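(* Let $p\ge1$, let $f\in\mathbb{C}[x_1,\dots,x_p]$ be a polynomial satisfying Mahler's Hypothesis, let $g\in\mathbb{C}[x_1,\dots,x_p]$ be any polynomial, and let $N\ge0$ be an integer. Put $m:=\deg(f)$ and $q:=\deg(g)$. Then the value at $s=-N$ of the analytic continuation of the zeta integral $Z(s;f,g)=\int_{[0,\infty)^p}g(x)f(x)^{-s}\,dx$ is $$Z(-N;f,g)=\frac1m\sum_{\lambda=N+\lceil p/m\rceil}^{q+p+Nm}\frac{(-1)^{\lambda-N}}{\lambda-N}\,\frac{1}{\binom{\lambda}{N}}\int_{\sigma\in\partial C_+^p}C_{\lambda,N}(\sigma)\,f_{\mathrm{top}}(\sigma)^N\,d\sigma,$$ where $\lceil p/m\rceil$ is the smallest integer $\ge p/m$, and $C_{\lambda,N}(\sigma)$ is the coefficient of $\rho^{-p-mN}$ in $g(\rho\sigma)\,r_f(\rho\sigma)^\lambda$, regarded for fixed $\sigma\in\partial C_+^p$ as a Laurent polynomial in $\rho$.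
   Context: Mahler's Hypothesis for $f\in\mathbb{C}[x_1,\dots,x_p]$: $f$ is non-constant, $f(x)\neq0$ for all $x\in[0,\infty)^p$, and the top-degree homogeneous part $f_{\mathrm{top}}$ of $f$ (the homogeneous part of degree $m=\deg(f)$) satisfies $f_{\mathrm{top}}(x)\ne0$ for all $x\in[0,\infty)^p\setminus\{0\}$. Here $\deg$ is the total degree. The zeta integral $Z(s;f,g)$ converges absolutely for $\mathrm{Re}(s)>(\deg(g)+p)/\deg(f)$; here $f(x)^{-s}:=e^{-s\log f(x)}$ with $\log f$ any continuous branch of the logarithm of $f$ on $[0,\infty)^p$ (values of the continuation at integers $s$ do not depend on the choice). By a known theorem of Mahler it extends to a meromorphic function of $s\in\mathbb{C}$, regular at all $s=0,-1,-2,\dots$. $\partial C_+^p:=\{x\in[0,\infty)^p:\max(x_1,\dots,x_p)=1\}$ is the part of the boundary of the unit hypercube $[0,1]^p$ where at least one coordinate equals $1$, and $d\sigma$ is its natural $(p-1)$-dimensional volume element, so that, writing $x=\rho\sigma$ with $\rho=\max_i x_i>0$ and $\sigma\in\partial C_+^p$, Lebesgue measure on $[0,\infty)^p$ is $dx=\rho^{p-1}\,d\rho\,d\sigma$. For $x\in[0,\infty)^p\setminus\{0\}$, $r_f(x):=\dfrac{f(x)-f_{\mathrm{top}}(x)}{f_{\mathrm{top}}(x)}$. Thus for $\rho>0$ and $\sigma\in\partial C_+^p$, $r_f(\rho\sigma)=\sum_{j=1}^{m}\dfrac{f_{(m-j)}(\sigma)}{\rho^{j}f_{\mathrm{top}}(\sigma)}$,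 where $f_{(i)}$ is the homogeneous part of $f$ of degree $i$. *)

theory Defs
  imports "HOL-Complex_Analysis.Complex_Analysis" "HOL-Library.Poly_Mapping"
begin

section \<open>Polynomials in the variables indexed by a finite type\<close>

text \<open>
  A monomial is its exponent vector \<open>'n \<Rightarrow>\<^sub>0 nat\<close>; the number of variables is \<open>CARD('n)\<close>.
\<close>

type_synonym 'n cpoly = "('n \<Rightarrow>\<^sub>0 nat) \<Rightarrow>\<^sub>0 complex"

definition mono_degree :: "('n::finite \<Rightarrow>\<^sub>0 nat) \<Rightarrow> nat" where
  "mono_degree a = (\<Sum>i\<in>UNIV. Poly_Mapping.lookup a i)"

definition mono_eval :: "('n::finite \<Rightarrow>\<^sub>0 nat) \<Rightarrow> real ^ 'n \<Rightarrow> complex" where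
  "mono_eval a x = (\<Prod>i\<in>UNIV. complex_of_real (x $ i) ^ Poly_Mapping.lookup a i)"

definition poly_eval :: "'n::finite cpoly \<Rightarrow> real ^ 'n \<Rightarrow> complex" where
  "poly_eval f x = (\<Sum>a\<in>Poly_Mapping.keys f. Poly_Mapping.lookup f a * mono_eval a x)"

text \<open>The zero polynomial is given total degree \<open>0\<close>.\<close>

definition total_degree :: "'n::finite cpoly \<Rightarrow> nat" where
  "total_degree f = Max (insert 0 (mono_degree ` Poly_Mapping.keys f))"

definition hom_part :: "nat \<Rightarrow> 'n::finite cpoly \<Rightarrow> 'n cpoly" where
  "hom_part i f =
     (\<Sum>a | a \<in> Poly_Mapping.keys f \<and> mono_degree a = i.
        Poly_Mapping.single a (Poly_Mapping.lookup f a))"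

definition top_part :: "'n::finite cpoly \<Rightarrow> 'n cpoly" where
  "top_part f = hom_part (total_degree f) f"

lemma lookup_hom_part:
  "Poly_Mapping.lookup (hom_part i f) a = (if mono_degree a = i then Poly_Mapping.lookup f a else 0)"
proof -
  let ?A = "{b. b \<in> Poly_Mapping.keys f \<and> mono_degree b = i}"
  have "Poly_Mapping.lookup (hom_part i f) a
        = (\<Sum>b\<in>?A. if b = a then Poly_Mapping.lookup f b else 0)"
    unfolding hom_part_def lookup_sum by (simp add: lookup_single when_def)
  also have "\<dots> = (if a \<in> ?A then Poly_Mapping.lookup f a else 0)"
    by (subst sum.delta) auto
  finally show ?thesis by (auto simp: in_keys_iff)
qed


section \<open>Mahler's Hypothesis and the zeta integral\<close>

definition orthant :: "(real ^ 'n::finite) set" where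
  "orthant = {x. \<forall>i. 0 \<le> x $ i}"

definition mahler_hypothesis :: "'n::finite cpoly \<Rightarrow> bool" where
  "mahler_hypothesis f \<longleftrightarrow>
     (\<nexists>c. f = Poly_Mapping.single 0 c) \<and>
     (\<forall>x\<in>orthant. poly_eval f x \<noteq> 0) \<and>
     (\<forall>x\<in>orthant - {0}. poly_eval (top_part f) x \<noteq> 0)"

definition log_branch :: "'n::finite cpoly \<Rightarrow> (real ^ 'n \<Rightarrow> complex) \<Rightarrow> bool" where
  "log_branch f L \<longleftrightarrow> continuous_on orthant L \<and> (\<forall>x\<in>orthant. exp (L x) = poly_eval f x)"

text \<open>The polynomial \<open>f\<close> enters the integral only through the branch \<open>L\<close> of its logarithm.\<close>

definition zeta_integral :: "'n::finite cpoly \<Rightarrow> (real ^ 'n \<Rightarrow> complex) \<Rightarrow> complex \<Rightarrow> complex" where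
  "zeta_integral g L s = (LINT x:orthant|lborel. poly_eval g x * exp (- s * L x))"

text \<open>
  The meromorphic continuation of the zeta integral to the whole plane. Functions that are
  \<open>nicely_meromorphic_on UNIV\<close> have the value \<open>0\<close> at poles and no removable singularities,
  so the continuation is unique as a function. A pole at a nonpositive integer is excluded.
\<close>

definition is_zeta_continuation ::
  "'n::finite cpoly \<Rightarrow> 'n cpoly \<Rightarrow> (real ^ 'n \<Rightarrow> complex) \<Rightarrow> (complex \<Rightarrow> complex) \<Rightarrow> bool" where
  "is_zeta_continuation f g L Z \<longleftrightarrow>
     Z nicely_meromorphic_on UNIV \<and>
     (\<forall>n::nat. Z analytic_on {- of_nat n}) \<and>
     (\<forall>s. Re s > real (total_degree g + CARD('n)) / real (total_degree f) \<longrightarrow>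
          Z s = zeta_integral g L s)"

definition zeta ::
  "'n::finite cpoly \<Rightarrow> 'n cpoly \<Rightarrow> (real ^ 'n \<Rightarrow> complex) \<Rightarrow> complex \<Rightarrow> complex" where
  "zeta f g L = (THE Z. is_zeta_continuation f g L Z)"

lemma is_zeta_continuation_unique:
  fixes f g :: "'n::finite cpoly"
  assumes Z: "is_zeta_continuation f g L Z" and W: "is_zeta_continuation f g L W"
  shows "Z = W"
proof -
  define D where "D = remove_sings (\<lambda>s. Z s - W s)"
  define a where "a = real (total_degree g + CARD('n)) / real (total_degree f)"
  note mer = Z[unfolded is_zeta_continuation_def, THEN conjunct1]
             W[unfolded is_zeta_continuation_def, THEN conjunct1]
  have mero: "(\<lambda>s. Z s - W s) meromorphic_on UNIV"
    using mer by (auto simp: nicely_meromorphic_on_def intro!: meromorphic_intros)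
  have D: "D nicely_meromorphic_on UNIV"
    unfolding D_def by (rule remove_sings_nicely_meromorphic[OF mero])
  have freq: "\<exists>\<^sub>F s in at (of_real (a + 1)). D s = 0"
  proof (rule eventually_frequently)
    have op: "open {s. Re s > a}" by (rule open_halfspace_Re_gt)
    have "D s = 0" if "Re s > a" for s
    proof -
      have "\<forall>\<^sub>F t in at s. Z t - W t = 0"
        unfolding eventually_at_topological
        using op that Z W by (intro exI[of _ "{s. Re s > a}"]) (auto simp: is_zeta_continuation_def a_def)
      then have "remove_sings (\<lambda>s. Z s - W s) s = remove_sings (\<lambda>_. 0) s"
        by (intro remove_sings_cong) auto
      then show ?thesis by (simp add: D_def)
    qed
    then show "\<forall>\<^sub>F s in at (of_real (a + 1)). D s = 0"
      unfolding eventually_at_topological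
      using op by (intro exI[of _ "{s. Re s > a}"]) auto
  qed simp
  have D0: "D s = 0" for s
    using frequently_eq_meromorphic_imp_constant[OF freq D] by auto
  have ev: "\<forall>\<^sub>F t in at s. Z t = W t" for s
  proof -
    have "isolated_singularity_at (\<lambda>s. Z s - W s) s"
      using meromorphic_on_isolated_singularity meromorphic_on_subset[OF mero] by blast
    then have "\<forall>\<^sub>F t in at s. remove_sings (\<lambda>s. Z s - W s) t = Z t - W t"
      by (rule eventually_remove_sings_eq_at)
    then show ?thesis by eventually_elim (use D0 in \<open>simp add: D_def\<close>)
  qed
  show ?thesis
  proof
    fix s
    have pole: "is_pole Z s \<longleftrightarrow> is_pole W s"
      by (rule is_pole_cong[OF ev refl])
    show "Z s = W s"
    proof (cases "is_pole Z s")
      case True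
      with pole mer show ?thesis
        unfolding nicely_meromorphic_on_def using not_tendsto_and_filterlim_at_infinity is_pole_def
        by (metis UNIV_I at_neq_bot)
    next
      case False
      with pole mer have "Z \<midarrow>s\<rightarrow> Z s" "W \<midarrow>s\<rightarrow> W s"
        by (auto simp: nicely_meromorphic_on_def)
      moreover have "Z \<midarrow>s\<rightarrow> W s"
        using tendsto_cong[OF ev] \<open>W \<midarrow>s\<rightarrow> W s\<close> by auto
      ultimately show ?thesis by (metis LIM_unique)
    qed
  qed
qed


section \<open>The boundary of the unit hypercube\<close>

definition cube_boundary :: "(real ^ 'n::finite) set" where
  "cube_boundary = {x \<in> orthant. Max (range (($) x)) = 1}"

text \<open>
  \<open>(p-1)\<close>-dimensional Lebesgue measure on the hyperplane \<open>x $ i = 1\<close>, and the sum of these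
  measures over all \<open>i\<close>. Each point of \<open>cube_boundary\<close> lies on one of these hyperplanes, and
  the points lying on several of them form a null set.
\<close>

definition face_param :: "'n::finite \<Rightarrow> ('n \<Rightarrow> real) \<Rightarrow> real ^ 'n" where
  "face_param i y = (\<chi> j. if j = i then 1 else y j)"

definition face_volume :: "'n::finite \<Rightarrow> (real ^ 'n) measure" where
  "face_volume i = distr (Pi\<^sub>M (UNIV - {i}) (\<lambda>_. lborel)) borel (face_param i)"

definition boundary_volume :: "(real ^ 'n::finite) measure" where
  "boundary_volume = measure_of UNIV (sets borel) (\<lambda>A. \<Sum>i\<in>UNIV. emeasure (face_volume i) A)"

lemma sets_boundary_volume [measurable_cong]: "sets boundary_volume = sets borel"
  by (simp add: boundary_volume_def sets.sigma_sets_eq[of borel, simplified])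

lemma emeasure_boundary_volume:
  fixes A :: "(real ^ 'n::finite) set"
  assumes "A \<in> sets borel"
  shows "emeasure boundary_volume A = (\<Sum>i\<in>UNIV. emeasure (face_volume i) A)"
  unfolding boundary_volume_def
proof (rule emeasure_measure_of_sigma)
  show "sigma_algebra UNIV (sets (borel :: (real ^ 'n) measure))"
    using sets.sigma_algebra_axioms[of "borel :: (real ^ 'n) measure"] by simp
  show "positive (sets borel) (\<lambda>A. \<Sum>i\<in>(UNIV :: 'n set). emeasure (face_volume i) A)"
    by (simp add: positive_def)
  show "countably_additive (sets borel) (\<lambda>A. \<Sum>i\<in>(UNIV :: 'n set). emeasure (face_volume i) A)"
  proof (rule countably_additiveI)
    fix B :: "nat \<Rightarrow> (real ^ 'n) set"
    assume B: "range B \<subseteq> sets borel" "disjoint_family B"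
    have "suminf (\<lambda>k. \<Sum>i\<in>(UNIV :: 'n set). emeasure (face_volume i) (B k))
          = (\<Sum>i\<in>(UNIV :: 'n set). suminf (\<lambda>k. emeasure (face_volume i) (B k)))"
      by (rule suminf_sum) auto
    also have "\<dots> = (\<Sum>i\<in>(UNIV :: 'n set). emeasure (face_volume i) (\<Union>k. B k))"
      using B by (intro sum.cong refl suminf_emeasure) (simp_all add: face_volume_def)
    finally show "suminf (\<lambda>k. \<Sum>i\<in>(UNIV :: 'n set). emeasure (face_volume i) (B k))
          = (\<Sum>i\<in>(UNIV :: 'n set). emeasure (face_volume i) (\<Union>k. B k))" .
  qed
qed (rule assms)


section \<open>Laurent polynomials along rays\<close>

definition r_fun :: "'n::finite cpoly \<Rightarrow> real ^ 'n \<Rightarrow> complex" where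
  "r_fun f x = (poly_eval f x - poly_eval (top_part f) x) / poly_eval (top_part f) x"

text \<open>
  Laurent polynomials over the complex numbers, as finitely supported functions on the integers
  with the convolution product.
\<close>

type_synonym laurent = "int \<Rightarrow>\<^sub>0 complex"

definition laurent_eval :: "laurent \<Rightarrow> real \<Rightarrow> complex" where
  "laurent_eval P \<rho> = (\<Sum>k\<in>Poly_Mapping.keys P. Poly_Mapping.lookup P k * complex_of_real \<rho> powi k)"

definition ray_poly :: "'n::finite cpoly \<Rightarrow> real ^ 'n \<Rightarrow> laurent" where
  "ray_poly g \<sigma> =
     (\<Sum>i\<le>total_degree g. Poly_Mapping.single (int i) (poly_eval (hom_part i g) \<sigma>))"

definition ray_r :: "'n::finite cpoly \<Rightarrow> real ^ 'n \<Rightarrow> laurent" where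
  "ray_r f \<sigma> =
     (\<Sum>j=1..total_degree f. Poly_Mapping.single (- int j)
        (poly_eval (hom_part (total_degree f - j) f) \<sigma> / poly_eval (top_part f) \<sigma>))"

definition C_coeff :: "'n::finite cpoly \<Rightarrow> 'n cpoly \<Rightarrow> nat \<Rightarrow> nat \<Rightarrow> real ^ 'n \<Rightarrow> complex" where
  "C_coeff f g l N \<sigma> =
     Poly_Mapping.lookup (ray_poly g \<sigma> * ray_r f \<sigma> ^ l)
       (- int CARD('n) - int (total_degree f * N))"

text \<open>
  The Laurent polynomials \<open>ray_poly g \<sigma>\<close> and \<open>ray_r f \<sigma>\<close> represent the functions
  \<open>\<rho> \<mapsto> g(\<rho>\<sigma>)\<close> and \<open>\<rho> \<mapsto> r\<^sub>f(\<rho>\<sigma>)\<close>.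
\<close>

lemma laurent_eval_supset:
  assumes "finite K" "Poly_Mapping.keys P \<subseteq> K"
  shows "laurent_eval P \<rho> = (\<Sum>k\<in>K. Poly_Mapping.lookup P k * complex_of_real \<rho> powi k)"
  unfolding laurent_eval_def using assms
  by (intro sum.mono_neutral_left) (auto simp: in_keys_iff)

lemma laurent_eval_add: "laurent_eval (P + Q) \<rho> = laurent_eval P \<rho> + laurent_eval Q \<rho>"
proof -
  let ?K = "Poly_Mapping.keys P \<union> Poly_Mapping.keys Q"
  have "Poly_Mapping.keys (P + Q) \<subseteq> ?K"
    by (rule Poly_Mapping.keys_add)
  then show ?thesis
    by (simp add: laurent_eval_supset[of ?K] lookup_add sum.distrib algebra_simps)
qed

lemma laurent_eval_single:
  "laurent_eval (Poly_Mapping.single k c) \<rho> = c * complex_of_real \<rho> powi k"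
  by (simp add: laurent_eval_supset[of "{k}"])

lemma laurent_eval_sum: "laurent_eval (\<Sum>i\<in>I. P i) \<rho> = (\<Sum>i\<in>I. laurent_eval (P i) \<rho>)"
  by (induction I rule: infinite_finite_induct)
     (auto simp: laurent_eval_add, auto simp: laurent_eval_def)

lemma laurent_eval_mult:
  assumes "\<rho> \<noteq> 0"
  shows "laurent_eval (P * Q) \<rho> = laurent_eval P \<rho> * laurent_eval Q \<rho>"
proof -
  have decomp: "R = (\<Sum>k\<in>Poly_Mapping.keys R. Poly_Mapping.single k (Poly_Mapping.lookup R k))"
    for R :: laurent
    by (rule poly_mapping_eqI)
       (auto simp: lookup_sum lookup_single when_def in_keys_iff sum.delta)
  have "P * Q = (\<Sum>k\<in>Poly_Mapping.keys P. \<Sum>l\<in>Poly_Mapping.keys Q.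
           Poly_Mapping.single (k + l) (Poly_Mapping.lookup P k * Poly_Mapping.lookup Q l))"
    by (subst decomp[of P], subst decomp[of Q]) (simp add: sum_product mult_single)
  then show ?thesis
    using assms
    by (simp add: laurent_eval_sum laurent_eval_single laurent_eval_def[of P]
          laurent_eval_def[of Q] sum_product power_int_add algebra_simps)
qed

lemma poly_eval_hom_part:
  "poly_eval (hom_part i f) x =
     (\<Sum>a | a \<in> Poly_Mapping.keys f \<and> mono_degree a = i. Poly_Mapping.lookup f a * mono_eval a x)"
proof -
  have "Poly_Mapping.keys (hom_part i f) = {a \<in> Poly_Mapping.keys f. mono_degree a = i}"
    by (auto simp: in_keys_iff lookup_hom_part split: if_splits)
  then show ?thesis
    unfolding poly_eval_def by (auto simp: lookup_hom_part intro!: sum.cong)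
qed

lemma mono_eval_scaleR:
  "mono_eval a (\<rho> *\<^sub>R x) = complex_of_real \<rho> ^ mono_degree a * mono_eval a x"
  by (simp add: mono_eval_def mono_degree_def power_mult_distrib prod.distrib power_sum)

lemma poly_eval_hom_part_scaleR:
  "poly_eval (hom_part i f) (\<rho> *\<^sub>R x) = complex_of_real \<rho> ^ i * poly_eval (hom_part i f) x"
  by (auto simp: poly_eval_hom_part mono_eval_scaleR sum_distrib_left intro!: sum.cong)

lemma mono_degree_le_total_degree:
  "a \<in> Poly_Mapping.keys f \<Longrightarrow> mono_degree a \<le> total_degree f"
  by (simp add: total_degree_def)

lemma poly_eval_eq_sum_hom_part:
  "poly_eval f x = (\<Sum>i\<le>total_degree f. poly_eval (hom_part i f) x)"
proof -
  have "(\<Sum>i\<le>total_degree f. \<Sum>a | a \<in> Poly_Mapping.keys f \<and> mono_degree a = i.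
           Poly_Mapping.lookup f a * mono_eval a x)
        = (\<Sum>a\<in>Poly_Mapping.keys f. Poly_Mapping.lookup f a * mono_eval a x)"
    by (rule sum.group) (auto simp: mono_degree_le_total_degree)
  then show ?thesis by (simp add: poly_eval_hom_part poly_eval_def[of f])
qed

lemma laurent_eval_ray_poly: "laurent_eval (ray_poly g \<sigma>) \<rho> = poly_eval g (\<rho> *\<^sub>R \<sigma>)"
  by (simp add: ray_poly_def laurent_eval_sum laurent_eval_single poly_eval_hom_part_scaleR
        poly_eval_eq_sum_hom_part[of g "\<rho> *\<^sub>R \<sigma>"] mult.commute)

lemma laurent_eval_ray_r:
  assumes "\<rho> > 0"
  shows "laurent_eval (ray_r f \<sigma>) \<rho> = r_fun f (\<rho> *\<^sub>R \<sigma>)"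
proof -
  define m where "m = total_degree f"
  have "poly_eval f (\<rho> *\<^sub>R \<sigma>) =
        poly_eval (top_part f) (\<rho> *\<^sub>R \<sigma>) + (\<Sum>i<m. poly_eval (hom_part i f) (\<rho> *\<^sub>R \<sigma>))"
    unfolding poly_eval_eq_sum_hom_part[of f] top_part_def m_def
    by (simp flip: lessThan_Suc_atMost)
  moreover have "(\<Sum>i<m. poly_eval (hom_part i f) (\<rho> *\<^sub>R \<sigma>)) =
        (\<Sum>j=1..m. poly_eval (hom_part (m - j) f) (\<rho> *\<^sub>R \<sigma>))"
    by (rule sum.reindex_bij_witness[of _ "\<lambda>j. m - j" "\<lambda>i. m - i"]) auto
  ultimately have "r_fun f (\<rho> *\<^sub>R \<sigma>) = (\<Sum>j=1..m. poly_eval (hom_part (m - j) f) (\<rho> *\<^sub>R \<sigma>) /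
        poly_eval (top_part f) (\<rho> *\<^sub>R \<sigma>))"
    by (simp add: r_fun_def sum_divide_distrib)
  also have "\<dots> = (\<Sum>j=1..m. poly_eval (hom_part (m - j) f) \<sigma> / poly_eval (top_part f) \<sigma> *
        complex_of_real \<rho> powi (- int j))"
  proof (rule sum.cong[OF refl])
    fix j assume "j \<in> {1..m}"
    then have "complex_of_real \<rho> ^ m = complex_of_real \<rho> ^ (m - j) * complex_of_real \<rho> ^ j"
      by (simp flip: power_add)
    with assms show "poly_eval (hom_part (m - j) f) (\<rho> *\<^sub>R \<sigma>) / poly_eval (top_part f) (\<rho> *\<^sub>R \<sigma>) =
        poly_eval (hom_part (m - j) f) \<sigma> / poly_eval (top_part f) \<sigma> *
        complex_of_real \<rho> powi (- int j)"
      by (simp add: poly_eval_hom_part_scaleR top_part_def power_int_minus divide_inverse flip: m_def)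
  qed
  finally show ?thesis
    by (simp add: ray_r_def laurent_eval_sum laurent_eval_single flip: m_def)
qed

end

theory Submission
  imports Defs
begin

text \<open>
  Let \<open>p\<close> be the number of variables, \<open>m\<close> the degree of \<open>f\<close>, and let \<open>G\<close> be homogeneous of degree
  \<open>d\<close>. Integrating \<open>d/d\<rho> (\<rho>\<^sup>p (G f\<^sup>-\<^sup>s)(\<rho>\<sigma>))\<close> over rays gives
  \<open>(m s - p - d) Z(s; G) = s \<Sum>\<^sub>j j Z(s + 1; G f\<^sub>(\<^sub>m\<^sub>-\<^sub>j\<^sub>))\<close>, where the integrals on the right converge in a
  half plane that is larger by \<open>1/m\<close>. Hence \<open>U(s; G) = \<Gamma>(s) Z(s; G) / \<Gamma>(m s - p - d)\<close> extends to an
  entire function with \<open>U(s; G) = \<Sum>\<^sub>j j (m s - p - d + 1)\<^sub>j\<^sub>-\<^sub>1 U(s + 1; G f\<^sub>(\<^sub>m\<^sub>-\<^sub>j\<^sub>))\<close>, a Pochhammer symbol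
  being the middle factor. At an integer \<open>s\<close> this recurrence runs through \<open>T = p + d - m s\<close> and stops
  at \<open>T = 0\<close>, where the ray integral has a nonzero boundary term at infinity,
  \<open>U(s; G) = \<Gamma>(s) \<integral> G f\<^sub>t\<^sub>o\<^sub>p\<^sup>-\<^sup>s d\<sigma>\<close>. The coefficients \<open>c\<^sub>n(T)\<close> of \<open>\<rho>\<^sup>-\<^sup>T\<close> in \<open>r\<^sub>f(\<rho>\<sigma>)\<^sup>n\<close> satisfy the
  matching recurrence \<open>T c\<^sub>n(T) = n \<Sum>\<^sub>j j a\<^sub>j c\<^sub>n\<^sub>-\<^sub>1(T - j)\<close>, which solves it. Finally
  \<open>Z = U \<Gamma>(m s - p - d) / \<Gamma>(s)\<close>, and at \<open>s = -N\<close> the pole of the numerator cancels the zero of \<open>1 / \<Gamma>(s)\<close>.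
\<close>

unbundle no fps_syntax

section \<open>Polar coordinates with respect to the cube boundary\<close>

text \<open>Everything is done for homogeneous numerators \<open>G\<close>: with a single degree
  \<open>d\<close>, the derivative along rays is a combination of integrals of the same kind, and
  the products of \<open>G\<close> with parts of \<open>f\<close> are again homogeneous, so the
  family is closed under the recurrence. \<open>g\<close> is split into homogeneous parts only at
  the end. Two obstacles shape the rest. As \<open>f\<close> is complex valued, the modulus of
  \<open>exp (- s * L x)\<close> depends on \<open>Im (L x)\<close>, so convergence needs this to be
  bounded; both nonvanishing conditions in Mahler's Hypothesis enter there, through a
  compactification. And solving the recurrence for \<open>Z\<close> means dividing by
  \<open>m s - p - d\<close>, which produces new poles at every step. The Gamma factors absorb them:
  passing from \<open>(s, d)\<close> to \<open>(s + 1, d + m - j)\<close> shifts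
  \<open>m s - p - d\<close> by exactly \<open>j\<close>, so quotients of reciprocal Gammas are
  polynomials. For integer \<open>s\<close> the recursion ends on the line
  \<open>m s = p + d\<close>, where \<open>Z(s; G)\<close> need not converge, but its coefficient
  vanishes and the integrals on the right do converge.\<close>

lemma lborel_vec_eq_distr_PiM:
  "(lborel :: (real ^ 'n::finite) measure) = distr (Pi\<^sub>M UNIV (\<lambda>_. lborel)) borel vec_lambda"
proof (rule lborel_eqI)
  interpret product_sigma_finite "\<lambda>_::'n. lborel :: real measure" ..
  have [measurable]: "(vec_lambda :: _ \<Rightarrow> real ^ 'n) \<in> borel_measurable (Pi\<^sub>M UNIV (\<lambda>_. lborel))"
    by (subst borel_measurable_euclidean_space) (auto simp: Basis_vec_def inner_axis)
  fix l u :: "real ^ 'n"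
  assume le: "\<And>b. b \<in> Basis \<Longrightarrow> l \<bullet> b \<le> u \<bullet> b"
  then have le': "l $ i \<le> u $ i" for i
    using le[of "axis i 1"] by (auto simp: Basis_vec_def inner_axis)
  have "vec_lambda -` box l u \<inter> space (Pi\<^sub>M UNIV (\<lambda>_. lborel :: real measure)) =
      (\<Pi>\<^sub>E i\<in>UNIV. {l $ i<..<u $ i})"
    by (auto simp: space_PiM mem_box_cart PiE_def Pi_def)
  then have "emeasure (distr (Pi\<^sub>M UNIV (\<lambda>_. lborel)) borel vec_lambda) (box l u) =
      (\<Prod>i\<in>UNIV. ennreal (u $ i - l $ i))"
    using le' by (simp add: emeasure_distr emeasure_PiM)
  also have "\<dots> = (\<Prod>b\<in>Basis. (u - l) \<bullet> b)"
    using le' by (subst prod_ennreal) (auto simp: axis_index prod.reindex Basis_vec_def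
        inner_axis inj_on_def axis_eq_axis UNION_singleton_eq_range)
  finally show "emeasure (distr (Pi\<^sub>M UNIV (\<lambda>_. lborel)) borel vec_lambda) (box l u) =
      (\<Prod>b\<in>Basis. (u - l) \<bullet> b)" .
qed simp

lemma measurable_vec_lambda [measurable]:
  "(vec_lambda :: _ \<Rightarrow> real ^ 'n::finite) \<in> borel_measurable (Pi\<^sub>M UNIV (\<lambda>_. lborel))"
  by (subst borel_measurable_euclidean_space) (auto simp: Basis_vec_def inner_axis)

lemma measurable_face_param [measurable]:
  "face_param i \<in> borel_measurable (Pi\<^sub>M (UNIV - {i}) (\<lambda>_. lborel))"
proof (subst borel_measurable_euclidean_space, intro ballI)
  fix b :: "real ^ 'a" assume "b \<in> Basis"
  then obtain j where b: "b = axis j 1"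
    by (auto simp: Basis_vec_def)
  show "(\<lambda>y. face_param i y \<bullet> b) \<in> borel_measurable (Pi\<^sub>M (UNIV - {i}) (\<lambda>_. lborel))"
    unfolding b by (cases "j = i") (auto simp: face_param_def inner_axis)
qed

lemma measurable_vec_nth [measurable]: "(\<lambda>x :: real ^ 'n::finite. x $ i) \<in> borel_measurable borel"
  by (intro borel_measurable_continuous_onI continuous_intros)

text \<open>The Jacobian of a dilation, one coordinate at a time. With all indices but one in
  \<open>I\<close> it yields the factor \<open>t ^ (p - 1)\<close> of polar coordinates. The
  restricted lambda keeps the dilated point in the extensional space of the product measure.\<close>

lemma nn_integral_PiM_lborel_scale:
  fixes F :: "('i \<Rightarrow> real) \<Rightarrow> ennreal"
  assumes "finite I" and "F \<in> borel_measurable (Pi\<^sub>M I (\<lambda>_. lborel))" and t: "t > 0"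
  shows "(\<integral>\<^sup>+y. F y \<partial>Pi\<^sub>M I (\<lambda>_. lborel)) =
    ennreal (t ^ card I) * (\<integral>\<^sup>+y. F (\<lambda>j\<in>I. t * y j) \<partial>Pi\<^sub>M I (\<lambda>_. lborel))"
  using assms(1,2)
proof (induction I arbitrary: F rule: finite_induct)
  case empty
  interpret product_sigma_finite "\<lambda>_::'i. lborel :: real measure" ..
  show ?case
    by (simp add: nn_integral_empty empty space_PiM_empty)
next
  case (insert i I)
  interpret product_sigma_finite "\<lambda>_::'i. lborel :: real measure" ..
  note [measurable] = insert.prems
  let ?P = "Pi\<^sub>M I (\<lambda>_. lborel :: real measure)"
  let ?s = "\<lambda>I y. \<lambda>j\<in>I. t * y j :: real"
  have [measurable]: "?s J \<in> measurable (Pi\<^sub>M J (\<lambda>_. lborel)) (Pi\<^sub>M J (\<lambda>_. lborel))" for J :: "'i set"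
    by (rule measurable_restrict) measurable
  have upd: "(?s I x)(i := t * y) = ?s (insert i I) (x(i := y))" for x y
    using insert.hyps by (auto simp: fun_eq_iff restrict_def)
  have ms: "(\<lambda>y. F ((?s I x)(i := y))) \<in> borel_measurable borel" if "x \<in> space ?P" for x
  proof -
    have *: "?s I x \<in> space ?P" by (auto simp: space_PiM)
    have "(\<lambda>y. (?s I x)(i := y)) \<in> measurable lborel (Pi\<^sub>M (insert i I) (\<lambda>_. lborel))"
      by (rule measurable_component_update[OF * insert.hyps(2)])
    then show ?thesis by measurable
  qed
  have "(\<integral>\<^sup>+y. F y \<partial>Pi\<^sub>M (insert i I) (\<lambda>_. lborel)) = (\<integral>\<^sup>+x. \<integral>\<^sup>+y. F (x(i := y)) \<partial>lborel \<partial>?P)"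
    using insert by (intro product_nn_integral_insert) auto
  also have "\<dots> = ennreal (t ^ card I) * (\<integral>\<^sup>+x. \<integral>\<^sup>+y. F ((?s I x)(i := y)) \<partial>lborel \<partial>?P)"
    by (intro insert.IH) measurable
  also have "(\<integral>\<^sup>+x. \<integral>\<^sup>+y. F ((?s I x)(i := y)) \<partial>lborel \<partial>?P) =
      (\<integral>\<^sup>+x. ennreal t * \<integral>\<^sup>+y. F ((?s I x)(i := t * y)) \<partial>lborel \<partial>?P)"
  proof (rule nn_integral_cong)
    fix x assume "x \<in> space ?P"
    from nn_integral_real_affine[OF ms[OF this], of t 0] t
    show "(\<integral>\<^sup>+y. F ((?s I x)(i := y)) \<partial>lborel) = ennreal t * \<integral>\<^sup>+y. F ((?s I x)(i := t * y)) \<partial>lborel"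
      by simp
  qed
  also have "\<dots> = ennreal t * (\<integral>\<^sup>+x. \<integral>\<^sup>+y. F (?s (insert i I) (x(i := y))) \<partial>lborel \<partial>?P)"
    unfolding upd by (intro nn_integral_cmult) measurable
  also have "(\<integral>\<^sup>+x. \<integral>\<^sup>+y. F (?s (insert i I) (x(i := y))) \<partial>lborel \<partial>?P) =
      (\<integral>\<^sup>+y. F (?s (insert i I) y) \<partial>Pi\<^sub>M (insert i I) (\<lambda>_. lborel))"
    using insert by (intro product_nn_integral_insert[symmetric]) auto
  finally show ?case
    using insert.hyps t by (simp add: ennreal_mult' mult.assoc mult.left_commute del: restrict_apply)
qed

lemma AE_lborel_vec_nth_neq: "AE x in lborel. (x :: real ^ 'n::finite) $ i \<noteq> c"
proof -
  have "negligible {x :: real ^ 'n. axis i 1 \<bullet> x = c}"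
    by (rule negligible_hyperplane) simp
  then have "{x :: real ^ 'n. axis i 1 \<bullet> x = c} \<in> null_sets lborel"
    by (simp add: negligible_iff_null_sets null_sets_completion_iff closed_hyperplane borel_closed)
  then show ?thesis
    by (rule AE_I') (auto simp: inner_axis')
qed

text \<open>Ties between coordinates are negligible, so the pyramids over the faces of the cube
  overlap only in a null set.\<close>

lemma AE_lborel_vec_nth_distinct:
  assumes "i \<noteq> j"
  shows "AE x in lborel. (x :: real ^ 'n::finite) $ i \<noteq> x $ j"
proof -
  have "negligible {x :: real ^ 'n. (axis i 1 - axis j 1) \<bullet> x = 0}"
    using assms by (intro negligible_hyperplane) (auto simp: axis_eq_axis)
  then have "{x :: real ^ 'n. (axis i 1 - axis j 1) \<bullet> x = 0} \<in> null_sets lborel"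
    by (simp add: negligible_iff_null_sets null_sets_completion_iff closed_hyperplane borel_closed)
  then show ?thesis
    by (rule AE_I') (auto simp: inner_axis' inner_diff_left)
qed

lemma closed_orthant: "closed (orthant :: (real ^ 'n::finite) set)"
  unfolding orthant_def by (intro closed_Collect_all closed_Collect_le continuous_intros)

lemma measurable_orthant [measurable]: "(orthant :: (real ^ 'n::finite) set) \<in> sets borel"
  by (intro borel_closed closed_orthant)

lemma cube_boundary_iff:
  "x \<in> cube_boundary \<longleftrightarrow> (\<forall>i. 0 \<le> x $ i \<and> x $ i \<le> 1) \<and> (\<exists>i. x $ i = 1)"
proof -
  have "Max (range (($) x)) = 1 \<longleftrightarrow> (\<forall>i. x $ i \<le> 1) \<and> (\<exists>i. x $ i = 1)"
    by (subst Max_eq_iff) (simp_all add: image_iff, metis)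
  then show ?thesis by (auto simp: cube_boundary_def orthant_def)
qed

lemma compact_cube_boundary: "compact (cube_boundary :: (real ^ 'n::finite) set)"
proof -
  have "(cube_boundary :: (real ^ 'n) set) = cbox 0 1 \<inter> (\<Union>i. {x. x $ i = 1})"
    by (auto simp: cube_boundary_iff mem_box_cart)
  moreover have "closed (\<Union>i. {x :: real ^ 'n. x $ i = 1})"
    by (intro closed_UN) (auto intro!: closed_Collect_eq continuous_intros)
  ultimately show ?thesis
    by (metis compact_Int_closed compact_cbox)
qed

lemma measurable_cube_boundary [measurable]: "(cube_boundary :: (real ^ 'n::finite) set) \<in> sets borel"
  by (intro borel_compact compact_cube_boundary)

text \<open>\<open>boundary_volume\<close> is specified by its values on sets, so additivity over
  the faces is carried to integrals by induction on measurable functions.\<close>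

lemma nn_integral_boundary_volume:
  fixes F :: "real ^ 'n::finite \<Rightarrow> ennreal"
  assumes [measurable]: "F \<in> borel_measurable borel"
  shows "(\<integral>\<^sup>+x. F x \<partial>boundary_volume) =
    (\<Sum>i\<in>UNIV. \<integral>\<^sup>+y. F (face_param i y) \<partial>Pi\<^sub>M (UNIV - {i}) (\<lambda>_. lborel))"
proof -
  have "(\<integral>\<^sup>+x. F x \<partial>boundary_volume) = (\<Sum>i\<in>UNIV. \<integral>\<^sup>+x. F x \<partial>face_volume i)"
    using assms
  proof (induction F rule: borel_measurable_induct)
    case (cong f g)
    have "f = g" using cong by (simp add: fun_eq_iff)
    then show ?case using cong by simp
  next
    case (set A)
    then show ?case
      by (simp add: emeasure_boundary_volume face_volume_def sets_boundary_volume)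
  next
    case (mult u c)
    then show ?case
      by (simp add: nn_integral_cmult sum_distrib_left face_volume_def sets_boundary_volume
          measurable_cong_sets[OF sets_boundary_volume refl])
  next
    case (add u v)
    then show ?case
      by (simp add: nn_integral_add sum.distrib face_volume_def
          measurable_cong_sets[OF sets_boundary_volume refl])
  next
    case (seq U)
    have m: "U k \<in> borel_measurable boundary_volume" "U k \<in> borel_measurable (face_volume i)" for k i
      using seq(1)[of k] by (simp_all add: face_volume_def measurable_cong_sets[OF sets_boundary_volume refl])
    have Sup: "Sup (range U) = (\<lambda>x. SUP k. U k x)"
      by (auto simp: fun_eq_iff image_image)
    have eq: "(\<integral>\<^sup>+x. Sup (range U) x \<partial>M) = (SUP k. \<integral>\<^sup>+x. U k x \<partial>M)"
      if "\<And>k. U k \<in> borel_measurable M" for M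
      unfolding Sup using seq that by (intro nn_integral_monotone_convergence_SUP)
    have "(\<integral>\<^sup>+x. Sup (range U) x \<partial>boundary_volume) =
        (SUP k. \<Sum>i\<in>UNIV. \<integral>\<^sup>+x. U k x \<partial>face_volume i)"
      by (subst eq) (simp_all add: m seq)
    also have "\<dots> = (\<Sum>i\<in>UNIV. SUP k. \<integral>\<^sup>+x. U k x \<partial>face_volume i)"
      using seq by (intro ennreal_SUP_sum) (auto simp: incseq_def le_fun_def intro!: nn_integral_mono)
    also have "\<dots> = (\<Sum>i\<in>UNIV. \<integral>\<^sup>+x. Sup (range U) x \<partial>face_volume i)"
      by (intro sum.cong refl eq[symmetric]) (simp add: m)
    finally show ?case .
  qed
  also have "\<dots> = (\<Sum>i\<in>UNIV. \<integral>\<^sup>+y. F (face_param i y) \<partial>Pi\<^sub>M (UNIV - {i}) (\<lambda>_. lborel))"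
    unfolding face_volume_def by (intro sum.cong refl nn_integral_distr) auto
  finally show ?thesis .
qed

text \<open>The orthant is cut into pyramids, one for each index of a largest coordinate. On the
  pyramid over face \<open>i\<close> the radius is the coordinate \<open>x $ i\<close> itself, so
  splitting off this coordinate and dilating the others by it is the whole change of
  variables.\<close>

lemma nn_integral_polar:
  fixes F :: "real ^ 'n::finite \<Rightarrow> ennreal"
  assumes [measurable]: "F \<in> borel_measurable borel"
  shows "(\<integral>\<^sup>+x. indicator orthant x * F x \<partial>lborel) =
    (\<integral>\<^sup>+\<sigma>. indicator cube_boundary \<sigma> *
       (\<integral>\<^sup>+t. indicator {0<..} t * (ennreal (t ^ (CARD('n) - 1)) * F (t *\<^sub>R \<sigma>)) \<partial>lborel) \<partial>boundary_volume)"
proof -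
  interpret product_sigma_finite "\<lambda>_::'n. lborel :: real measure" ..
  define S :: "'n \<Rightarrow> (real ^ 'n) set" where "S i = {x \<in> orthant. 0 < x $ i \<and> (\<forall>j. x $ j \<le> x $ i)}" for i
  have [measurable]: "S i \<in> sets borel" for i
    unfolding S_def by measurable
  let ?P = "\<lambda>i::'n. Pi\<^sub>M (UNIV - {i}) (\<lambda>_. lborel :: real measure)"
  have region: "(\<integral>\<^sup>+x. indicator (S i) x * F x \<partial>lborel) =
      (\<integral>\<^sup>+y. indicator cube_boundary (face_param i y) * (\<integral>\<^sup>+t. indicator {0<..} t *
        (ennreal (t ^ (CARD('n) - 1)) * F (t *\<^sub>R face_param i y)) \<partial>lborel) \<partial>?P i)" for i
  proof -
    have ins: "insert i (UNIV - {i}) = UNIV" by auto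
    let ?F = "\<lambda>x. indicator (S i) x * F x"
    have vl [measurable]: "(\<lambda>y. ?F (vec_lambda y)) \<in> borel_measurable (Pi\<^sub>M UNIV (\<lambda>_. lborel))"
      by measurable
    have pair [measurable]:
      "(\<lambda>(t, y). t *\<^sub>R face_param i y) \<in> borel_measurable (lborel \<Otimes>\<^sub>M ?P i)"
      by measurable
    have "(\<integral>\<^sup>+x. ?F x \<partial>lborel) = (\<integral>\<^sup>+y. ?F (vec_lambda y) \<partial>Pi\<^sub>M UNIV (\<lambda>_. lborel))"
      by (subst lborel_vec_eq_distr_PiM) (simp add: nn_integral_distr)
    also have "\<dots> = (\<integral>\<^sup>+t. (\<integral>\<^sup>+y. ?F (vec_lambda (y(i := t))) \<partial>?P i) \<partial>lborel)"
      using product_nn_integral_insert_rev[of "UNIV - {i}" i "\<lambda>y. ?F (vec_lambda y)"]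
      unfolding ins by simp
    also have "\<dots> = (\<integral>\<^sup>+t. (\<integral>\<^sup>+y. indicator cube_boundary (face_param i y) *
        (indicator {0<..} t * (ennreal (t ^ (CARD('n) - 1)) * F (t *\<^sub>R face_param i y))) \<partial>?P i) \<partial>lborel)"
    proof (rule nn_integral_cong)
      fix t :: real
      show "(\<integral>\<^sup>+y. ?F (vec_lambda (y(i := t))) \<partial>?P i) = (\<integral>\<^sup>+y. indicator cube_boundary (face_param i y) *
        (indicator {0<..} t * (ennreal (t ^ (CARD('n) - 1)) * F (t *\<^sub>R face_param i y))) \<partial>?P i)"
      proof (cases "t > 0")
        case False
        then have "vec_lambda (y(i := t)) \<notin> S i" for y
          by (auto simp: S_def)
        with False show ?thesis by simp
      next
        case t: True
        have "(\<lambda>y. y(i := t)) \<in> measurable (?P i) (Pi\<^sub>M (insert i (UNIV - {i})) (\<lambda>_. lborel))"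
          by (intro measurable_fun_upd[where J = "UNIV - {i}"]) auto
        then have [measurable]: "(\<lambda>y. y(i := t)) \<in> measurable (?P i) (Pi\<^sub>M UNIV (\<lambda>_. lborel))"
          by (simp only: ins)
        have "(\<lambda>y. ?F (vec_lambda (y(i := t)))) \<in> borel_measurable (?P i)"
          by measurable
        then have "(\<integral>\<^sup>+y. ?F (vec_lambda (y(i := t))) \<partial>?P i) = ennreal (t ^ (CARD('n) - 1)) *
            (\<integral>\<^sup>+y. ?F (vec_lambda ((\<lambda>j\<in>UNIV - {i}. t * y j)(i := t))) \<partial>?P i)"
          using t by (subst nn_integral_PiM_lborel_scale[of _ _ t]) (auto simp: card_Diff_singleton)
        also have "(\<lambda>y. vec_lambda ((\<lambda>j\<in>UNIV - {i}. t * y j)(i := t))) = (\<lambda>y. t *\<^sub>R face_param i y)"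
          by (auto simp: fun_eq_iff vec_eq_iff face_param_def)
        hence "(\<integral>\<^sup>+y. ?F (vec_lambda ((\<lambda>j\<in>UNIV - {i}. t * y j)(i := t))) \<partial>?P i) =
            (\<integral>\<^sup>+y. ?F (t *\<^sub>R face_param i y) \<partial>?P i)"
          by (simp add: fun_eq_iff)
        also have "ennreal (t ^ (CARD('n) - 1)) * \<dots> =
            (\<integral>\<^sup>+y. ennreal (t ^ (CARD('n) - 1)) * ?F (t *\<^sub>R face_param i y) \<partial>?P i)"
          by (subst nn_integral_cmult) measurable
        also have "\<dots> = (\<integral>\<^sup>+y. indicator cube_boundary (face_param i y) *
        (indicator {0<..} t * (ennreal (t ^ (CARD('n) - 1)) * F (t *\<^sub>R face_param i y))) \<partial>?P i)"
        proof (rule nn_integral_cong)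
          fix y
          \<comment> \<open>Coordinate \<open>i\<close> of \<open>face_param i y\<close> is 1, so
            after division by \<open>t\<close> the maximality condition of \<open>S i\<close> says
            that the other coordinates lie in the unit interval.\<close>
          have "t *\<^sub>R face_param i y \<in> S i \<longleftrightarrow> face_param i y \<in> cube_boundary"
            using t by (auto simp: S_def cube_boundary_iff orthant_def face_param_def zero_le_mult_iff
                split: if_splits)
          then show "ennreal (t ^ (CARD('n) - 1)) * ?F (t *\<^sub>R face_param i y) =
              indicator cube_boundary (face_param i y) *
              (indicator {0<..} t * (ennreal (t ^ (CARD('n) - 1)) * F (t *\<^sub>R face_param i y)))"
            using t by (auto simp: indicator_def)
        qed
        finally show ?thesis .
      qed
    qed
    also have "\<dots> = (\<integral>\<^sup>+y. (\<integral>\<^sup>+t. indicator cube_boundary (face_param i y) *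
        (indicator {0<..} t * (ennreal (t ^ (CARD('n) - 1)) * F (t *\<^sub>R face_param i y))) \<partial>lborel) \<partial>?P i)"
      by (rule pair_sigma_finite.Fubini')
         (auto intro!: pair_sigma_finite.intro sigma_finite lborel.sigma_finite_measure_axioms)
    also have "\<dots> = (\<integral>\<^sup>+y. indicator cube_boundary (face_param i y) * (\<integral>\<^sup>+t. indicator {0<..} t *
        (ennreal (t ^ (CARD('n) - 1)) * F (t *\<^sub>R face_param i y)) \<partial>lborel) \<partial>?P i)"
      by (intro nn_integral_cong nn_integral_cmult) measurable
    finally show ?thesis .
  qed
  \<comment> \<open>A point of the orthant with nonzero, pairwise distinct coordinates lies in
    exactly one pyramid.\<close>
  have "AE x in lborel. indicator orthant x = (\<Sum>i\<in>UNIV. indicator (S i) x :: ennreal)"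
  proof -
    have "AE x in lborel. \<forall>i j. (x :: real ^ 'n) $ i \<noteq> 0 \<and> (i \<noteq> j \<longrightarrow> x $ i \<noteq> x $ j)"
      by (auto simp: AE_all_countable AE_lborel_vec_nth_neq intro!: AE_lborel_vec_nth_distinct)
    then show ?thesis
    proof eventually_elim
      case (elim x)
      show ?case
      proof (cases "x \<in> orthant")
        case True
        have "Max (range (($) x)) \<in> range (($) x)" by (intro Max_in) auto
        then obtain k where k: "Max (range (($) x)) = x $ k" by (metis imageE)
        then have le: "x $ j \<le> x $ k" for j
          by (metis Max_ge finite finite_imageI rangeI)
        have "x \<in> S i \<longleftrightarrow> i = k" for i
          using True elim le unfolding S_def orthant_def
          by (auto simp: less_le) (metis antisym)+
        then have "indicator (S i) x = (if i = k then 1 else 0 :: ennreal)" for i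
          by auto
        then show ?thesis using True by simp
      qed (auto simp: S_def)
    qed
  qed
  then have "(\<integral>\<^sup>+x. indicator orthant x * F x \<partial>lborel) = (\<integral>\<^sup>+x. (\<Sum>i\<in>UNIV. indicator (S i) x * F x) \<partial>lborel)"
    by (intro nn_integral_cong_AE) (auto simp: sum_distrib_right)
  also have "\<dots> = (\<Sum>i\<in>UNIV. \<integral>\<^sup>+x. indicator (S i) x * F x \<partial>lborel)"
    by (intro nn_integral_sum) auto
  also have "\<dots> = (\<integral>\<^sup>+\<sigma>. indicator cube_boundary \<sigma> *
       (\<integral>\<^sup>+t. indicator {0<..} t * (ennreal (t ^ (CARD('n) - 1)) * F (t *\<^sub>R \<sigma>)) \<partial>lborel) \<partial>boundary_volume)"
    unfolding region by (subst nn_integral_boundary_volume) simp_all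
  finally show ?thesis .
qed

section \<open>Polar coordinates as an identity of measures\<close>

definition cube_measure :: "(real ^ 'n::finite) measure" where
  "cube_measure = density boundary_volume (\<lambda>x. ennreal (indicator cube_boundary x))"

definition radial_measure :: "nat \<Rightarrow> real measure" where
  "radial_measure k = density lborel (\<lambda>t. ennreal (indicator {0<..} t * t ^ k))"

lemma sets_cube_measure [measurable_cong, simp]: "sets cube_measure = sets borel"
  by (simp add: cube_measure_def sets_boundary_volume)

lemma sets_radial_measure [measurable_cong, simp]: "sets (radial_measure k) = sets borel"
  by (simp add: radial_measure_def)

lemma space_cube_measure [simp]: "space cube_measure = UNIV"
  using sets_eq_imp_space_eq[OF sets_cube_measure] by simp

lemma measurable_boundary_volume_cong:
  "measurable boundary_volume M = measurable borel M"
  by (rule measurable_cong_sets) (simp_all add: sets_boundary_volume)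

lemma AE_cube_measure: "AE \<sigma> in cube_measure. \<sigma> \<in> cube_boundary"
  unfolding cube_measure_def
  by (subst AE_density) (auto simp: measurable_boundary_volume_cong indicator_def intro!: AE_I2)

text \<open>\<open>boundary_volume\<close> lives on whole hyperplanes; cut down to the cube it has
  mass at most 1 per face. Finiteness supplies the hypothesis of Fubini's theorem and makes
  continuous functions on \<open>cube_boundary\<close> integrable.\<close>

lemma finite_measure_cube_measure: "finite_measure (cube_measure :: (real ^ 'n::finite) measure)"
proof (rule finite_measureI)
  interpret product_sigma_finite "\<lambda>_::'n. lborel :: real measure" ..
  have "emeasure (cube_measure :: (real ^ 'n) measure) UNIV =
      (\<integral>\<^sup>+x. indicator cube_boundary x \<partial>(boundary_volume :: (real ^ 'n) measure))"
    by (subst cube_measure_def, subst emeasure_density)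
       (auto simp: measurable_boundary_volume_cong sets_boundary_volume ennreal_indicator)
  also have "\<dots> = (\<Sum>i\<in>UNIV. \<integral>\<^sup>+y. indicator cube_boundary (face_param i y)
      \<partial>Pi\<^sub>M (UNIV - {i :: 'n}) (\<lambda>_. lborel))"
    by (rule nn_integral_boundary_volume) measurable
  also have "\<dots> \<le> (\<Sum>i\<in>(UNIV :: 'n set). 1)"
  proof (rule sum_mono)
    fix i :: 'n
    let ?A = "\<Pi>\<^sub>E j\<in>UNIV - {i}. {0..1::real}"
    have "(\<integral>\<^sup>+y. indicator cube_boundary (face_param i y) \<partial>Pi\<^sub>M (UNIV - {i}) (\<lambda>_. lborel)) \<le>
        (\<integral>\<^sup>+y. indicator ?A y \<partial>Pi\<^sub>M (UNIV - {i}) (\<lambda>_. lborel))"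
    proof (rule nn_integral_mono)
      fix y assume "y \<in> space (Pi\<^sub>M (UNIV - {i}) (\<lambda>_. lborel :: real measure))"
      then show "indicator cube_boundary (face_param i y) \<le> (indicator ?A y :: ennreal)"
        by (auto simp: indicator_def cube_boundary_iff face_param_def space_PiM PiE_def Pi_def
            split: if_splits)
    qed
    also have "\<dots> = emeasure (Pi\<^sub>M (UNIV - {i}) (\<lambda>_. lborel)) ?A"
      by (intro nn_integral_indicator sets_PiM_I_finite) auto
    also have "\<dots> = 1"
      by (simp add: emeasure_PiM)
    finally show "(\<integral>\<^sup>+y. indicator cube_boundary (face_param i y) \<partial>Pi\<^sub>M (UNIV - {i}) (\<lambda>_. lborel)) \<le> 1" .
  qed
  finally show "emeasure (cube_measure :: (real ^ 'n) measure) (space cube_measure) \<noteq> \<infinity>"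
    by (auto simp: top_unique ennreal_of_nat_eq_real_of_nat)
qed

lemma sigma_finite_radial_measure: "sigma_finite_measure (radial_measure k)"
  unfolding radial_measure_def by (subst sigma_finite_measure.sigma_finite_iff_density_finite'[OF lborel.sigma_finite_measure_axioms]) auto

lemma pair_sigma_finite_polar: "pair_sigma_finite cube_measure (radial_measure k)"
  by (intro pair_sigma_finite.intro finite_measure.axioms(1)[OF finite_measure_cube_measure]
      sigma_finite_radial_measure)

text \<open>As an equality of measures, polar coordinates pass at once from nonnegative to complex
  integrands, through the integral with respect to an image measure.\<close>

lemma lborel_orthant_polar:
  "distr (cube_measure \<Otimes>\<^sub>M radial_measure (CARD('n) - 1)) borel (\<lambda>(\<sigma>, t). t *\<^sub>R \<sigma>) =
   density lborel (\<lambda>x :: real ^ 'n::finite. ennreal (indicator orthant x))"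
proof (rule measure_eqI)
  let ?k = "CARD('n) - 1"
  interpret pair_sigma_finite "cube_measure :: (real ^ 'n) measure" "radial_measure ?k"
    by (rule pair_sigma_finite_polar)
  fix A :: "(real ^ 'n) set"
  assume "A \<in> sets (distr (cube_measure \<Otimes>\<^sub>M radial_measure (CARD('n) - 1)) borel (\<lambda>(\<sigma>, t). t *\<^sub>R \<sigma>))"
  then have [measurable]: "A \<in> sets borel" by simp
  have "emeasure (distr (cube_measure \<Otimes>\<^sub>M radial_measure ?k) borel (\<lambda>(\<sigma>, t). t *\<^sub>R \<sigma>)) A =
      (\<integral>\<^sup>+x. indicator A (snd x *\<^sub>R fst x) \<partial>(cube_measure \<Otimes>\<^sub>M radial_measure ?k))"
    by (subst nn_integral_indicator[symmetric], simp, subst nn_integral_distr)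
       (auto simp: case_prod_beta')
  also have "\<dots> = (\<integral>\<^sup>+\<sigma>. \<integral>\<^sup>+t. indicator A (t *\<^sub>R \<sigma>) \<partial>radial_measure ?k \<partial>cube_measure)"
    by (subst M2.nn_integral_fst[symmetric]) auto
  also have "\<dots> = (\<integral>\<^sup>+\<sigma>. indicator cube_boundary \<sigma> *
       (\<integral>\<^sup>+t. indicator {0<..} t * (ennreal (t ^ ?k) * indicator A (t *\<^sub>R \<sigma>)) \<partial>lborel) \<partial>boundary_volume)"
    unfolding cube_measure_def
    by (subst nn_integral_density)
       (auto simp: measurable_boundary_volume_cong ennreal_indicator radial_measure_def
          nn_integral_density ennreal_mult' mult.assoc indicator_def
          intro!: nn_integral_cong arg_cong2[where f = "(*)"])
  also have "\<dots> = (\<integral>\<^sup>+x. indicator orthant x * indicator A x \<partial>lborel)"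
    by (subst nn_integral_polar) simp_all
  also have "\<dots> = emeasure (density lborel (\<lambda>x :: real ^ 'n. ennreal (indicator orthant x))) A"
    by (subst emeasure_density) (auto simp: ennreal_indicator)
  finally show "emeasure (distr (cube_measure \<Otimes>\<^sub>M radial_measure ?k) borel (\<lambda>(\<sigma>, t). t *\<^sub>R \<sigma>)) A =
      emeasure (density lborel (\<lambda>x :: real ^ 'n. ennreal (indicator orthant x))) A" .
qed simp

lemma scaleR_cube_boundary_in_orthant:
  "\<sigma> \<in> cube_boundary \<Longrightarrow> t \<ge> 0 \<Longrightarrow> t *\<^sub>R \<sigma> \<in> orthant"
  by (simp add: cube_boundary_iff orthant_def)


text \<open>Fubini gives integrability on almost every ray only. The inner
  \<open>indicator orthant\<close> makes the integrand measurable on the whole space, although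
  \<open>H\<close> is controlled only on the orthant; for \<sigma> on the cube boundary and
  \<open>t > 0\<close> it equals 1.\<close>

lemma polar_integral:
  fixes H :: "real ^ 'n::finite \<Rightarrow> complex"
  assumes H: "set_integrable lborel orthant H"
  shows "AE \<sigma> in cube_measure. set_integrable lborel {0<..} (\<lambda>t. t ^ (CARD('n) - 1) *\<^sub>R H (t *\<^sub>R \<sigma>))"
    and "(\<lambda>\<sigma>. LINT t:{0<..}|lborel. t ^ (CARD('n) - 1) *\<^sub>R (indicator orthant (t *\<^sub>R \<sigma>) *\<^sub>R H (t *\<^sub>R \<sigma>)))
       \<in> borel_measurable borel"
    and "(LINT x:orthant|lborel. H x) =
      (\<integral>\<sigma>. (LINT t:{0<..}|lborel. t ^ (CARD('n) - 1) *\<^sub>R (indicator orthant (t *\<^sub>R \<sigma>) *\<^sub>R H (t *\<^sub>R \<sigma>))) \<partial>cube_measure)"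
proof -
  let ?k = "CARD('n) - 1"
  interpret pair_sigma_finite "cube_measure :: (real ^ 'n) measure" "radial_measure ?k"
    by (rule pair_sigma_finite_polar)
  define K where "K x = indicator orthant x *\<^sub>R H x" for x
  have intK: "integrable lborel K"
    using H by (simp add: K_def[abs_def] set_integrable_def)
  then have [measurable]: "K \<in> borel_measurable borel"
    by (simp add: borel_measurable_integrable)
  have KK: "indicator orthant x *\<^sub>R K x = K x" for x
    by (simp add: K_def indicator_def)
  have "integrable (density lborel (\<lambda>x :: real ^ 'n. ennreal (indicator orthant x))) K"
    by (subst integrable_density) (simp_all add: KK intK)
  then have pair: "integrable (cube_measure \<Otimes>\<^sub>M radial_measure ?k) (\<lambda>(\<sigma>, t). K (t *\<^sub>R \<sigma>))"
    by (subst (asm) lborel_orthant_polar[symmetric], subst (asm) integrable_distr_eq)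
       (simp_all add: case_prod_beta')
  have rad: "integrable (radial_measure ?k) (\<lambda>t. K (t *\<^sub>R \<sigma>)) \<longleftrightarrow>
      set_integrable lborel {0<..} (\<lambda>t. t ^ ?k *\<^sub>R K (t *\<^sub>R \<sigma>))" for \<sigma>
    unfolding radial_measure_def set_integrable_def
    by (subst integrable_density) (auto simp: indicator_def intro!: AE_I2)
  have radi: "(\<integral>t. K (t *\<^sub>R \<sigma>) \<partial>radial_measure ?k) = (LINT t:{0<..}|lborel. t ^ ?k *\<^sub>R K (t *\<^sub>R \<sigma>))" for \<sigma>
    unfolding radial_measure_def set_lebesgue_integral_def
    by (subst integral_density) (auto simp: indicator_def intro!: AE_I2)
  have K: "K (t *\<^sub>R \<sigma>) = H (t *\<^sub>R \<sigma>)" if "t > 0" "\<sigma> \<in> cube_boundary" for t \<sigma>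
    using that by (simp add: K_def scaleR_cube_boundary_in_orthant)
  show "AE \<sigma> in cube_measure. set_integrable lborel {0<..} (\<lambda>t. t ^ ?k *\<^sub>R H (t *\<^sub>R \<sigma>))"
    using AE_integrable_fst'[OF pair] AE_cube_measure
  proof eventually_elim
    case (elim \<sigma>)
    have "set_integrable lborel {0<..} (\<lambda>t. t ^ ?k *\<^sub>R K (t *\<^sub>R \<sigma>))"
      by (subst rad[symmetric]) (use elim(1) in simp)
    then show ?case
      by (rule set_integrable_cong[THEN iffD1, rotated 3]) (simp_all add: K elim)
  qed
  have "(\<lambda>\<sigma>. LINT t:{0<..}|lborel. t ^ ?k *\<^sub>R K (t *\<^sub>R \<sigma>)) \<in> borel_measurable borel"
    unfolding radi[symmetric] by measurable
  then show "(\<lambda>\<sigma>. LINT t:{0<..}|lborel. t ^ ?k *\<^sub>R (indicator orthant (t *\<^sub>R \<sigma>) *\<^sub>R H (t *\<^sub>R \<sigma>)))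
       \<in> borel_measurable borel"
    by (simp add: K_def)
  have "(LINT x:orthant|lborel. H x) = (\<integral>x. K x \<partial>density lborel (\<lambda>x. ennreal (indicator orthant x)))"
    by (subst integral_density) (simp_all add: KK, simp add: K_def[abs_def] set_lebesgue_integral_def)
  also have "\<dots> = (\<integral>(\<sigma>, t). K (t *\<^sub>R \<sigma>) \<partial>(cube_measure \<Otimes>\<^sub>M radial_measure ?k))"
    by (subst lborel_orthant_polar[symmetric], subst integral_distr) (simp_all add: case_prod_beta')
  also have "\<dots> = (\<integral>\<sigma>. (\<integral>t. K (t *\<^sub>R \<sigma>) \<partial>radial_measure ?k) \<partial>cube_measure)"
    by (subst integral_fst'[OF pair, symmetric]) simp
  also have "\<dots> = (\<integral>\<sigma>. (LINT t:{0<..}|lborel. t ^ ?k *\<^sub>R K (t *\<^sub>R \<sigma>)) \<partial>cube_measure)"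
    by (simp only: radi)
  finally show "(LINT x:orthant|lborel. H x) =
      (\<integral>\<sigma>. (LINT t:{0<..}|lborel. t ^ ?k *\<^sub>R (indicator orthant (t *\<^sub>R \<sigma>) *\<^sub>R H (t *\<^sub>R \<sigma>))) \<partial>cube_measure)"
    by (simp only: K_def)
qed

lemma integrable_continuous_on_cube_boundary:
  fixes B :: "real ^ 'n::finite \<Rightarrow> complex"
  assumes "continuous_on cube_boundary B"
  shows "set_integrable boundary_volume cube_boundary B"
    and "(LINT \<sigma>:cube_boundary|boundary_volume. B \<sigma>) =
      (\<integral>\<sigma>. indicator cube_boundary \<sigma> *\<^sub>R B \<sigma> \<partial>cube_measure)"
proof -
  interpret finite_measure "cube_measure :: (real ^ 'n) measure"
    by (rule finite_measure_cube_measure)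
  define K where "K x = indicator cube_boundary x *\<^sub>R B x" for x
  have Km [measurable]: "K \<in> borel_measurable borel"
    unfolding K_def by (rule borel_measurable_continuous_on_indicator) (use assms in auto)
  have KK: "indicator cube_boundary x *\<^sub>R K x = K x" for x
    by (simp add: K_def indicator_def)
  have "compact (B ` cube_boundary)"
    using assms compact_cube_boundary by (rule compact_continuous_image)
  then obtain b where b: "\<And>x. x \<in> cube_boundary \<Longrightarrow> norm (B x) \<le> b"
    by (metis compact_imp_bounded bounded_iff imageI)
  have "integrable cube_measure K"
    by (rule integrable_const_bound[of _ "max b 0"])
       (auto simp: K_def indicator_def measurable_cong_sets[OF sets_cube_measure refl] le_max_iff_disj
          intro!: AE_I2 b Km[unfolded K_def indicator_def])
  then show "set_integrable boundary_volume cube_boundary B"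
    unfolding cube_measure_def set_integrable_def
    by (subst (asm) integrable_density)
       (simp_all add: measurable_boundary_volume_cong KK Km, simp add: K_def[abs_def])
  show "(LINT \<sigma>:cube_boundary|boundary_volume. B \<sigma>) =
      (\<integral>\<sigma>. indicator cube_boundary \<sigma> *\<^sub>R B \<sigma> \<partial>cube_measure)"
    unfolding cube_measure_def set_lebesgue_integral_def K_def[symmetric]
    by (subst integral_density) (simp_all add: measurable_boundary_volume_cong KK Km)
qed

text \<open>This takes the place of a divergence theorem: a primitive on each ray suffices, and its
  limit at infinity survives as the boundary term \<open>B\<close>. Rays on which the integrand is
  not integrable form a null set.\<close>

lemma integral_orthant_FTC:
  fixes H :: "real ^ 'n::finite \<Rightarrow> complex"
  assumes int: "set_integrable lborel orthant H" and cont: "continuous_on orthant H"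
    and B: "continuous_on cube_boundary B"
    and der: "\<And>\<sigma> t. \<sigma> \<in> cube_boundary \<Longrightarrow> t > 0 \<Longrightarrow>
      (\<Phi> \<sigma> has_vector_derivative (t ^ (CARD('n) - 1) *\<^sub>R H (t *\<^sub>R \<sigma>))) (at t)"
    and lim0: "\<And>\<sigma>. \<sigma> \<in> cube_boundary \<Longrightarrow> (\<Phi> \<sigma> \<longlongrightarrow> 0) (at_right 0)"
    and lim_top: "\<And>\<sigma>. \<sigma> \<in> cube_boundary \<Longrightarrow> (\<Phi> \<sigma> \<longlongrightarrow> B \<sigma>) at_top"
  shows "(LINT x:orthant|lborel. H x) = (LINT \<sigma>:cube_boundary|boundary_volume. B \<sigma>)"
proof -
  let ?k = "CARD('n) - 1"
  have "(LINT x:orthant|lborel. H x) =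
      (\<integral>\<sigma>. (LINT t:{0<..}|lborel. t ^ ?k *\<^sub>R (indicator orthant (t *\<^sub>R \<sigma>) *\<^sub>R H (t *\<^sub>R \<sigma>))) \<partial>cube_measure)"
    by (rule polar_integral[OF int])
  also have "\<dots> = (\<integral>\<sigma>. indicator cube_boundary \<sigma> *\<^sub>R B \<sigma> \<partial>cube_measure)"
  proof (rule integral_cong_AE)
    show "AE \<sigma> in cube_measure. (LINT t:{0<..}|lborel. t ^ ?k *\<^sub>R (indicator orthant (t *\<^sub>R \<sigma>) *\<^sub>R H (t *\<^sub>R \<sigma>))) =
        indicator cube_boundary \<sigma> *\<^sub>R B \<sigma>"
      using polar_integral(1)[OF int] AE_cube_measure
    proof eventually_elim
      case (elim \<sigma>)
      have "(LINT t:{0<..}|lborel. t ^ ?k *\<^sub>R (indicator orthant (t *\<^sub>R \<sigma>) *\<^sub>R H (t *\<^sub>R \<sigma>))) =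
          (LINT t:{0<..}|lborel. t ^ ?k *\<^sub>R H (t *\<^sub>R \<sigma>))"
        using elim by (intro set_lebesgue_integral_cong) (auto simp: scaleR_cube_boundary_in_orthant)
      also have "\<dots> = (LBINT t=ereal 0..\<infinity>. t ^ ?k *\<^sub>R H (t *\<^sub>R \<sigma>))"
        by (simp add: interval_integral_to_infinity_eq)
      also have "\<dots> = B \<sigma> - 0"
      proof (rule interval_integral_FTC_integrable)
        fix t assume "ereal 0 < ereal t"
        then have t: "t > 0" by simp
        show "(\<Phi> \<sigma> has_vector_derivative (t ^ ?k *\<^sub>R H (t *\<^sub>R \<sigma>))) (at t)"
          using elim t by (intro der)
        have "continuous_on {0<..} (\<lambda>t. t ^ ?k *\<^sub>R H (t *\<^sub>R \<sigma>))"
          by (intro continuous_intros continuous_on_compose2[OF cont])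
             (use elim in \<open>auto simp: scaleR_cube_boundary_in_orthant\<close>)
        then show "isCont (\<lambda>t. t ^ ?k *\<^sub>R H (t *\<^sub>R \<sigma>)) t"
          using t by (simp add: continuous_on_eq_continuous_at open_greaterThan)
      next
        show "set_integrable lborel (einterval (ereal 0) \<infinity>) (\<lambda>t. t ^ ?k *\<^sub>R H (t *\<^sub>R \<sigma>))"
          using elim by (simp add: einterval_def greaterThan_def)
        show "((\<Phi> \<sigma> \<circ> real_of_ereal) \<longlongrightarrow> 0) (at_right (ereal 0))"
          using lim0[of \<sigma>] elim by (simp add: ereal_tendsto_simps)
        show "((\<Phi> \<sigma> \<circ> real_of_ereal) \<longlongrightarrow> B \<sigma>) (at_left \<infinity>)"
          using lim_top[of \<sigma>] elim by (simp add: ereal_tendsto_simps)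
      qed simp
      finally show ?case using elim by simp
    qed
    show "(\<lambda>\<sigma>. LINT t:{0<..}|lborel. t ^ ?k *\<^sub>R (indicator orthant (t *\<^sub>R \<sigma>) *\<^sub>R H (t *\<^sub>R \<sigma>))) \<in>
        borel_measurable cube_measure"
      using polar_integral(2)[OF int] by (simp add: measurable_cong_sets[OF sets_cube_measure refl])
    show "(\<lambda>\<sigma>. indicator cube_boundary \<sigma> *\<^sub>R B \<sigma>) \<in> borel_measurable cube_measure"
      unfolding measurable_cong_sets[OF sets_cube_measure refl]
      by (rule borel_measurable_continuous_on_indicator) (use B in auto)
  qed
  finally show ?thesis
    by (simp add: integrable_continuous_on_cube_boundary(2)[OF B])
qed

section \<open>Boundedness of the logarithm\<close>

text \<open>A linear substitute for the norm on the orthant. Linearity makes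
  \<open>corner_simplex\<close> convex and the homogenisation of \<open>f\<close> below a
  polynomial.\<close>

definition coord_sum :: "real ^ 'n::finite \<Rightarrow> real" where
  "coord_sum x = (\<Sum>i\<in>UNIV. x $ i)"

text \<open>A property of functions rather than of polynomials, since the recurrence keeps
  multiplying the numerator by homogeneous parts of \<open>f\<close>. Continuity is included so that
  compactness bounds \<open>G\<close>.\<close>

definition homogeneous :: "nat \<Rightarrow> (real ^ 'n::finite \<Rightarrow> complex) \<Rightarrow> bool" where
  "homogeneous d G \<longleftrightarrow> continuous_on orthant G \<and>
     (\<forall>x\<in>orthant. \<forall>t\<ge>0. G (t *\<^sub>R x) = of_real t ^ d * G x)"

definition corner_simplex :: "(real ^ 'n::finite) set" where
  "corner_simplex = {x \<in> orthant. coord_sum x \<le> 1}"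

lemma coord_sum_scaleR [simp]: "coord_sum (t *\<^sub>R x) = t * coord_sum x"
  by (simp add: coord_sum_def sum_distrib_left)

lemma coord_sum_add: "coord_sum (x + y) = coord_sum x + coord_sum y"
  by (simp add: coord_sum_def sum.distrib)

lemma coord_sum_nonneg: "x \<in> orthant \<Longrightarrow> coord_sum x \<ge> 0"
  by (auto simp: coord_sum_def orthant_def intro: sum_nonneg)

lemma coord_sum_ge_1: "x \<in> cube_boundary \<Longrightarrow> coord_sum x \<ge> 1"
proof -
  assume x: "x \<in> cube_boundary"
  then obtain i where i: "x $ i = 1" by (auto simp: cube_boundary_iff)
  have "x $ i \<le> coord_sum x"
    unfolding coord_sum_def by (rule member_le_sum) (use x in \<open>auto simp: cube_boundary_iff\<close>)
  with i show ?thesis by simp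
qed

lemma continuous_on_coord_sum [continuous_intros]:
  "continuous_on S f \<Longrightarrow> continuous_on S (\<lambda>x. coord_sum (f x))"
  unfolding coord_sum_def by (intro continuous_intros)

lemma measurable_coord_sum [measurable]: "coord_sum \<in> borel_measurable borel"
  by (intro borel_measurable_continuous_onI continuous_intros)

lemma scaleR_orthant: "x \<in> orthant \<Longrightarrow> t \<ge> 0 \<Longrightarrow> t *\<^sub>R x \<in> orthant"
  by (simp add: orthant_def)

lemma cube_boundary_subset_orthant: "cube_boundary \<subseteq> orthant"
  by (auto simp: cube_boundary_def)

lemma cube_boundary_nonzero: "\<sigma> \<in> cube_boundary \<Longrightarrow> \<sigma> \<in> orthant - {0}"
  by (auto simp: cube_boundary_iff orthant_def)

lemma convex_orthant: "convex (orthant :: (real ^ 'n::finite) set)"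
  by (auto simp: convex_def orthant_def)

lemma convex_corner_simplex: "convex (corner_simplex :: (real ^ 'n::finite) set)"
  unfolding corner_simplex_def convex_def
  by (auto simp: orthant_def coord_sum_add intro: convex_bound_le)

lemma compact_corner_simplex: "compact (corner_simplex :: (real ^ 'n::finite) set)"
proof -
  have "corner_simplex = cbox 0 1 \<inter> (orthant \<inter> {x :: real ^ 'n. coord_sum x \<le> 1})"
  proof (rule set_eqI)
    fix x :: "real ^ 'n"
    have "x $ i \<le> 1" if "x \<in> orthant" "coord_sum x \<le> 1" for i
    proof -
      have "x $ i \<le> coord_sum x"
        unfolding coord_sum_def by (rule member_le_sum) (use that in \<open>auto simp: orthant_def\<close>)
      with that show ?thesis by simp
    qed
    then show "x \<in> corner_simplex \<longleftrightarrow> x \<in> cbox 0 1 \<inter> (orthant \<inter> {x. coord_sum x \<le> 1})"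
      by (auto simp: corner_simplex_def mem_box_cart orthant_def)
  qed
  moreover have "closed (orthant \<inter> {x :: real ^ 'n. coord_sum x \<le> 1})"
    by (intro closed_Int closed_orthant closed_Collect_le continuous_intros)
  ultimately show ?thesis
    by (metis compact_Int_closed compact_cbox)
qed

lemma rescale_in_corner_simplex:
  assumes "x \<in> orthant"
  shows "(1 / (1 + coord_sum x)) *\<^sub>R x \<in> corner_simplex"
  using assms coord_sum_nonneg[OF assms]
  by (auto simp: corner_simplex_def intro!: scaleR_orthant)

lemma homogeneousD:
  assumes "homogeneous d G"
  shows "continuous_on orthant G"
    and "x \<in> orthant \<Longrightarrow> t \<ge> 0 \<Longrightarrow> G (t *\<^sub>R x) = of_real t ^ d * G x"
  using assms by (auto simp: homogeneous_def)

lemma homogeneous_mult: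
  "homogeneous d G \<Longrightarrow> homogeneous e H \<Longrightarrow> homogeneous (d + e) (\<lambda>x. G x * H x)"
  by (auto simp: homogeneous_def power_add intro!: continuous_intros)

lemma continuous_on_poly_eval: "continuous_on S (poly_eval f)"
  unfolding poly_eval_def mono_eval_def by (intro continuous_intros)

lemma homogeneous_hom_part: "homogeneous i (poly_eval (hom_part i f))"
  by (auto simp: homogeneous_def poly_eval_hom_part_scaleR continuous_on_poly_eval)

text \<open>Division by \<open>1 + coord_sum x\<close> maps the orthant, origin included, into the
  compact simplex, where continuity bounds \<open>G\<close>; homogeneity restores the scale.\<close>

lemma homogeneous_bound:
  fixes G :: "real ^ 'n::finite \<Rightarrow> complex"
  assumes G: "homogeneous d G"
  obtains C where "\<And>x. x \<in> orthant \<Longrightarrow> norm (G x) \<le> C * (1 + coord_sum x) ^ d"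
proof -
  have "compact (G ` corner_simplex)"
    using homogeneousD(1)[OF G] compact_corner_simplex
    by (auto intro!: compact_continuous_image elim: continuous_on_subset simp: corner_simplex_def)
  then obtain C where C: "\<And>x. x \<in> corner_simplex \<Longrightarrow> norm (G x) \<le> C"
    by (metis compact_imp_bounded bounded_iff imageI)
  show thesis
  proof (rule that)
    fix x :: "real ^ 'n" assume x: "x \<in> orthant"
    define c where "c = 1 + coord_sum x"
    have c: "c > 0" using coord_sum_nonneg[OF x] by (simp add: c_def)
    have "x = c *\<^sub>R ((1 / c) *\<^sub>R x)" using c by simp
    then have "G x = of_real c ^ d * G ((1 / c) *\<^sub>R x)"
      using homogeneousD(2)[OF G, of "(1 / c) *\<^sub>R x" c] x c by (simp add: scaleR_orthant)
    moreover have "norm (G ((1 / c) *\<^sub>R x)) \<le> C"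
      unfolding c_def by (intro C rescale_in_corner_simplex x)
    ultimately show "norm (G x) \<le> C * (1 + coord_sum x) ^ d"
      using c by (simp add: norm_mult norm_power mult.commute flip: c_def)
  qed
qed

lemma nn_integral_powr_tail:
  assumes "b > 1"
  shows "(\<integral>\<^sup>+t. indicator {0<..} t * ennreal ((1 + t) powr (- b)) \<partial>lborel) < \<infinity>"
proof -
  have "(\<integral>\<^sup>+t. indicator {0<..} t * ennreal ((1 + t) powr (- b)) \<partial>lborel) \<le>
      (\<integral>\<^sup>+t. ennreal ((1 + t) powr (- b)) * indicator {0..} t \<partial>lborel)"
    by (intro nn_integral_mono) (auto simp: indicator_def)
  also have "\<dots> = ennreal (0 - (- 1 / (b - 1)) * (1 + 0) powr (1 - b))"
  proof (rule nn_integral_FTC_atLeast)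
    fix t :: real assume t: "0 \<le> t"
    have "((\<lambda>t. (- 1 / (b - 1)) * (1 + t) powr (1 - b)) has_real_derivative
        (- 1 / (b - 1)) * ((1 - b) * (1 + t) powr (1 - b - 1))) (at t)"
      using t assms by (auto intro!: derivative_eq_intros)
    also have "(- 1 / (b - 1)) * ((1 - b) * (1 + t) powr (1 - b - 1)) = (1 + t) powr (- b)"
      using assms by (simp add: field_simps)
    finally show "((\<lambda>t. (- 1 / (b - 1)) * (1 + t) powr (1 - b)) has_real_derivative (1 + t) powr (- b)) (at t)" .
  next
    have "((\<lambda>t. (- 1 / (b - 1)) * (1 + t) powr (1 - b)) \<longlongrightarrow> (- 1 / (b - 1)) * 0) at_top"
      using assms
      by (intro tendsto_intros tendsto_neg_powr filterlim_tendsto_add_at_top[OF tendsto_const filterlim_ident]) auto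
    then show "((\<lambda>t. (- 1 / (b - 1)) * (1 + t) powr (1 - b)) \<longlongrightarrow> 0) at_top" by simp
  qed auto
  finally show ?thesis
    by (rule le_less_trans) simp
qed

text \<open>On the cube boundary \<open>coord_sum\<close> is at least 1, so in polar coordinates
  each ray integral is at most that of \<open>(1 + t) powr (- (a - p + 1))\<close>, uniformly in
  \<sigma>. The exponent exceeds 1 in size exactly when \<open>a > p\<close>.\<close>

lemma set_integrable_orthant_powr:
  assumes a: "a > real CARD('n)"
  shows "set_integrable lborel (orthant :: (real ^ 'n::finite) set) (\<lambda>x. (1 + coord_sum x) powr (- a))"
proof -
  interpret finite_measure "cube_measure :: (real ^ 'n) measure"
    by (rule finite_measure_cube_measure)
  let ?k = "CARD('n) - 1"
  let ?I = "\<integral>\<^sup>+t. indicator {0<..} t * ennreal ((1 + t) powr (- (a - real ?k))) \<partial>lborel"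
  have I: "?I < \<infinity>"
    using a by (intro nn_integral_powr_tail) (auto simp: of_nat_diff Suc_leI)
  have "(\<integral>\<^sup>+x. indicator orthant x * ennreal ((1 + coord_sum x) powr (- a)) \<partial>(lborel :: (real ^ 'n) measure)) =
    (\<integral>\<^sup>+\<sigma>. indicator cube_boundary \<sigma> * (\<integral>\<^sup>+t. indicator {0<..} t *
      (ennreal (t ^ ?k) * ennreal ((1 + coord_sum (t *\<^sub>R \<sigma>)) powr (- a))) \<partial>lborel) \<partial>(boundary_volume :: (real ^ 'n) measure))"
    by (rule nn_integral_polar) measurable
  also have "\<dots> \<le> (\<integral>\<^sup>+\<sigma>. indicator cube_boundary \<sigma> * ?I \<partial>(boundary_volume :: (real ^ 'n) measure))"
  proof (rule nn_integral_mono)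
    fix \<sigma> :: "real ^ 'n"
    have "(\<integral>\<^sup>+t. indicator {0<..} t *
      (ennreal (t ^ ?k) * ennreal ((1 + coord_sum (t *\<^sub>R \<sigma>)) powr (- a))) \<partial>lborel) \<le> ?I"
      if \<sigma>: "\<sigma> \<in> cube_boundary"
    proof (rule nn_integral_mono)
      fix t :: real
      have "t ^ ?k * (1 + coord_sum (t *\<^sub>R \<sigma>)) powr (- a) \<le> (1 + t) powr (- (a - real ?k))" if t: "t > 0"
      proof -
        have "t * 1 \<le> t * coord_sum \<sigma>"
          using t coord_sum_ge_1[OF \<sigma>] by (intro mult_left_mono) auto
        then have "(1 + coord_sum (t *\<^sub>R \<sigma>)) powr (- a) \<le> (1 + t) powr (- a)"
          using t a by (intro powr_mono2') auto
        moreover have "t ^ ?k \<le> (1 + t) ^ ?k"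
          using t by (intro power_mono) auto
        ultimately have "t ^ ?k * (1 + coord_sum (t *\<^sub>R \<sigma>)) powr (- a) \<le> (1 + t) ^ ?k * (1 + t) powr (- a)"
          using t by (intro mult_mono) auto
        also have "\<dots> = (1 + t) powr (- (a - real ?k))"
          using t by (simp add: powr_realpow[symmetric] powr_add[symmetric])
        finally show ?thesis .
      qed
      then show "indicator {0<..} t * (ennreal (t ^ ?k) * ennreal ((1 + coord_sum (t *\<^sub>R \<sigma>)) powr (- a))) \<le>
          indicator {0<..} t * ennreal ((1 + t) powr (- (a - real ?k)))"
        by (auto simp: indicator_def ennreal_mult'[symmetric] simp del: coord_sum_scaleR intro!: ennreal_leI)
    qed
    then show "indicator cube_boundary \<sigma> * (\<integral>\<^sup>+t. indicator {0<..} t *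
      (ennreal (t ^ ?k) * ennreal ((1 + coord_sum (t *\<^sub>R \<sigma>)) powr (- a))) \<partial>lborel) \<le>
      indicator cube_boundary \<sigma> * ?I"
      by (auto simp: indicator_def)
  qed
  also have "\<dots> = emeasure (cube_measure :: (real ^ 'n) measure) UNIV * ?I"
    by (subst nn_integral_multc, simp add: measurable_boundary_volume_cong,
        subst cube_measure_def, subst emeasure_density)
       (auto simp: measurable_boundary_volume_cong sets_boundary_volume ennreal_indicator)
  also have "\<dots> < \<infinity>"
  proof -
    have "emeasure (cube_measure :: (real ^ 'n) measure) UNIV < top"
      using emeasure_finite[of UNIV] by (simp only: less_top infinity_ennreal_def)
    with I show ?thesis by (simp only: ennreal_mult_less_top infinity_ennreal_def simp_thms)
  qed
  finally have fin: "(\<integral>\<^sup>+x. indicator orthant x * ennreal ((1 + coord_sum x) powr (- a)) \<partial>(lborel :: (real ^ 'n) measure)) < \<infinity>" .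
  have m [measurable]: "(\<lambda>x :: real ^ 'n. indicator orthant x *\<^sub>R (1 + coord_sum x) powr (- a)) \<in> borel_measurable borel"
    by measurable
  show ?thesis
    unfolding set_integrable_def integrable_iff_bounded
    using fin by (auto simp: indicator_def ennreal_mult'[symmetric] if_distrib[of norm] cong: if_cong
        intro: le_less_trans[rotated] intro!: nn_integral_mono)
qed

section \<open>Growth of the logarithm and of the integrand\<close>

locale mahler_log =
  fixes f :: "'n::finite cpoly" and L :: "real ^ 'n \<Rightarrow> complex"
  assumes mahler: "mahler_hypothesis f" and log: "log_branch f L"
begin

abbreviation m :: nat where "m \<equiv> total_degree f"

lemma m_pos: "m > 0"
proof (rule ccontr)
  assume "\<not> m > 0"
  then have m0: "m = 0" by simp
  have "a = 0" if "a \<in> Poly_Mapping.keys f" for a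
  proof -
    have "mono_degree a = 0" using mono_degree_le_total_degree[OF that] m0 by simp
    then show ?thesis by (auto simp: mono_degree_def intro!: poly_mapping_eqI)
  qed
  then have "f = Poly_Mapping.single 0 (Poly_Mapping.lookup f 0)"
    by (intro poly_mapping_eqI) (auto simp: lookup_single when_def in_keys_iff)
  with mahler show False by (auto simp: mahler_hypothesis_def)
qed

lemma poly_eval_nonzero: "x \<in> orthant \<Longrightarrow> poly_eval f x \<noteq> 0"
  and top_part_nonzero: "x \<in> orthant \<Longrightarrow> x \<noteq> 0 \<Longrightarrow> poly_eval (top_part f) x \<noteq> 0"
  using mahler by (auto simp: mahler_hypothesis_def)

lemma continuous_on_L: "continuous_on orthant L" and exp_L: "x \<in> orthant \<Longrightarrow> exp (L x) = poly_eval f x"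
  using log by (auto simp: log_branch_def)

text \<open>
  The compactification \<open>x \<mapsto> x / (1 + \<Sum>\<^sub>i x\<^sub>i)\<close> turns \<open>f\<close> into a nowhere vanishing
  continuous function on a compact convex set, whose logarithm is bounded.
\<close>

definition compactified :: "real ^ 'n \<Rightarrow> complex" where
  "compactified y = (\<Sum>i\<le>m. of_real (1 - coord_sum y) ^ (m - i) * poly_eval (hom_part i f) y)"

text \<open>If \<open>1 - coord_sum y = t > 0\<close>, then \<open>y\<close> is the image of
  \<open>(1 / t) *\<^sub>R y\<close> under the compactification, and \<open>t ^ m\<close> clears the
  denominators of \<open>f\<close> there.\<close>

lemma compactified_scaleR:
  assumes "t > 0" "1 - coord_sum y = t"
  shows "compactified y = of_real t ^ m * poly_eval f ((1 / t) *\<^sub>R y)"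
  unfolding compactified_def poly_eval_eq_sum_hom_part[of f "(1 / t) *\<^sub>R y"] sum_distrib_left assms(2)
proof (rule sum.cong[OF refl])
  fix i assume "i \<in> {..m}"
  then have "complex_of_real t ^ m = of_real t ^ (m - i) * of_real t ^ i"
    by (simp flip: power_add)
  then show "of_real t ^ (m - i) * poly_eval (hom_part i f) y =
      of_real t ^ m * poly_eval (hom_part i f) ((1 / t) *\<^sub>R y)"
    using assms(1) by (simp only: poly_eval_hom_part_scaleR) (simp add: field_simps)
qed

text \<open>On the face at infinity, \<open>coord_sum y = 1\<close>, only the summand
  \<open>i = m\<close> survives (with \<open>0 ^ 0 = 1\<close>), and the condition on
  \<open>top_part f\<close> applies; elsewhere it is the condition on \<open>f\<close>
  itself.\<close>

lemma compactified_nonzero: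
  assumes "y \<in> corner_simplex"
  shows "compactified y \<noteq> 0"
proof (cases "coord_sum y = 1")
  case True
  have "compactified y = (\<Sum>i\<in>{m}. of_real (1 - coord_sum y) ^ (m - i) * poly_eval (hom_part i f) y)"
    unfolding compactified_def using True by (intro sum.mono_neutral_right) auto
  also have "\<dots> = poly_eval (top_part f) y"
    by (simp add: top_part_def)
  moreover have "y \<noteq> 0" using True by (auto simp: coord_sum_def)
  ultimately show ?thesis
    using assms top_part_nonzero by (simp add: corner_simplex_def)
next
  case False
  with assms have "1 - coord_sum y > 0" by (simp add: corner_simplex_def)
  then show ?thesis
    using assms by (subst compactified_scaleR[OF _ refl])
      (auto intro!: poly_eval_nonzero scaleR_orthant simp: corner_simplex_def simp flip: of_real_diff)
qed

text \<open>A bound on the modulus of \<open>f\<close> would control \<open>Re (L x)\<close> only.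
  The imaginary part is controlled because \<open>L\<close> differs by a constant from a logarithm
  that splits into the real term \<open>m ln (1 + coord_sum x)\<close> and a bounded one pulled back
  from the simplex.\<close>

lemma log_bound:
  obtains B where "\<And>x. x \<in> orthant \<Longrightarrow> norm (L x - of_real (real m * ln (1 + coord_sum x))) \<le> B"
proof -
  have "continuous_on corner_simplex compactified"
    unfolding compactified_def by (intro continuous_intros continuous_on_poly_eval)
  then obtain l where l: "continuous_on corner_simplex l"
    and exp_l: "\<And>y. y \<in> corner_simplex \<Longrightarrow> compactified y = exp (l y)"
    using continuous_logarithm_on_contractible convex_imp_contractible convex_corner_simplex compactified_nonzero
    by metis
  let ?\<phi> = "\<lambda>x :: real ^ 'n. (1 / (1 + coord_sum x)) *\<^sub>R x"
  define D where "D x = L x - of_real (real m * ln (1 + coord_sum x)) - l (?\<phi> x)" for x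
  have pos: "1 + coord_sum x > 0" if "x \<in> orthant" for x :: "real ^ 'n"
    using coord_sum_nonneg[OF that] by simp
  have contD: "continuous_on orthant D"
    unfolding D_def
    by (intro continuous_intros continuous_on_L continuous_on_compose2[OF l])
       (auto dest: pos simp: rescale_in_corner_simplex less_imp_neq[symmetric])
  have expD: "exp (D x) = 1" if x: "x \<in> orthant" for x
  proof -
    let ?c = "1 + coord_sum x"
    note c = pos[OF x]
    have "1 - coord_sum (?\<phi> x) = 1 / ?c" using c by (simp add: field_simps)
    then have "compactified (?\<phi> x) = of_real (1 / ?c) ^ m * poly_eval f x"
      using c by (subst compactified_scaleR[of "1 / ?c"]) auto
    moreover have "exp (complex_of_real (real m * ln ?c)) = of_real ?c ^ m"
      using c by (simp only: exp_of_real exp_of_nat_mult) simp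
    ultimately show ?thesis
      using c x poly_eval_nonzero[OF x] exp_l[OF rescale_in_corner_simplex[OF x]]
      by (simp add: D_def exp_diff exp_add exp_L power_one_over field_simps del: of_real_add of_real_mult)
  qed
  \<comment> \<open>\<open>exp (D x) = 1\<close> confines \<open>D\<close> to integer multiples of
    \<open>2 * pi * \<i>\<close>, a set with gaps of size \<open>2 * pi\<close>, while the orthant
    is connected.\<close>
  have "D constant_on orthant"
  proof (rule continuous_discrete_range_constant[OF convex_connected[OF convex_orthant] contD])
    fix x :: "real ^ 'n" assume x: "x \<in> orthant"
    show "\<exists>e>0. \<forall>y. y \<in> orthant \<and> D y \<noteq> D x \<longrightarrow> e \<le> norm (D y - D x)"
    proof (intro exI[of _ "2 * pi"] conjI allI impI)
      fix y assume y: "y \<in> orthant \<and> D y \<noteq> D x"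
      have "exp (D y) = exp (D x)" using expD x y by simp
      then obtain k :: int where k: "D y = D x + of_int (2 * k) * (of_real pi * \<i>)"
        by (auto simp: exp_eq)
      with y have "k \<noteq> 0" by auto
      then have "1 \<le> \<bar>real_of_int k\<bar>" by linarith
      then have "2 * pi * 1 \<le> 2 * pi * \<bar>real_of_int k\<bar>" by (intro mult_left_mono) auto
      then show "2 * pi \<le> norm (D y - D x)" using k by (simp add: norm_mult)
    qed auto
  qed
  then obtain c where c: "\<And>x. x \<in> orthant \<Longrightarrow> D x = c" by (auto simp: constant_on_def)
  have "compact (l ` corner_simplex)"
    by (intro compact_continuous_image l compact_corner_simplex)
  then obtain b where b: "\<And>y. y \<in> corner_simplex \<Longrightarrow> norm (l y) \<le> b"
    by (metis compact_imp_bounded bounded_iff imageI)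
  show thesis
  proof (rule that)
    fix x :: "real ^ 'n" assume x: "x \<in> orthant"
    have "L x - of_real (real m * ln (1 + coord_sum x)) = c + l (?\<phi> x)"
      using c[OF x] by (simp add: D_def algebra_simps)
    also have "norm \<dots> \<le> norm c + b"
      by (intro order.trans[OF norm_triangle_ineq] add_left_mono b rescale_in_corner_simplex x)
    finally show "norm (L x - of_real (real m * ln (1 + coord_sum x))) \<le> norm c + b" .
  qed
qed

text \<open>\<open>B\<close> is independent of \<open>s\<close>, so the extra factor is bounded on
  bounded sets of \<open>s\<close>; the locally uniform convergence behind holomorphy rests on
  this.\<close>

lemma norm_exp_L_bound:
  obtains B where "B \<ge> 0" and "\<And>s x. x \<in> orthant \<Longrightarrow>
    norm (exp (- s * L x)) \<le> (1 + coord_sum x) powr (- (real m * Re s)) * exp (norm s * B)"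
proof -
  obtain B where B: "\<And>x. x \<in> orthant \<Longrightarrow> norm (L x - of_real (real m * ln (1 + coord_sum x))) \<le> B"
    using log_bound by blast
  show thesis
  proof (rule that[of "max B 0"])
    fix s and x :: "real ^ 'n" assume x: "x \<in> orthant"
    define D where "D = L x - of_real (real m * ln (1 + coord_sum x))"
    have c: "1 + coord_sum x > 0" using coord_sum_nonneg[OF x] by simp
    have "- s * L x = - s * of_real (real m * ln (1 + coord_sum x)) + (- s * D)"
      by (simp add: D_def algebra_simps)
    then have "norm (exp (- s * L x)) =
        norm (exp (- s * of_real (real m * ln (1 + coord_sum x)))) * norm (exp (- s * D))"
      by (simp only: exp_add norm_mult)
    also have "norm (exp (- s * of_real (real m * ln (1 + coord_sum x)))) =
        (1 + coord_sum x) powr (- (real m * Re s))"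
      using c by (simp add: norm_exp_eq_Re powr_def algebra_simps)
    also have "norm (exp (- s * D)) \<le> exp (norm s * max B 0)"
    proof -
      have "norm (exp (- s * D)) \<le> exp (norm (- s * D))" by (rule norm_exp)
      also have "norm (- s * D) \<le> norm s * max B 0"
        using B[OF x] by (auto simp: norm_mult D_def le_max_iff_disj intro!: mult_left_mono)
      finally show ?thesis by simp
    qed
    finally show "norm (exp (- s * L x)) \<le> (1 + coord_sum x) powr (- (real m * Re s)) * exp (norm s * max B 0)"
      by (simp add: mult_left_mono)
  qed auto
qed

definition Z :: "(real ^ 'n \<Rightarrow> complex) \<Rightarrow> complex \<Rightarrow> complex" where
  "Z G s = (LINT x:orthant|lborel. G x * exp (- s * L x))"

lemma integrand_bound:
  assumes G: "homogeneous d G"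
  obtains C where "C \<ge> 0" and "\<And>s x. x \<in> orthant \<Longrightarrow>
    norm (G x * exp (- s * L x)) \<le> C * exp (norm s * C) * (1 + coord_sum x) powr (- (real m * Re s - real d))"
proof -
  obtain B where B: "B \<ge> 0" "\<And>s x. x \<in> orthant \<Longrightarrow>
    norm (exp (- s * L x)) \<le> (1 + coord_sum x) powr (- (real m * Re s)) * exp (norm s * B)"
    using norm_exp_L_bound by blast
  obtain A where A: "\<And>x. x \<in> orthant \<Longrightarrow> norm (G x) \<le> A * (1 + coord_sum x) ^ d"
    using homogeneous_bound[OF G] by blast
  define C where "C = max A B"
  have C: "A \<le> C" "B \<le> C" "C \<ge> 0" using B(1) by (auto simp: C_def)
  show thesis
  proof (rule that[OF C(3)])
    fix s and x :: "real ^ 'n" assume x: "x \<in> orthant"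
    define c where "c = 1 + coord_sum x"
    have c: "c > 0" using coord_sum_nonneg[OF x] by (simp add: c_def)
    have "norm (G x * exp (- s * L x)) \<le> (C * c ^ d) * (c powr (- (real m * Re s)) * exp (norm s * C))"
      unfolding norm_mult
    proof (intro mult_mono)
      have "norm (G x) \<le> A * c ^ d" using A[OF x] by (simp add: c_def)
      also have "\<dots> \<le> C * c ^ d" using C c by (intro mult_right_mono) auto
      finally show "norm (G x) \<le> C * c ^ d" .
      have "norm (exp (- s * L x)) \<le> c powr (- (real m * Re s)) * exp (norm s * B)"
        using B(2)[OF x] by (simp add: c_def)
      also have "\<dots> \<le> c powr (- (real m * Re s)) * exp (norm s * C)"
        using C by (intro mult_left_mono) (auto intro!: mult_left_mono)
      finally show "norm (exp (- s * L x)) \<le> c powr (- (real m * Re s)) * exp (norm s * C)" .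
    qed (use C c in auto)
    also have "\<dots> = C * exp (norm s * C) * c powr (- (real m * Re s - real d))"
      using c by (simp add: powr_realpow[symmetric] powr_add[symmetric] mult_ac)
    finally show "norm (G x * exp (- s * L x)) \<le>
        C * exp (norm s * C) * (1 + coord_sum x) powr (- (real m * Re s - real d))"
      by (simp add: c_def)
  qed
qed

lemma integrand_measurable:
  assumes "continuous_on orthant G"
  shows "(\<lambda>x. indicator orthant x *\<^sub>R (G x * exp (- s * L x))) \<in> borel_measurable borel"
  by (rule borel_measurable_continuous_on_indicator)
     (intro borel_closed closed_orthant continuous_intros assms continuous_on_L)+

lemma integrable_integrand:
  assumes G: "homogeneous d G" and s: "real m * Re s > real (d + CARD('n))"
  shows "set_integrable lborel orthant (\<lambda>x. G x * exp (- s * L x))"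
proof -
  obtain C where C: "C \<ge> 0" "\<And>s x. x \<in> orthant \<Longrightarrow>
    norm (G x * exp (- s * L x)) \<le> C * exp (norm s * C) * (1 + coord_sum x) powr (- (real m * Re s - real d))"
    using integrand_bound[OF G] by blast
  have "set_integrable lborel (orthant :: (real ^ 'n) set) (\<lambda>x. (1 + coord_sum x) powr (- (real m * Re s - real d)))"
    using s by (intro set_integrable_orthant_powr) simp
  then have "set_integrable lborel (orthant :: (real ^ 'n) set)
      (\<lambda>x. C * exp (norm s * C) * (1 + coord_sum x) powr (- (real m * Re s - real d)))"
    by (intro set_integrable_mult_right)
  then show ?thesis
    unfolding set_integrable_def
  proof (rule Bochner_Integration.integrable_bound)
    show "(\<lambda>x. indicator orthant x *\<^sub>R (G x * exp (- s * L x))) \<in> borel_measurable lborel"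
      using integrand_measurable[OF homogeneousD(1)[OF G]] by simp
    show "AE x in lborel. norm (indicator orthant x *\<^sub>R (G x * exp (- s * L x))) \<le>
        norm (indicator orthant x *\<^sub>R (C * exp (norm s * C) * (1 + coord_sum x) powr (- (real m * Re s - real d))))"
      using C by (intro AE_I2) (auto simp: indicator_def)
  qed
qed

end

section \<open>The Euler operator along rays\<close>

text \<open>A log branch is only assumed continuous. Near \<open>t\<close> its imaginary part moves
  by less than pi, so it coincides with \<open>l t\<close> plus the principal logarithm of
  \<open>\<phi> u / \<phi> t\<close>, which is differentiable since that quotient is near 1.\<close>

lemma has_vector_derivative_log:
  fixes l \<phi> :: "real \<Rightarrow> complex"
  assumes cont: "isCont l t" and \<phi>: "(\<phi> has_vector_derivative \<phi>') (at t)"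
    and exp: "\<forall>\<^sub>F u in nhds t. exp (l u) = \<phi> u"
  shows "(l has_vector_derivative \<phi>' / \<phi> t) (at t)"
proof -
  have t: "\<phi> t = exp (l t)" using eventually_nhds_x_imp_x[OF exp] by simp
  then have t0: "\<phi> t \<noteq> 0" by simp
  have "((\<lambda>u. \<phi> u / \<phi> t) has_vector_derivative \<phi>' / \<phi> t) (at t)"
    by (rule has_vector_derivative_divide[OF \<phi>])
  then have "(Ln \<circ> (\<lambda>u. \<phi> u / \<phi> t) has_vector_derivative \<phi>' / \<phi> t * 1) (at t)"
    by (rule field_vector_diff_chain_at) (use t0 in \<open>auto intro!: derivative_eq_intros\<close>)
  then have der: "((\<lambda>u. l t + Ln (\<phi> u / \<phi> t)) has_vector_derivative \<phi>' / \<phi> t) (at t)"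
    by (auto intro!: derivative_eq_intros simp: o_def)
  have "((\<lambda>u. Im (l u - l t)) \<longlongrightarrow> Im (l t - l t)) (at t)"
    using cont unfolding isCont_def by (intro tendsto_intros)
  then have "\<forall>\<^sub>F u in at t. \<bar>Im (l u - l t)\<bar> < pi"
    by (auto dest!: tendstoD[of _ _ _ pi] simp: dist_real_def)
  moreover have "\<forall>\<^sub>F u in at t. exp (l u) = \<phi> u"
    using exp by (simp add: eventually_at_filter eventually_mono)
  ultimately have "\<forall>\<^sub>F u in at t. l t + Ln (\<phi> u / \<phi> t) = l u"
  proof eventually_elim
    case (elim u)
    have "\<phi> u / \<phi> t = exp (l u - l t)" using elim t by (simp add: exp_diff)
    moreover have "Ln (exp (l u - l t)) = l u - l t" using elim(1) by (intro Ln_exp) linarith+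
    ultimately show ?case by simp
  qed
  moreover have "l t + Ln (\<phi> t / \<phi> t) = l t" using t0 by simp
  ultimately show ?thesis
    using der unfolding has_vector_derivative_def
    by (intro has_derivative_transform_eventually[OF der[unfolded has_vector_derivative_def]]) auto
qed

context mahler_log
begin

abbreviation half_plane :: "nat \<Rightarrow> complex set" where
  "half_plane k \<equiv> {s. real m * Re s > real k}"

lemma open_half_plane: "open (half_plane k)"
  by (intro open_Collect_less continuous_intros)

text \<open>Over a cube the integral is holomorphic by differentiation under the integral sign. The
  cubes exhaust the orthant, and one dominating function per closed disc makes the convergence
  uniform there.\<close>

lemma holomorphic_Z:
  assumes G: "homogeneous d G"
  shows "Z G holomorphic_on half_plane (d + CARD('n))"
proof -
  define Q :: "nat \<Rightarrow> (real ^ 'n) set" where "Q k = cbox 0 (\<chi> i. real k)" for k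
  have Q: "Q k \<subseteq> orthant" for k by (auto simp: Q_def orthant_def mem_box_cart)
  have [measurable]: "Q k \<in> sets borel" for k by (simp add: Q_def)
  define F where "F k s = integral (Q k) (\<lambda>x. G x * exp (- s * L x))" for k s
  note contG = homogeneousD(1)[OF G]
  show ?thesis
  proof (rule holomorphic_uniform_sequence[OF open_half_plane, where f = F])
    fix k
    have cG: "continuous_on (Q k) G" and cL: "continuous_on (Q k) L"
      using Q contG continuous_on_L continuous_on_subset by blast+
    have "F k holomorphic_on UNIV"
      unfolding F_def Q_def
    proof (rule leibniz_rule_holomorphic)
      fix s x
      show "((\<lambda>s. G x * exp (- s * L x)) has_field_derivative G x * (exp (- s * L x) * (- L x))) (at s within UNIV)"
        by (auto intro!: derivative_eq_intros)
    next
      fix s :: complex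
      show "(\<lambda>x. G x * exp (- s * L x)) integrable_on cbox 0 (\<chi> i. real k)"
        by (intro integrable_continuous continuous_intros cG[unfolded Q_def] cL[unfolded Q_def])
    next
      have "continuous_on (UNIV \<times> Q k) (\<lambda>z. G (snd z) * (exp (- fst z * L (snd z)) * (- L (snd z))))"
        by (intro continuous_intros continuous_on_compose2[OF cG] continuous_on_compose2[OF cL]) auto
      then show "continuous_on (UNIV \<times> cbox 0 (\<chi> i. real k)) (\<lambda>(s, x). G x * (exp (- s * L x) * (- L x)))"
        by (simp add: case_prod_beta' Q_def)
    qed simp
    then show "F k holomorphic_on half_plane (d + CARD('n))"
      by (rule holomorphic_on_subset) simp
  next
    fix z :: complex assume z: "z \<in> half_plane (d + CARD('n))"
    \<comment> \<open>Half the distance from \<open>z\<close> to the line bounding the half plane,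
      so the closed disc stays inside.\<close>
    define r where "r = (real m * Re z - real (d + CARD('n))) / (2 * real m)"
    have r: "r > 0" "real m * (Re z - r) > real (d + CARD('n))"
    proof -
      show "r > 0" using z m_pos by (simp add: r_def)
      have "real m * r = (real m * Re z - real (d + CARD('n))) / 2"
        using m_pos by (simp add: r_def)
      with z show "real m * (Re z - r) > real (d + CARD('n))"
        by (simp add: right_diff_distrib)
    qed
    have Re: "Re z - r \<le> Re s" and nrm: "norm s \<le> norm z + r" if "s \<in> cball z r" for s
    proof -
      have "\<bar>Re (z - s)\<bar> \<le> r" using that abs_Re_le_cmod[of "z - s"] by (simp add: dist_norm)
      then show "Re z - r \<le> Re s" by simp
      show "norm s \<le> norm z + r"
        using that norm_triangle_ineq2[of s z] by (simp add: dist_norm norm_minus_commute)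
    qed
    have sub: "cball z r \<subseteq> half_plane (d + CARD('n))"
    proof
      fix s assume "s \<in> cball z r"
      from Re[OF this] have "real m * (Re z - r) \<le> real m * Re s" by (intro mult_left_mono) auto
      with r show "s \<in> half_plane (d + CARD('n))" by simp
    qed
    obtain C where C: "C \<ge> 0" "\<And>s x. x \<in> orthant \<Longrightarrow>
      norm (G x * exp (- s * L x)) \<le> C * exp (norm s * C) * (1 + coord_sum x) powr (- (real m * Re s - real d))"
      using integrand_bound[OF G] by blast
    \<comment> \<open>The worst case of the bound over the disc: the real part of \<open>s\<close>
      is replaced by its least value and the norm by its largest.\<close>
    define h where "h x = C * exp ((norm z + r) * C) * (1 + coord_sum x) powr (- (real m * (Re z - r) - real d))"
      for x :: "real ^ 'n"
    have h: "norm (G x * exp (- s * L x)) \<le> h x" if "x \<in> orthant" "s \<in> cball z r" for s x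
    proof -
      have "norm (G x * exp (- s * L x)) \<le> C * exp (norm s * C) * (1 + coord_sum x) powr (- (real m * Re s - real d))"
        using that by (intro C)
      also have "\<dots> \<le> h x"
        unfolding h_def
        using C(1) Re[OF that(2)] nrm[OF that(2)] coord_sum_nonneg[OF that(1)]
        by (intro mult_mono powr_mono) (auto intro!: mult_right_mono mult_left_mono)
      finally show ?thesis .
    qed
    have inth: "set_integrable lborel orthant h"
      unfolding h_def using r by (intro set_integrable_mult_right set_integrable_orthant_powr) simp
    then have [measurable]: "(\<lambda>x. indicator orthant x *\<^sub>R h x) \<in> borel_measurable borel"
      unfolding set_integrable_def by (simp add: borel_measurable_integrable)
    define \<epsilon> where "\<epsilon> k = (LINT x:orthant - Q k|lborel. h x)" for k
    have h0: "h x \<ge> 0" for x using C(1) by (simp add: h_def)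
    have "(\<lambda>k. \<integral>x. indicator (orthant - Q k) x *\<^sub>R h x \<partial>lborel) \<longlonglongrightarrow> (\<integral>x. 0 \<partial>(lborel :: (real ^ 'n) measure))"
    proof (rule integral_dominated_convergence[where w = "\<lambda>x. indicator orthant x *\<^sub>R h x"])
      show "AE x in lborel. (\<lambda>k. indicator (orthant - Q k) x *\<^sub>R h x) \<longlonglongrightarrow> 0"
      proof (rule AE_I2)
        fix x :: "real ^ 'n"
        have "indicator (orthant - Q k) x *\<^sub>R h x = 0" if "k \<ge> nat \<lceil>coord_sum x\<rceil>" for k
        proof (cases "x \<in> orthant")
          case True
          have "x $ i \<le> coord_sum x" for i
            unfolding coord_sum_def by (rule member_le_sum) (use True in \<open>auto simp: orthant_def\<close>)
          moreover have "coord_sum x \<le> real k" using that by linarith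
          ultimately have "x \<in> Q k"
            using True by (auto simp: Q_def mem_box_cart orthant_def intro: order_trans)
          then show ?thesis by simp
        qed simp
        then show "(\<lambda>k. indicator (orthant - Q k) x *\<^sub>R h x) \<longlonglongrightarrow> 0"
          by (intro tendsto_eventually eventually_sequentiallyI)
      qed
      show "(\<lambda>x. indicator (orthant - Q k) x *\<^sub>R h x) \<in> borel_measurable lborel" for k
      proof -
        have "(\<lambda>x. indicator (orthant - Q k) x *\<^sub>R h x) =
            (\<lambda>x. indicator (- Q k) x *\<^sub>R (indicator orthant x *\<^sub>R h x))"
          by (auto simp: fun_eq_iff indicator_def)
        then show ?thesis by (simp only:) measurable
      qed
    qed (use inth h0 in \<open>auto simp: set_integrable_def indicator_def\<close>)
    then have \<epsilon>: "\<epsilon> \<longlonglongrightarrow> 0"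
      by (simp add: \<epsilon>_def[abs_def] set_lebesgue_integral_def)
    have diff: "norm (Z G s - F k s) \<le> \<epsilon> k" if s: "s \<in> cball z r" for s k
    proof -
      let ?g = "\<lambda>x. G x * exp (- s * L x)"
      have int: "set_integrable lborel orthant ?g"
        using s sub by (intro integrable_integrand[OF G]) auto
      have intQ: "set_integrable lborel (Q k) ?g" and intD: "set_integrable lborel (orthant - Q k) ?g"
        by (rule set_integrable_subset[OF int]; use Q in auto)+
      have "Z G s = (LINT x:Q k \<union> (orthant - Q k)|lborel. ?g x)"
        using Q by (simp add: Z_def Un_absorb1)
      also have "\<dots> = (LINT x:Q k|lborel. ?g x) + (LINT x:orthant - Q k|lborel. ?g x)"
        by (rule set_integral_Un[OF _ intQ intD]) auto
      also have "(LINT x:Q k|lborel. ?g x) = F k s"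
        unfolding F_def by (rule set_borel_integral_eq_integral(2)[OF intQ])
      finally have "norm (Z G s - F k s) = norm (LINT x:orthant - Q k|lborel. ?g x)" by simp
      also have "\<dots> \<le> (LINT x:orthant - Q k|lborel. norm (?g x))"
        by (rule set_integral_norm_bound[OF intD])
      also have "\<dots> \<le> \<epsilon> k"
        unfolding \<epsilon>_def
        using h[OF _ s] by (intro set_integral_mono set_integrable_norm intD set_integrable_subset[OF inth]) auto
      finally show ?thesis .
    qed
    have "uniform_limit (cball z r) F (Z G) sequentially"
    proof (rule uniform_limitI)
      fix e :: real assume "e > 0"
      then have "\<forall>\<^sub>F k in sequentially. \<epsilon> k < e"
        by (rule order_tendstoD(2)[OF \<epsilon>])
      then show "\<forall>\<^sub>F k in sequentially. \<forall>s\<in>cball z r. dist (F k s) (Z G s) < e"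
        by eventually_elim (auto simp: dist_norm norm_minus_commute[of "F _ _"] intro: le_less_trans[OF diff])
    qed
    with r sub show "\<exists>d'>0. cball z d' \<subseteq> half_plane (d + CARD('n)) \<and> uniform_limit (cball z d') F (Z G) sequentially"
      by blast
  qed
qed

text \<open>\<open>m f - E f\<close>, where \<open>E\<close> is the Euler operator \<open>\<Sum>\<^sub>i x\<^sub>i \<partial>\<^sub>i\<close>.\<close>

definition euler_defect :: "real ^ 'n \<Rightarrow> complex" where
  "euler_defect x = (\<Sum>j=1..m. of_nat j * poly_eval (hom_part (m - j) f) x)"

lemma euler_defect_ray:
  assumes t: "t > 0"
  shows "((\<lambda>t. poly_eval f (t *\<^sub>R x)) has_vector_derivative
    (of_nat m * poly_eval f (t *\<^sub>R x) - euler_defect (t *\<^sub>R x)) / of_real t) (at t)"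
proof -
  let ?c = "\<lambda>i. poly_eval (hom_part i f) x"
  have "((\<lambda>t. poly_eval f (t *\<^sub>R x)) has_vector_derivative
      (\<Sum>i\<le>m. of_real (real i * t ^ (i - 1)) * ?c i)) (at t)"
    unfolding poly_eval_eq_sum_hom_part[of f "_ *\<^sub>R x"] poly_eval_hom_part_scaleR of_real_power[symmetric]
    by (intro has_vector_derivative_sum has_vector_derivative_mult_left
        has_vector_derivative_of_real has_real_derivative_iff_has_vector_derivative[THEN iffD1])
       (auto intro!: derivative_eq_intros)
  also have "(\<Sum>i\<le>m. of_real (real i * t ^ (i - 1)) * ?c i) =
      (\<Sum>i\<le>m. of_nat i * (of_real t ^ i * ?c i)) / of_real t"
    unfolding sum_divide_distrib
  proof (rule sum.cong[OF refl])
    fix i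
    show "of_real (real i * t ^ (i - 1)) * ?c i = of_nat i * (of_real t ^ i * ?c i) / of_real t"
      using t by (cases i) auto
  qed
  also have "(\<Sum>i\<le>m. of_nat i * (of_real t ^ i * ?c i)) =
      of_nat m * poly_eval f (t *\<^sub>R x) - (\<Sum>i\<le>m. of_nat (m - i) * (of_real t ^ i * ?c i))"
    unfolding poly_eval_eq_sum_hom_part[of f "_ *\<^sub>R x"] poly_eval_hom_part_scaleR sum_distrib_left
      sum_subtractf[symmetric]
    by (intro sum.cong refl) (auto simp: of_nat_diff algebra_simps)
  also have "(\<Sum>i\<le>m. of_nat (m - i) * (of_real t ^ i * ?c i)) = (\<Sum>i<m. of_nat (m - i) * (of_real t ^ i * ?c i))"
    by (simp flip: lessThan_Suc_atMost)
  also have "\<dots> = euler_defect (t *\<^sub>R x)"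
    unfolding euler_defect_def poly_eval_hom_part_scaleR
    by (rule sum.reindex_bij_witness[of _ "\<lambda>j. m - j" "\<lambda>i. m - i"]) auto
  finally show ?thesis .
qed

section \<open>Differentiation along rays and the recurrence for \<open>Z\<close>\<close>

lemma L_ray:
  assumes \<sigma>: "\<sigma> \<in> orthant" and t: "t > 0"
  shows "((\<lambda>t. L (t *\<^sub>R \<sigma>)) has_vector_derivative
    (of_nat m - euler_defect (t *\<^sub>R \<sigma>) / poly_eval f (t *\<^sub>R \<sigma>)) / of_real t) (at t)"
proof -
  have "continuous_on {0<..} (\<lambda>t. L (t *\<^sub>R \<sigma>))"
    by (intro continuous_on_compose2[OF continuous_on_L] continuous_intros) (auto simp: scaleR_orthant \<sigma>)
  then have "isCont (\<lambda>t. L (t *\<^sub>R \<sigma>)) t"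
    using t by (simp add: continuous_on_eq_continuous_at open_greaterThan)
  moreover have "\<forall>\<^sub>F u in nhds t. exp (L (u *\<^sub>R \<sigma>)) = poly_eval f (u *\<^sub>R \<sigma>)"
    using eventually_nhds_in_open[OF open_greaterThan, of t 0] t
    by (auto elim!: eventually_mono simp: exp_L scaleR_orthant \<sigma>)
  ultimately
  have "((\<lambda>t. L (t *\<^sub>R \<sigma>)) has_vector_derivative
    (of_nat m * poly_eval f (t *\<^sub>R \<sigma>) - euler_defect (t *\<^sub>R \<sigma>)) / of_real t / poly_eval f (t *\<^sub>R \<sigma>)) (at t)"
    by (rule has_vector_derivative_log[OF _ euler_defect_ray[OF t]])
  also have "(of_nat m * poly_eval f (t *\<^sub>R \<sigma>) - euler_defect (t *\<^sub>R \<sigma>)) / of_real t / poly_eval f (t *\<^sub>R \<sigma>) =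
      (of_nat m - euler_defect (t *\<^sub>R \<sigma>) / poly_eval f (t *\<^sub>R \<sigma>)) / of_real t"
    using poly_eval_nonzero[OF scaleR_orthant[OF \<sigma>, of t]] t by (simp add: field_simps)
  finally show ?thesis .
qed

text \<open>The derivative of \<open>t ^ (d + p) * G \<sigma> * exp (- s * L (t \<sigma>))\<close>
  along the ray, divided by the Jacobian \<open>t ^ (p - 1)\<close>. The top-degree part of
  \<open>f\<close> contributes to the first coefficient; the lower parts come divided by
  \<open>f\<close>, which is the shift from \<open>s\<close> to \<open>s + 1\<close>.\<close>

definition radial_integrand :: "nat \<Rightarrow> (real ^ 'n \<Rightarrow> complex) \<Rightarrow> complex \<Rightarrow> real ^ 'n \<Rightarrow> complex" where
  "radial_integrand d G s x = (of_nat (d + CARD('n)) - of_nat m * s) * (G x * exp (- s * L x)) +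
     s * (\<Sum>j=1..m. of_nat j * (G x * poly_eval (hom_part (m - j) f) x * exp (- (s + 1) * L x)))"

lemma radial_derivative:
  assumes G: "homogeneous d G" and \<sigma>: "\<sigma> \<in> orthant" and t: "t > 0"
  shows "((\<lambda>t. of_real t ^ (d + CARD('n)) * (G \<sigma> * exp (- s * L (t *\<^sub>R \<sigma>)))) has_vector_derivative
    t ^ (CARD('n) - 1) *\<^sub>R radial_integrand d G s (t *\<^sub>R \<sigma>)) (at t)"
proof -
  let ?x = "t *\<^sub>R \<sigma>" and ?p = "CARD('n)"
  let ?e = "exp (- s * L ?x)"
  have x: "?x \<in> orthant" using \<sigma> t by (simp add: scaleR_orthant)
  have "((exp \<circ> (\<lambda>t. - s * L (t *\<^sub>R \<sigma>))) has_vector_derivative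
      (- s * ((of_nat m - euler_defect ?x / poly_eval f ?x) / of_real t)) * ?e) (at t)"
    by (rule field_vector_diff_chain_at[OF has_vector_derivative_mult_right[OF L_ray[OF \<sigma> t]] DERIV_exp])
  then have e: "((\<lambda>t. G \<sigma> * exp (- s * L (t *\<^sub>R \<sigma>))) has_vector_derivative
      G \<sigma> * ((- s * ((of_nat m - euler_defect ?x / poly_eval f ?x) / of_real t)) * ?e)) (at t)"
    unfolding o_def by (rule has_vector_derivative_mult_right)
  have "((\<lambda>t. complex_of_real (t ^ (d + ?p))) has_vector_derivative
      of_real (real (d + ?p) * t ^ (d + ?p - 1))) (at t)"
    by (intro has_vector_derivative_of_real has_real_derivative_iff_has_vector_derivative[THEN iffD1])
       (auto intro!: derivative_eq_intros)
  from has_vector_derivative_mult[OF this e]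
  have der: "((\<lambda>t. of_real t ^ (d + ?p) * (G \<sigma> * exp (- s * L (t *\<^sub>R \<sigma>)))) has_vector_derivative
      of_real (t ^ (d + ?p)) * (G \<sigma> * ((- s * ((of_nat m - euler_defect ?x / poly_eval f ?x) / of_real t)) * ?e)) +
      of_real (real (d + ?p) * t ^ (d + ?p - 1)) * (G \<sigma> * ?e)) (at t)"
    by simp
  have "- (s + 1) * L ?x = - s * L ?x - L ?x" by (simp add: algebra_simps)
  then have expdiv: "exp (- (s + 1) * L ?x) = ?e / poly_eval f ?x"
    by (simp only: exp_diff exp_L[OF x])
  have sum: "(\<Sum>j=1..m. of_nat j * (G ?x * poly_eval (hom_part (m - j) f) ?x * exp (- (s + 1) * L ?x))) =
      G ?x * euler_defect ?x * (?e / poly_eval f ?x)"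
    unfolding euler_defect_def expdiv by (simp add: sum_distrib_left sum_distrib_right mult_ac sum_divide_distrib)
  have dp: "complex_of_real t ^ (d + ?p) = of_real t * (of_real t ^ (?p - 1) * of_real t ^ d)"
    by (simp add: power_add[symmetric] power_Suc[symmetric] add.commute del: power_Suc)
  have dp1: "complex_of_real t ^ (d + ?p - 1) = of_real t ^ (?p - 1) * of_real t ^ d"
    by (simp add: power_add[symmetric] algebra_simps)
  have G\<sigma>: "G ?x = of_real t ^ d * G \<sigma>"
    using homogeneousD(2)[OF G \<sigma>, of t] t by simp
  \<comment> \<open>Here \<open>T\<close>, \<open>P\<close>, \<open>D\<close> stand for
    \<open>t\<close>, \<open>t ^ (p - 1)\<close>, \<open>t ^ d\<close>; \<open>g\<close> and
    \<open>e\<close> for \<open>G \<sigma>\<close> and the exponential; \<open>E\<close>,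
    \<open>\<phi>\<close> for the Euler defect and \<open>f\<close>; \<open>K\<close>,
    \<open>M\<close> for \<open>d + p\<close> and \<open>m\<close>.\<close>
  have alg: "T * (P * D) * (g * ((- s * ((M - E / \<phi>) / T)) * e)) + K * (P * D) * (g * e) =
      P * ((K - M * s) * (D * g * e) + s * (D * g * E * (e / \<phi>)))"
    if "T \<noteq> 0" "\<phi> \<noteq> 0" for T P D g e \<phi> E K M :: complex
    using that by (simp add: field_simps)
  have "of_real (t ^ (d + ?p)) * (G \<sigma> * ((- s * ((of_nat m - euler_defect ?x / poly_eval f ?x) / of_real t)) * ?e)) +
      of_real (real (d + ?p) * t ^ (d + ?p - 1)) * (G \<sigma> * ?e) = of_real (t ^ (?p - 1)) * radial_integrand d G s ?x"
    unfolding radial_integrand_def sum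
    unfolding of_real_mult of_real_power dp dp1 of_real_of_nat_eq G\<sigma>
    by (rule alg) (use t poly_eval_nonzero[OF x] in auto)
  also have "\<dots> = t ^ (?p - 1) *\<^sub>R radial_integrand d G s ?x"
    by (simp only: scaleR_conv_of_real)
  finally have "of_real (t ^ (d + ?p)) * (G \<sigma> * ((- s * ((of_nat m - euler_defect ?x / poly_eval f ?x) / of_real t)) * ?e)) +
      of_real (real (d + ?p) * t ^ (d + ?p - 1)) * (G \<sigma> * ?e) = t ^ (?p - 1) *\<^sub>R radial_integrand d G s ?x" .
  with der show ?thesis by simp
qed

lemma radial_limit_0:
  assumes \<sigma>: "\<sigma> \<in> orthant"
  shows "((\<lambda>t. of_real t ^ (d + CARD('n)) * (c * exp (- s * L (t *\<^sub>R \<sigma>)))) \<longlongrightarrow> 0) (at_right 0)"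
proof -
  have "continuous_on {0..} (\<lambda>t. of_real t ^ (d + CARD('n)) * (c * exp (- s * L (t *\<^sub>R \<sigma>))))"
    by (intro continuous_intros continuous_on_compose2[OF continuous_on_L]) (auto simp: scaleR_orthant \<sigma>)
  then have "((\<lambda>t. of_real t ^ (d + CARD('n)) * (c * exp (- s * L (t *\<^sub>R \<sigma>)))) \<longlongrightarrow>
      of_real 0 ^ (d + CARD('n)) * (c * exp (- s * L (0 *\<^sub>R \<sigma>)))) (at 0 within {0..})"
    unfolding continuous_on_def by blast
  moreover have "(0 :: complex) ^ (d + CARD('n)) = 0"
    by (simp add: power_0_left)
  ultimately have "((\<lambda>t. of_real t ^ (d + CARD('n)) * (c * exp (- s * L (t *\<^sub>R \<sigma>)))) \<longlongrightarrow> 0) (at 0 within {0..})"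
    by simp
  then show ?thesis
    by (rule tendsto_within_subset) auto
qed

lemma radial_limit_top_zero:
  assumes G: "homogeneous d G" and \<sigma>: "\<sigma> \<in> cube_boundary" and s: "s \<in> half_plane (d + CARD('n))"
  shows "((\<lambda>t. of_real t ^ (d + CARD('n)) * (G \<sigma> * exp (- s * L (t *\<^sub>R \<sigma>)))) \<longlongrightarrow> 0) at_top"
proof -
  let ?p = "CARD('n)"
  have \<sigma>': "\<sigma> \<in> orthant" using \<sigma> cube_boundary_subset_orthant by auto
  obtain C where C: "C \<ge> 0" "\<And>s x. x \<in> orthant \<Longrightarrow>
    norm (G x * exp (- s * L x)) \<le> C * exp (norm s * C) * (1 + coord_sum x) powr (- (real m * Re s - real d))"
    using integrand_bound[OF G] by blast
  define K where "K = C * exp (norm s * C)"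
  define b where "b = real m * Re s - real d - real ?p"
  have b: "b > 0" using s by (simp add: b_def)
  have bound: "norm (of_real t ^ (d + ?p) * (G \<sigma> * exp (- s * L (t *\<^sub>R \<sigma>)))) \<le> K * (1 + t) powr (- b)"
    if t: "t > 0" for t
  proof -
    have eq: "complex_of_real t ^ (d + ?p) * (G \<sigma> * exp (- s * L (t *\<^sub>R \<sigma>))) =
        of_real t ^ ?p * (G (t *\<^sub>R \<sigma>) * exp (- s * L (t *\<^sub>R \<sigma>)))"
      using homogeneousD(2)[OF G \<sigma>', of t] t by (simp add: power_add)
    have "norm (complex_of_real t ^ (d + ?p) * (G \<sigma> * exp (- s * L (t *\<^sub>R \<sigma>)))) =
        t ^ ?p * norm (G (t *\<^sub>R \<sigma>) * exp (- s * L (t *\<^sub>R \<sigma>)))"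
      unfolding eq using t by (simp add: norm_mult norm_power)
    also have "\<dots> \<le> (1 + t) ^ ?p * (K * (1 + t) powr (- (b + real ?p)))"
    proof (intro mult_mono power_mono)
      have "norm (G (t *\<^sub>R \<sigma>) * exp (- s * L (t *\<^sub>R \<sigma>))) \<le> K * (1 + coord_sum (t *\<^sub>R \<sigma>)) powr (- (b + real ?p))"
        using C(2)[OF scaleR_orthant[OF \<sigma>', of t], of s] t by (simp add: K_def b_def)
      also have "t * 1 \<le> t * coord_sum \<sigma>"
        using t coord_sum_ge_1[OF \<sigma>] by (intro mult_left_mono) auto
      then have "K * (1 + coord_sum (t *\<^sub>R \<sigma>)) powr (- (b + real ?p)) \<le> K * (1 + t) powr (- (b + real ?p))"
        using t b C(1) by (intro mult_left_mono powr_mono2') (auto simp: K_def)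
      finally show "norm (G (t *\<^sub>R \<sigma>) * exp (- s * L (t *\<^sub>R \<sigma>))) \<le> K * (1 + t) powr (- (b + real ?p))" .
    qed (use t in auto)
    also have "\<dots> = K * (1 + t) powr (- b)"
      using t by (simp add: powr_realpow[symmetric] powr_add[symmetric] mult.left_commute)
    finally show ?thesis .
  qed
  have "((\<lambda>t. K * (1 + t) powr (- b)) \<longlongrightarrow> K * 0) at_top"
    using b
    by (intro tendsto_intros tendsto_neg_powr filterlim_tendsto_add_at_top[OF tendsto_const filterlim_ident]) auto
  then have lim: "((\<lambda>t. K * (1 + t) powr (- b)) \<longlongrightarrow> 0) at_top" by simp
  show ?thesis
    by (rule Lim_null_comparison[OF eventually_mono[OF eventually_gt_at_top[of 0] bound] lim])
qed

lemma poly_eval_ray_asymp: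
  "((\<lambda>t. poly_eval f (t *\<^sub>R \<sigma>) / of_real t ^ m) \<longlongrightarrow> poly_eval (top_part f) \<sigma>) at_top"
proof -
  let ?c = "\<lambda>i. poly_eval (hom_part i f) \<sigma>"
  have "((\<lambda>t. \<Sum>i\<le>m. ?c i * of_real (inverse (t ^ (m - i)))) \<longlongrightarrow> (\<Sum>i\<le>m. if i = m then ?c i else 0)) at_top"
  proof (rule tendsto_sum)
    fix i assume i: "i \<in> {..m}"
    show "((\<lambda>t. ?c i * of_real (inverse (t ^ (m - i)))) \<longlongrightarrow> (if i = m then ?c i else 0)) at_top"
    proof (cases "i = m")
      case False
      have "((\<lambda>t::real. inverse (t ^ (m - i))) \<longlongrightarrow> 0) at_top"
        by (intro tendsto_inverse_0_at_top filterlim_pow_at_top filterlim_ident) (use i False in auto)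
      then have "((\<lambda>t. ?c i * of_real (inverse (t ^ (m - i)))) \<longlongrightarrow> ?c i * of_real 0) at_top"
        by (intro tendsto_intros)
      with False show ?thesis by simp
    qed simp
  qed
  moreover have "\<forall>\<^sub>F t in at_top. (\<Sum>i\<le>m. ?c i * of_real (inverse (t ^ (m - i)))) =
      poly_eval f (t *\<^sub>R \<sigma>) / of_real t ^ m"
    using eventually_gt_at_top[of 0]
  proof eventually_elim
    case (elim t)
    have "complex_of_real t ^ i / of_real t ^ m = of_real (inverse (t ^ (m - i)))" if "i \<le> m" for i
      using elim that by (simp add: power_diff divide_simps)
    then show ?case
      unfolding poly_eval_eq_sum_hom_part[of f "_ *\<^sub>R \<sigma>"] poly_eval_hom_part_scaleR sum_divide_distrib
      by (intro sum.cong refl) (metis atMost_iff mult.commute times_divide_eq_right)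
  qed
  ultimately show ?thesis
    by (simp add: top_part_def tendsto_cong)
qed

text \<open>On the critical line the power of \<open>t\<close> is exactly \<open>(t ^ m) ^ n\<close>
  and balances the growth of \<open>f ^ n\<close>. Since \<open>n\<close> is an integer, the limit
  does not depend on the branch.\<close>

lemma radial_limit_top_residue:
  assumes \<sigma>: "\<sigma> \<in> cube_boundary" and n: "m * n = d + CARD('n)"
  shows "((\<lambda>t. of_real t ^ (d + CARD('n)) * (c * exp (- of_nat n * L (t *\<^sub>R \<sigma>)))) \<longlongrightarrow>
    c / poly_eval (top_part f) \<sigma> ^ n) at_top"
proof -
  have nz: "\<sigma> \<in> orthant" "poly_eval (top_part f) \<sigma> \<noteq> 0"
    using \<sigma> cube_boundary_nonzero top_part_nonzero by auto
  have "((\<lambda>t. c / (poly_eval f (t *\<^sub>R \<sigma>) / of_real t ^ m) ^ n) \<longlongrightarrow> c / poly_eval (top_part f) \<sigma> ^ n) at_top"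
    using nz by (intro tendsto_intros poly_eval_ray_asymp) auto
  moreover have "\<forall>\<^sub>F t in at_top. c / (poly_eval f (t *\<^sub>R \<sigma>) / of_real t ^ m) ^ n =
      of_real t ^ (d + CARD('n)) * (c * exp (- of_nat n * L (t *\<^sub>R \<sigma>)))"
    using eventually_gt_at_top[of 0]
  proof eventually_elim
    case (elim t)
    have "exp (- of_nat n * L (t *\<^sub>R \<sigma>)) = inverse (poly_eval f (t *\<^sub>R \<sigma>) ^ n)"
      using nz elim by (simp add: exp_minus exp_of_nat_mult exp_L scaleR_orthant)
    moreover have "complex_of_real t ^ (d + CARD('n)) = (of_real t ^ m) ^ n"
      by (simp add: n[symmetric] power_mult)
    ultimately show ?case
      by (simp add: power_divide field_simps)
  qed
  ultimately show ?thesis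
    by (rule Lim_transform_eventually)
qed

lemma homogeneous_mult_hom_part:
  assumes "homogeneous d G" "j \<in> {1..m}"
  shows "homogeneous (d + (m - j)) (\<lambda>x. G x * poly_eval (hom_part (m - j) f) x)"
  by (intro homogeneous_mult assms homogeneous_hom_part)

text \<open>The shift raises \<open>m Re s\<close> by \<open>m\<close> but the degree by only
  \<open>m - j\<close>, a net gain of \<open>j\<close>.\<close>

lemma shift_half_plane:
  assumes "j \<in> {1..m}"
  shows "s + 1 \<in> half_plane (d + (m - j) + k) \<longleftrightarrow> real m * Re s + real j > real (d + k)"
  using assms by (auto simp: of_nat_diff algebra_simps)

text \<open>The second alternative is a point on the edge of convergence. There the coefficient of
  the first integrand is zero, so the value of \<open>Z G s\<close> is immaterial, and the remaining
  integrals converge because each has a margin \<open>j \<ge> 1\<close>.\<close>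

lemma integral_radial_integrand:
  assumes G: "homogeneous d G"
    and s: "s \<in> half_plane (d + CARD('n)) \<or> of_nat m * s = of_nat (d + CARD('n))"
  shows "set_integrable lborel orthant (radial_integrand d G s)"
    and "(LINT x:orthant|lborel. radial_integrand d G s x) =
      (of_nat (d + CARD('n)) - of_nat m * s) * Z G s +
      s * (\<Sum>j=1..m. of_nat j * Z (\<lambda>x. G x * poly_eval (hom_part (m - j) f) x) (s + 1))"
proof -
  let ?p = "CARD('n)"
  let ?b = "of_nat (d + ?p) - of_nat m * s"
  have Re: "real m * Re s \<ge> real (d + ?p)"
    using s by (auto dest!: arg_cong[of _ _ Re])
  have i1: "set_integrable lborel orthant (\<lambda>x. ?b * (G x * exp (- s * L x)))"
    using s
  proof
    assume "s \<in> half_plane (d + ?p)"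
    then show ?thesis by (intro set_integrable_mult_right integrable_integrand[OF G]) simp
  qed (simp add: set_integrable_def)
  have i2: "set_integrable lborel orthant (\<lambda>x. G x * poly_eval (hom_part (m - j) f) x * exp (- (s + 1) * L x))"
    if j: "j \<in> {1..m}" for j
    using shift_half_plane[OF j, of s d ?p] Re j
    by (intro integrable_integrand[OF homogeneous_mult_hom_part[OF G j]]) auto
  have i3: "set_integrable lborel orthant
      (\<lambda>x. \<Sum>j=1..m. of_nat j * (G x * poly_eval (hom_part (m - j) f) x * exp (- (s + 1) * L x)))"
    using i2 unfolding set_integrable_def scaleR_sum_right
    by (intro Bochner_Integration.integrable_sum) (auto simp flip: mult_scaleR_right)
  then have i4: "set_integrable lborel orthant
      (\<lambda>x. s * (\<Sum>j=1..m. of_nat j * (G x * poly_eval (hom_part (m - j) f) x * exp (- (s + 1) * L x))))"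
    by (rule set_integrable_mult_right)
  show "set_integrable lborel orthant (radial_integrand d G s)"
    unfolding radial_integrand_def[abs_def] by (intro set_integral_add i1 i4)
  have "(LINT x:orthant|lborel. \<Sum>j=1..m. of_nat j * (G x * poly_eval (hom_part (m - j) f) x * exp (- (s + 1) * L x))) =
      (\<Sum>j=1..m. LINT x:orthant|lborel. of_nat j * (G x * poly_eval (hom_part (m - j) f) x * exp (- (s + 1) * L x)))"
    using i2 unfolding set_lebesgue_integral_def scaleR_sum_right set_integrable_def
    by (intro Bochner_Integration.integral_sum) (auto simp flip: mult_scaleR_right)
  also have "\<dots> = (\<Sum>j=1..m. of_nat j * Z (\<lambda>x. G x * poly_eval (hom_part (m - j) f) x) (s + 1))"
    by (simp add: Z_def)
  finally show "(LINT x:orthant|lborel. radial_integrand d G s x) = ?b * Z G s +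
      s * (\<Sum>j=1..m. of_nat j * Z (\<lambda>x. G x * poly_eval (hom_part (m - j) f) x) (s + 1))"
    unfolding radial_integrand_def using i1 i4 by (subst set_integral_add(2)) (simp_all add: Z_def)
qed

lemma continuous_on_radial_integrand:
  assumes "homogeneous d G"
  shows "continuous_on orthant (radial_integrand d G s)"
  unfolding radial_integrand_def[abs_def]
  by (intro continuous_intros continuous_on_L homogeneousD(1)[OF assms] continuous_on_poly_eval)

text \<open>Inside the half plane the primitive tends to 0 at both ends of every ray, so the whole
  radial integral vanishes.\<close>

lemma Z_recurrence:
  assumes G: "homogeneous d G" and s: "s \<in> half_plane (d + CARD('n))"
  shows "(of_nat m * s - of_nat (d + CARD('n))) * Z G s =
    s * (\<Sum>j=1..m. of_nat j * Z (\<lambda>x. G x * poly_eval (hom_part (m - j) f) x) (s + 1))"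
proof -
  note cb = cube_boundary_subset_orthant[THEN subsetD]
  have "(LINT x:orthant|lborel. radial_integrand d G s x) =
      (LINT \<sigma>:(cube_boundary :: (real ^ 'n) set)|boundary_volume. 0)"
    by (rule integral_orthant_FTC[OF integral_radial_integrand(1)[OF G] continuous_on_radial_integrand[OF G] _
          radial_derivative[OF G cb] radial_limit_0[OF cb] radial_limit_top_zero[OF G]])
       (use s in auto)
  then show ?thesis
    using integral_radial_integrand(2)[OF G, of s] s by (simp add: algebra_simps set_lebesgue_integral_def)
qed

text \<open>At the critical point the term with \<open>Z G\<close> drops out and the boundary term
  at infinity takes its place. This is the source of all cube boundary integrals in the final
  formula.\<close>

lemma Z_boundary_value:
  assumes G: "homogeneous d G" and n: "m * n = d + CARD('n)"
  shows "of_nat n * (\<Sum>j=1..m. of_nat j * Z (\<lambda>x. G x * poly_eval (hom_part (m - j) f) x) (of_nat n + 1)) =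
    (LINT \<sigma>:cube_boundary|boundary_volume. G \<sigma> / poly_eval (top_part f) \<sigma> ^ n)"
proof -
  note cb = cube_boundary_subset_orthant[THEN subsetD]
  have n': "of_nat m * (of_nat n :: complex) = of_nat (d + CARD('n))"
    unfolding n[symmetric] by simp
  have cont: "continuous_on cube_boundary (\<lambda>\<sigma>. G \<sigma> / poly_eval (top_part f) \<sigma> ^ n)"
    by (intro continuous_intros continuous_on_poly_eval continuous_on_subset[OF homogeneousD(1)[OF G]]
        cube_boundary_subset_orthant) (use cube_boundary_nonzero top_part_nonzero in auto)
  have "(LINT x:orthant|lborel. radial_integrand d G (of_nat n) x) =
    (LINT \<sigma>:cube_boundary|boundary_volume. G \<sigma> / poly_eval (top_part f) \<sigma> ^ n)"
    by (rule integral_orthant_FTC[OF integral_radial_integrand(1)[OF G] continuous_on_radial_integrand[OF G] cont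
          radial_derivative[OF G cb] radial_limit_0[OF cb] radial_limit_top_residue[OF _ n]])
       (use n' in auto)
  then show ?thesis
    using integral_radial_integrand(2)[OF G, of "of_nat n"] n' by simp
qed

end

section \<open>Entire continuation of the regularised integral\<close>

lemma lookup_single_mult:
  fixes Q :: laurent
  shows "Poly_Mapping.lookup (Poly_Mapping.single i c * Q) k = c * Poly_Mapping.lookup Q (k - i)"
proof -
  have decomp: "Q = (\<Sum>l\<in>Poly_Mapping.keys Q. Poly_Mapping.single l (Poly_Mapping.lookup Q l))"
    by (rule poly_mapping_eqI) (auto simp: lookup_sum lookup_single when_def in_keys_iff)
  have "Poly_Mapping.lookup (Poly_Mapping.single i c * Q) k =
      (\<Sum>l\<in>Poly_Mapping.keys Q. if i + l = k then c * Poly_Mapping.lookup Q l else 0)"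
    by (subst decomp) (auto simp: sum_distrib_left mult_single lookup_sum lookup_single when_def intro!: sum.cong)
  also have "\<dots> = (\<Sum>l\<in>Poly_Mapping.keys Q. if l = k - i then c * Poly_Mapping.lookup Q l else 0)"
    by (intro sum.cong) auto
  also have "\<dots> = c * Poly_Mapping.lookup Q (k - i)"
    by (subst sum.delta) (auto simp: in_keys_iff)
  finally show ?thesis .
qed

definition ray_coeff :: "'n::finite cpoly \<Rightarrow> nat \<Rightarrow> real ^ 'n \<Rightarrow> complex" where
  "ray_coeff f j \<sigma> = poly_eval (hom_part (total_degree f - j) f) \<sigma> / poly_eval (top_part f) \<sigma>"

text \<open>\<open>k\<close> is the signed exponent of the radius, so the coefficient of its power
  \<open>-T\<close> is taken at \<open>k = - T\<close>.\<close>

definition ray_power_coeff :: "'n::finite cpoly \<Rightarrow> nat \<Rightarrow> int \<Rightarrow> real ^ 'n \<Rightarrow> complex" where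
  "ray_power_coeff f n k \<sigma> = Poly_Mapping.lookup (ray_r f \<sigma> ^ n) k"

lemma ray_power_coeff_0: "ray_power_coeff f 0 k \<sigma> = (if k = 0 then 1 else 0)"
  by (simp add: ray_power_coeff_def lookup_one when_def)

lemma ray_power_coeff_Suc:
  "ray_power_coeff f (Suc n) k \<sigma> =
    (\<Sum>j=1..total_degree f. ray_coeff f j \<sigma> * ray_power_coeff f n (k + int j) \<sigma>)"
  by (simp add: ray_power_coeff_def ray_r_def[of f \<sigma>] ray_coeff_def lookup_sum sum_distrib_right lookup_single_mult)

text \<open>The exponents in \<open>ray_r\<close> lie between \<open>-m\<close> and
  \<open>-1\<close>, so those of its \<open>n\<close>-th power lie between \<open>-m n\<close> and
  \<open>-n\<close>. Both limits of the final sum come from this.\<close>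

lemma ray_power_coeff_eq_0:
  "k > - int n \<or> k < - int (total_degree f * n) \<Longrightarrow> ray_power_coeff f n k \<sigma> = 0"
proof (induction n arbitrary: k)
  case (Suc n)
  show ?case
    unfolding ray_power_coeff_Suc
  proof (rule sum.neutral, intro ballI)
    fix j assume "j \<in> {1..total_degree f}"
    with Suc.prems have "k + int j > - int n \<or> k + int j < - int (total_degree f * n)"
      by auto
    then show "ray_coeff f j \<sigma> * ray_power_coeff f n (k + int j) \<sigma> = 0"
      by (simp add: Suc.IH)
  qed
qed (auto simp: ray_power_coeff_0)

text \<open>This is \<open>\<rho> d/d\<rho> r\<^sup>n\<^sup>+\<^sup>1 = (n + 1) r\<^sup>n \<rho> dr/d\<rho>\<close>, read off at the coefficient of \<open>\<rho>\<^sup>k\<close>.\<close>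

lemma ray_power_coeff_derivation:
  "of_int k * ray_power_coeff f (Suc n) k \<sigma> =
    - of_nat (Suc n) * (\<Sum>j=1..total_degree f. of_nat j * (ray_coeff f j \<sigma> * ray_power_coeff f n (k + int j) \<sigma>))"
proof (induction n arbitrary: k)
  case 0
  have "of_int k * (ray_coeff f j \<sigma> * ray_power_coeff f 0 (k + int j) \<sigma>) =
      - (of_nat j * (ray_coeff f j \<sigma> * ray_power_coeff f 0 (k + int j) \<sigma>))" for j
  proof (cases "k = - int j")
    case False
    then have "k + int j \<noteq> 0" by linarith
    then show ?thesis by (simp add: ray_power_coeff_0)
  qed simp
  then show ?case
    by (simp add: ray_power_coeff_Suc[of f 0] sum_distrib_left sum_negf)
next
  case (Suc n)
  let ?a = "\<lambda>j. ray_coeff f j \<sigma>" and ?c = "\<lambda>n k. ray_power_coeff f n k \<sigma>"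
  let ?m = "total_degree f"
  have "of_int k * ?c (Suc (Suc n)) k = (\<Sum>j=1..?m. of_int k * (?a j * ?c (Suc n) (k + int j)))"
    by (subst ray_power_coeff_Suc) (rule sum_distrib_left)
  \<comment> \<open>Leibniz rule: writing \<open>k = (k + j) - j\<close> sends the derivation either
    to the old power, where the induction hypothesis gives \<open>n + 1\<close> equal terms, or to
    the new factor, which gives one more.\<close>
  also have "\<dots> = (\<Sum>j=1..?m. ?a j * (of_int (k + int j) * ?c (Suc n) (k + int j)) -
      of_nat j * (?a j * ?c (Suc n) (k + int j)))"
    by (intro sum.cong refl) (simp add: algebra_simps)
  also have "\<dots> = (\<Sum>j=1..?m. ?a j * (of_int (k + int j) * ?c (Suc n) (k + int j))) -
      (\<Sum>j=1..?m. of_nat j * (?a j * ?c (Suc n) (k + int j)))"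
    by (rule sum_subtractf)
  also have "(\<Sum>j=1..?m. ?a j * (of_int (k + int j) * ?c (Suc n) (k + int j))) =
      (\<Sum>j=1..?m. \<Sum>i=1..?m. - of_nat (Suc n) * (of_nat i * (?a i * (?a j * ?c n (k + int i + int j)))))"
    unfolding Suc.IH sum_distrib_left by (intro sum.cong refl) (simp add: algebra_simps)
  also have "\<dots> = (\<Sum>i=1..?m. \<Sum>j=1..?m. - of_nat (Suc n) * (of_nat i * (?a i * (?a j * ?c n (k + int i + int j)))))"
    by (rule sum.swap)
  also have "\<dots> = - of_nat (Suc n) * (\<Sum>i=1..?m. of_nat i * (?a i * ?c (Suc n) (k + int i)))"
    by (subst ray_power_coeff_Suc) (simp only: sum_distrib_left)
  finally show ?case
    by (simp add: algebra_simps)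
qed

text \<open>The product form avoids division; it merges the Pochhammer symbols of the recurrence
  with the factorials of the induction hypothesis.\<close>

lemma pochhammer_neg_of_nat_mult_fact:
  "b \<le> a \<Longrightarrow> pochhammer (- of_nat a :: complex) b * fact (a - b) = (- 1) ^ b * fact a"
proof (induction b)
  case (Suc b)
  have f: "fact (a - b) = (of_nat (a - b) :: complex) * fact (a - Suc b)"
    using Suc.prems by (subst fact_reduce) (auto simp: Suc_diff_Suc)
  have n: "of_nat (a - b) = (of_nat a - of_nat b :: complex)"
    using Suc.prems by (intro of_nat_diff) simp
  have "(- of_nat a + of_nat b) * fact (a - Suc b) = - (fact (a - b) :: complex)"
    unfolding f n by (simp add: algebra_simps)
  then have "pochhammer (- of_nat a :: complex) (Suc b) * fact (a - Suc b) =
      - (pochhammer (- of_nat a) b * fact (a - b))"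
    by (simp only: pochhammer_Suc mult.assoc mult_minus_right)
  also have "\<dots> = (- 1) ^ Suc b * fact a" using Suc by simp
  finally show ?case .
qed simp

section \<open>Gamma normalisation and entire continuation\<close>

context mahler_log
begin

text \<open>The function \<open>U\<close> before continuation. \<open>rGamma\<close> is entire, so
  the division by Gamma remains meaningful at the poles of Gamma.\<close>

definition regularised :: "nat \<Rightarrow> (real ^ 'n \<Rightarrow> complex) \<Rightarrow> complex \<Rightarrow> complex" where
  "regularised d G s = rGamma (of_nat m * s - of_nat (d + CARD('n))) * Gamma s * Z G s"

lemma half_plane_Re_pos: "s \<in> half_plane (d + CARD('n)) \<Longrightarrow> Re s > 0"
proof -
  assume "s \<in> half_plane (d + CARD('n))"
  then have "real m * Re s > 0" by (auto intro: le_less_trans[rotated])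
  then show ?thesis using m_pos by (simp add: zero_less_mult_iff)
qed

lemma Re_pos_not_nonpos_Int: "Re s > 0 \<Longrightarrow> s \<notin> \<int>\<^sub>\<le>\<^sub>0"
  by (auto elim!: nonpos_Ints_cases)

lemma holomorphic_regularised:
  assumes "homogeneous d G"
  shows "regularised d G holomorphic_on half_plane (d + CARD('n))"
  unfolding regularised_def[abs_def]
  by (intro holomorphic_intros holomorphic_Z assms)
     (use half_plane_Re_pos Re_pos_not_nonpos_Int in blast)

text \<open>With \<open>w = m s - p - d\<close>, one factor \<open>w\<close> of
  \<open>rGamma w\<close> absorbs the coefficient on the left of the recurrence for
  \<open>Z\<close>, and the factor \<open>s\<close> on the right turns \<open>Gamma s\<close> into
  \<open>Gamma (s + 1)\<close>. What remains has polynomial coefficients, so no division is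
  left.\<close>

lemma regularised_recurrence:
  assumes G: "homogeneous d G" and s: "s \<in> half_plane (d + CARD('n))"
  shows "regularised d G s = (\<Sum>j=1..m. of_nat j * pochhammer (of_nat m * s - of_nat (d + CARD('n)) + 1) (j - 1) *
    regularised (d + (m - j)) (\<lambda>x. G x * poly_eval (hom_part (m - j) f) x) (s + 1))"
proof -
  let ?w = "of_nat m * s - of_nat (d + CARD('n)) :: complex"
  let ?Z = "\<lambda>j. Z (\<lambda>x. G x * poly_eval (hom_part (m - j) f) x) (s + 1)"
  have w: "rGamma ?w = ?w * rGamma (?w + 1)"
    by (simp only: rGamma_plus1)
  have "regularised d G s = rGamma (?w + 1) * Gamma s * (?w * Z G s)"
    unfolding regularised_def w by (simp only: mult_ac)
  also have "\<dots> = rGamma (?w + 1) * (s * Gamma s) * (\<Sum>j=1..m. of_nat j * ?Z j)"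
    unfolding Z_recurrence[OF G s] by (simp add: mult_ac)
  also have "s * Gamma s = Gamma (s + 1)"
    using half_plane_Re_pos[OF s] by (intro Gamma_plus1[symmetric] Re_pos_not_nonpos_Int)
  also have "rGamma (?w + 1) * Gamma (s + 1) * (\<Sum>j=1..m. of_nat j * ?Z j) =
      (\<Sum>j=1..m. of_nat j * pochhammer (?w + 1) (j - 1) *
        regularised (d + (m - j)) (\<lambda>x. G x * poly_eval (hom_part (m - j) f) x) (s + 1))"
    unfolding sum_distrib_left
  proof (rule sum.cong[OF refl])
    fix j assume j: "j \<in> {1..m}"
    have A: "of_nat m * (s + 1) - of_nat (d + (m - j) + CARD('n)) = ?w + 1 + of_nat (j - 1)"
      using j by (simp add: of_nat_diff algebra_simps)
    \<comment> \<open>The normalisation of the shifted term is \<open>rGamma (w + j)\<close>; the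
      \<open>j - 1\<close> factors between it and \<open>rGamma (w + 1)\<close> form the Pochhammer
      symbol.\<close>
    have B: "rGamma (?w + 1) = pochhammer (?w + 1) (j - 1) * rGamma (?w + 1 + of_nat (j - 1))"
      by (rule pochhammer_rGamma)
    show "rGamma (?w + 1) * Gamma (s + 1) * (of_nat j * ?Z j) =
        of_nat j * pochhammer (?w + 1) (j - 1) *
        regularised (d + (m - j)) (\<lambda>x. G x * poly_eval (hom_part (m - j) f) x) (s + 1)"
      unfolding regularised_def A B by (simp only: mult_ac)
  qed
  finally show ?thesis .
qed

text \<open>The half plane of convergence widened to the left by \<open>k / m\<close>.\<close>

definition extended_half_plane :: "nat \<Rightarrow> nat \<Rightarrow> complex set" where
  "extended_half_plane d k = {s. real m * Re s + real k > real (d + CARD('n))}"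

lemma open_extended_half_plane: "open (extended_half_plane d k)"
  unfolding extended_half_plane_def by (intro open_Collect_less continuous_intros)

lemma connected_extended_half_plane: "connected (extended_half_plane d k)"
proof -
  have "extended_half_plane d k = {s. inner (of_nat m) s > real (d + CARD('n)) - real k}"
    by (auto simp: extended_half_plane_def inner_complex_def)
  then show ?thesis
    using convex_connected[OF convex_halfspace_gt] by metis
qed

lemma extended_half_plane_mono: "k \<le> l \<Longrightarrow> extended_half_plane d k \<subseteq> extended_half_plane d l"
  by (auto simp: extended_half_plane_def)

lemma half_plane_eq: "half_plane (d + CARD('n)) = extended_half_plane d 0"
  by (simp add: extended_half_plane_def)

lemma half_plane_nonempty: "half_plane k \<noteq> {}"
proof -
  have "of_real ((real k + 1) / real m) \<in> half_plane k" using m_pos by simp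
  then show ?thesis by blast
qed

text \<open>Every summand of the recurrence gains \<open>j \<ge> 1\<close>, so its right-hand side
  is already defined one step further to the left. The induction is over all \<open>d\<close> and
  \<open>G\<close>, as the recurrence changes both.\<close>

lemma partial_continuation:
  assumes "homogeneous d G"
  shows "\<exists>W. W holomorphic_on extended_half_plane d k \<and>
    (\<forall>s\<in>half_plane (d + CARD('n)). W s = regularised d G s)"
  using assms
proof (induction k arbitrary: d G)
  case 0
  then show ?case
    using holomorphic_regularised[of d G]
    by (intro exI[of _ "regularised d G"]) (simp add: extended_half_plane_def)
next
  case (Suc k)
  let ?G = "\<lambda>j x. G x * poly_eval (hom_part (m - j) f) x"
  have "\<forall>j\<in>{1..m}. \<exists>W. W holomorphic_on extended_half_plane (d + (m - j)) k \<and>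
      (\<forall>s\<in>half_plane (d + (m - j) + CARD('n)). W s = regularised (d + (m - j)) (?G j) s)"
    by (intro ballI Suc.IH homogeneous_mult_hom_part Suc.prems)
  from bchoice[OF this] obtain W where ex: "\<forall>j\<in>{1..m}. W j holomorphic_on extended_half_plane (d + (m - j)) k \<and>
      (\<forall>s\<in>half_plane (d + (m - j) + CARD('n)). W j s = regularised (d + (m - j)) (?G j) s)" ..
  have hol: "W j holomorphic_on extended_half_plane (d + (m - j)) k" if "j \<in> {1..m}" for j
    using ex that by blast
  have W: "W j s = regularised (d + (m - j)) (?G j) s"
    if "j \<in> {1..m}" "s \<in> half_plane (d + (m - j) + CARD('n))" for j s
    using ex that by blast
  define V where "V s = (\<Sum>j=1..m. of_nat j * pochhammer (of_nat m * s - of_nat (d + CARD('n)) + 1) (j - 1) *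
    W j (s + 1))" for s
  have "(\<lambda>s. W j (s + 1)) holomorphic_on extended_half_plane d (Suc k)" if j: "j \<in> {1..m}" for j
  proof -
    have "(W j \<circ> (\<lambda>s. s + 1)) holomorphic_on extended_half_plane d (Suc k)"
      by (rule holomorphic_on_compose_gen[OF _ hol[OF j]])
         (use j in \<open>auto intro!: holomorphic_intros simp: extended_half_plane_def of_nat_diff algebra_simps\<close>)
    then show ?thesis by (simp add: o_def)
  qed
  then have "V holomorphic_on extended_half_plane d (Suc k)"
    unfolding V_def[abs_def] pochhammer_prod by (intro holomorphic_intros)
  moreover have "V s = regularised d G s" if s: "s \<in> half_plane (d + CARD('n))" for s
    unfolding V_def regularised_recurrence[OF Suc.prems s]
    using s by (intro sum.cong refl arg_cong2[where f = "(*)"] W) (auto simp: of_nat_diff algebra_simps)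
  ultimately show ?case by blast
qed

text \<open>The extended half planes are nested, connected and exhaust the plane; the identity
  theorem makes the partial continuations agree, so they glue.\<close>

lemma entire_continuation:
  assumes G: "homogeneous d G"
  shows "\<exists>W. W holomorphic_on UNIV \<and> (\<forall>s\<in>half_plane (d + CARD('n)). W s = regularised d G s)"
proof -
  have "\<forall>k. \<exists>W. W holomorphic_on extended_half_plane d k \<and>
      (\<forall>s\<in>half_plane (d + CARD('n)). W s = regularised d G s)"
    using partial_continuation[OF G] by blast
  from choice[OF this] obtain V where ex: "\<forall>k. V k holomorphic_on extended_half_plane d k \<and>
      (\<forall>s\<in>half_plane (d + CARD('n)). V k s = regularised d G s)" ..
  have hol: "V k holomorphic_on extended_half_plane d k" for k
    using ex by blast
  have V: "V k s = regularised d G s" if "s \<in> half_plane (d + CARD('n))" for k s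
    using ex that by blast
  have step: "V k s = V l s" if "k \<le> l" "s \<in> extended_half_plane d k" for k l s
  proof (rule analytic_continuation_open[where f = "V k" and g = "V l"])
    show "V k holomorphic_on extended_half_plane d k" by (rule hol)
    show "V l holomorphic_on extended_half_plane d k"
      using hol extended_half_plane_mono[OF that(1)] by (rule holomorphic_on_subset)
    show "half_plane (d + CARD('n)) \<subseteq> extended_half_plane d k"
      unfolding half_plane_eq by (rule extended_half_plane_mono) simp
    show "V k s = V l s" if "s \<in> half_plane (d + CARD('n))" for s
      using that by (simp only: V)
  qed (rule open_half_plane open_extended_half_plane half_plane_nonempty connected_extended_half_plane that)+
  \<comment> \<open>An index whose half plane contains \<open>s\<close>; the added 1 makes the
    defining inequality strict.\<close>
  define K where "K s = nat \<lceil>real (d + CARD('n)) - real m * Re s\<rceil> + 1" for s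
  have K: "s \<in> extended_half_plane d (K s)" for s
    unfolding extended_half_plane_def K_def mem_Collect_eq of_nat_add of_nat_1 by linarith
  define W where "W s = V (K s) s" for s
  have W: "W s = V k s" if "s \<in> extended_half_plane d k" for k s
  proof (cases "k \<le> K s")
    case True
    show ?thesis unfolding W_def by (rule step[OF True that, symmetric])
  next
    case False
    then show ?thesis unfolding W_def by (intro step[OF _ K]) simp
  qed
  have "W holomorphic_on (\<Union>k\<in>UNIV. extended_half_plane d k)"
  proof (rule holomorphic_on_UN_open)
    fix k
    show "W holomorphic_on extended_half_plane d k"
      by (rule holomorphic_transform[OF hol]) (simp add: W)
  qed (rule open_extended_half_plane)
  moreover have "(\<Union>k\<in>UNIV. extended_half_plane d k) = UNIV" using K by auto
  ultimately have "W holomorphic_on UNIV" by simp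
  moreover have "W s = regularised d G s" if "s \<in> half_plane (d + CARD('n))" for s
    using W[of s 0] V[OF that, of 0] that unfolding half_plane_eq by simp
  ultimately show ?thesis by blast
qed

text \<open>The choice is harmless: entire functions that agree on a nonempty half plane are
  equal.\<close>

definition continued :: "nat \<Rightarrow> (real ^ 'n \<Rightarrow> complex) \<Rightarrow> complex \<Rightarrow> complex" where
  "continued d G = (SOME W. W holomorphic_on UNIV \<and> (\<forall>s\<in>half_plane (d + CARD('n)). W s = regularised d G s))"

lemma continued:
  assumes "homogeneous d G"
  shows "continued d G holomorphic_on A"
    and "s \<in> half_plane (d + CARD('n)) \<Longrightarrow> continued d G s = regularised d G s"
  using someI_ex[OF entire_continuation[OF assms]] unfolding continued_def
  by (auto intro: holomorphic_on_subset)

text \<open>Permanence of functional relations: both sides are entire and agree on the half plane of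
  convergence.\<close>

lemma continued_recurrence:
  assumes G: "homogeneous d G"
  shows "continued d G s = (\<Sum>j=1..m. of_nat j * pochhammer (of_nat m * s - of_nat (d + CARD('n)) + 1) (j - 1) *
    continued (d + (m - j)) (\<lambda>x. G x * poly_eval (hom_part (m - j) f) x) (s + 1))"
    (is "_ = ?R s")
proof (rule analytic_continuation_open[where f = "continued d G" and g = ?R and s' = UNIV])
  let ?G = "\<lambda>j x. G x * poly_eval (hom_part (m - j) f) x"
  show "continued d G holomorphic_on UNIV" by (rule continued[OF G])
  have "(\<lambda>s. continued (d + (m - j)) (?G j) (s + 1)) holomorphic_on UNIV" if j: "j \<in> {1..m}" for j
  proof -
    have "(continued (d + (m - j)) (?G j) \<circ> (\<lambda>s. s + 1)) holomorphic_on UNIV"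
      by (rule holomorphic_on_compose_gen[OF _ continued(1)[OF homogeneous_mult_hom_part[OF G j], of UNIV]])
         (auto intro!: holomorphic_intros)
    then show ?thesis by (simp add: o_def)
  qed
  then show "?R holomorphic_on UNIV"
    unfolding pochhammer_prod by (intro holomorphic_intros)
  fix s assume s: "s \<in> half_plane (d + CARD('n))"
  show "continued d G s = ?R s"
    unfolding continued(2)[OF G s] regularised_recurrence[OF G s]
    using s by (intro sum.cong refl arg_cong2[where f = "(*)"] continued(2)[symmetric] homogeneous_mult_hom_part[OF G])
      (auto simp: of_nat_diff algebra_simps)
qed (rule open_half_plane open_UNIV half_plane_nonempty connected_UNIV subset_UNIV UNIV_I)+

section \<open>Boundary integrals and the continuation at integers\<close>

lemma continuous_on_cube_boundary_top_part [continuous_intros]: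
  "continuous_on cube_boundary (\<lambda>\<sigma>. poly_eval (top_part f) \<sigma> powi i)"
  by (intro continuous_intros continuous_on_poly_eval) (use cube_boundary_nonzero top_part_nonzero in auto)

lemma continuous_on_ray_coeff: "continuous_on cube_boundary (ray_coeff f j)"
  unfolding ray_coeff_def[abs_def]
  by (intro continuous_intros continuous_on_poly_eval) (use cube_boundary_nonzero top_part_nonzero in auto)

lemma continuous_on_ray_power_coeff: "continuous_on cube_boundary (ray_power_coeff f n k)"
proof (induction n arbitrary: k)
  case 0
  then show ?case by (simp add: ray_power_coeff_0[abs_def])
next
  case (Suc n)
  then show ?case
    unfolding ray_power_coeff_Suc[abs_def] by (intro continuous_intros continuous_on_ray_coeff)
qed

text \<open>\<open>i\<close> is the integer argument \<open>s\<close>, so the weight is the top part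
  to the power \<open>-s\<close>. It is a signed integer because the recursion starts at
  \<open>-N\<close> and ends at a positive value.\<close>

definition boundary_integral :: "(real ^ 'n \<Rightarrow> complex) \<Rightarrow> int \<Rightarrow> nat \<Rightarrow> int \<Rightarrow> complex" where
  "boundary_integral G i n k =
    (LINT \<sigma>:cube_boundary|boundary_volume. ray_power_coeff f n k \<sigma> * (G \<sigma> * poly_eval (top_part f) \<sigma> powi (- i)))"

lemma boundary_integral_eq_0:
  "k > - int n \<or> k < - int (m * n) \<Longrightarrow> boundary_integral G i n k = 0"
  by (simp add: boundary_integral_def ray_power_coeff_eq_0 set_lebesgue_integral_def)

text \<open>Raising \<open>i\<close> by one divides by the top part, which turns a lower part of
  \<open>f\<close> in the numerator into a coefficient of the ray function. This mirrors the step
  from \<open>s\<close> to \<open>s + 1\<close>.\<close>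

lemma boundary_integral_hom_part:
  "boundary_integral (\<lambda>x. G x * poly_eval (hom_part (m - j) f) x) (i + 1) n k =
   (LINT \<sigma>:cube_boundary|boundary_volume. ray_coeff f j \<sigma> * ray_power_coeff f n k \<sigma> *
      (G \<sigma> * poly_eval (top_part f) \<sigma> powi (- i)))"
  unfolding boundary_integral_def
proof (rule set_lebesgue_integral_cong; (intro allI impI)?)
  fix \<sigma> :: "real ^ 'n" assume "\<sigma> \<in> cube_boundary"
  then have "poly_eval (top_part f) \<sigma> \<noteq> 0" using cube_boundary_nonzero top_part_nonzero by auto
  then have "poly_eval (top_part f) \<sigma> powi (- (i + 1)) =
      poly_eval (top_part f) \<sigma> powi (- i) / poly_eval (top_part f) \<sigma>"
    using power_int_diff[of "poly_eval (top_part f) \<sigma>" "- i" 1] by simp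
  then show "ray_power_coeff f n k \<sigma> * (G \<sigma> * poly_eval (hom_part (m - j) f) \<sigma> * poly_eval (top_part f) \<sigma> powi (- (i + 1))) =
      ray_coeff f j \<sigma> * ray_power_coeff f n k \<sigma> * (G \<sigma> * poly_eval (top_part f) \<sigma> powi (- i))"
    by (simp add: ray_coeff_def)
qed (simp add: sets_boundary_volume)

text \<open>The derivation identity for coefficients, integrated over the boundary. Its left side
  has the shape produced by the recurrence for \<open>continued\<close>.\<close>

lemma boundary_integral_derivation:
  assumes G: "homogeneous d G"
  shows "(\<Sum>j=1..m. of_nat j * boundary_integral (\<lambda>x. G x * poly_eval (hom_part (m - j) f) x) (i + 1) n (k + int j)) =
    - of_int k / of_nat (Suc n) * boundary_integral G i (Suc n) k"
proof -
  let ?g = "\<lambda>\<sigma>. G \<sigma> * poly_eval (top_part f) \<sigma> powi (- i)"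
  have cg: "continuous_on cube_boundary ?g"
    by (intro continuous_intros continuous_on_subset[OF homogeneousD(1)[OF G]] cube_boundary_subset_orthant)
  have int: "set_integrable boundary_volume cube_boundary
      (\<lambda>\<sigma>. of_nat j * (ray_coeff f j \<sigma> * ray_power_coeff f n (k + int j) \<sigma> * ?g \<sigma>))" for j
    by (intro integrable_continuous_on_cube_boundary(1) continuous_intros continuous_on_ray_coeff
        continuous_on_ray_power_coeff cg)
  have "(\<Sum>j=1..m. of_nat j * boundary_integral (\<lambda>x. G x * poly_eval (hom_part (m - j) f) x) (i + 1) n (k + int j)) =
      (\<Sum>j=1..m. LINT \<sigma>:cube_boundary|boundary_volume. of_nat j * (ray_coeff f j \<sigma> * ray_power_coeff f n (k + int j) \<sigma> * ?g \<sigma>))"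
    unfolding boundary_integral_hom_part by simp
  also have "\<dots> = (LINT \<sigma>:cube_boundary|boundary_volume.
      (\<Sum>j=1..m. of_nat j * (ray_coeff f j \<sigma> * ray_power_coeff f n (k + int j) \<sigma> * ?g \<sigma>)))"
    using int unfolding set_lebesgue_integral_def set_integrable_def scaleR_sum_right
    by (intro Bochner_Integration.integral_sum[symmetric]) auto
  also have "\<dots> = (LINT \<sigma>:cube_boundary|boundary_volume.
      - of_int k / of_nat (Suc n) * (ray_power_coeff f (Suc n) k \<sigma> * ?g \<sigma>))"
  proof -
    have "(\<Sum>j=1..m. of_nat j * (ray_coeff f j \<sigma> * ray_power_coeff f n (k + int j) \<sigma> * ?g \<sigma>)) =
        - of_int k / of_nat (Suc n) * (ray_power_coeff f (Suc n) k \<sigma> * ?g \<sigma>)" for \<sigma>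
    proof -
      have "(\<Sum>j=1..m. of_nat j * (ray_coeff f j \<sigma> * ray_power_coeff f n (k + int j) \<sigma>)) =
          - of_int k / of_nat (Suc n) * ray_power_coeff f (Suc n) k \<sigma>"
        using ray_power_coeff_derivation[of k f n \<sigma>] by (simp add: field_simps del: of_nat_Suc)
      then have "(\<Sum>j=1..m. of_nat j * (ray_coeff f j \<sigma> * ray_power_coeff f n (k + int j) \<sigma>)) * ?g \<sigma> =
          - of_int k / of_nat (Suc n) * ray_power_coeff f (Suc n) k \<sigma> * ?g \<sigma>" by simp
      then show ?thesis by (simp only: sum_distrib_right mult.assoc)
    qed
    then show ?thesis by simp
  qed
  also have "\<dots> = - of_int k / of_nat (Suc n) * boundary_integral G i (Suc n) k"
    unfolding boundary_integral_def by (rule set_integral_mult_right)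
  finally show ?thesis .
qed

text \<open>The point lies on the edge of convergence, so \<open>continued\<close> is not known to
  equal \<open>regularised\<close> there. One step of the recurrence leads to convergent integrals,
  whose sum is the boundary term.\<close>

lemma continued_boundary_value:
  assumes G: "homogeneous d G" and n: "m * n = d + CARD('n)"
  shows "continued d G (of_nat n) = Gamma (of_nat n) * boundary_integral G (int n) 0 0"
proof -
  let ?G = "\<lambda>j x. G x * poly_eval (hom_part (m - j) f) x"
  have n0: "n > 0" using n by (cases n) auto
  have n': "of_nat m * (of_nat n :: complex) = of_nat (d + CARD('n))"
    unfolding n[symmetric] by simp
  have nr: "real m * real n = real (d + CARD('n))"
    unfolding n[symmetric] by simp
  have "of_nat j * pochhammer (of_nat m * of_nat n - of_nat (d + CARD('n)) + 1) (j - 1) *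
      continued (d + (m - j)) (?G j) (of_nat n + 1) = Gamma (of_nat n) * (of_nat n * (of_nat j * Z (?G j) (of_nat n + 1)))"
    if j: "j \<in> {1..m}" for j
  proof -
    have "continued (d + (m - j)) (?G j) (of_nat n + 1) = regularised (d + (m - j)) (?G j) (of_nat n + 1)"
      using j nr by (intro continued(2) homogeneous_mult_hom_part[OF G]) (auto simp: of_nat_diff algebra_simps)
    also have "\<dots> = rGamma (of_nat j) * Gamma (of_nat n + 1) * Z (?G j) (of_nat n + 1)"
    proof -
      have "of_nat m * (of_nat n + 1) - of_nat (d + (m - j) + CARD('n)) = (of_nat j :: complex)"
        using j n' by (simp add: of_nat_diff algebra_simps)
      then show ?thesis by (simp only: regularised_def)
    qed
    also have "Gamma (of_nat n + 1 :: complex) = of_nat n * Gamma (of_nat n)"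
      using n0 by (intro Gamma_plus1 Re_pos_not_nonpos_Int) simp
    finally have "continued (d + (m - j)) (?G j) (of_nat n + 1) =
        rGamma (of_nat j) * (of_nat n * Gamma (of_nat n)) * Z (?G j) (of_nat n + 1)" .
    \<comment> \<open>Since \<open>m n - p - d = 0\<close>, the Pochhammer symbol starts at 1 and
      equals \<open>(j - 1)!\<close>, the inverse of \<open>rGamma j\<close>.\<close>
    moreover have "pochhammer (1 :: complex) (j - 1) * rGamma (of_nat j) = 1"
    proof -
      have "pochhammer (1 :: complex) (j - 1) * rGamma (1 + of_nat (j - 1)) = rGamma 1"
        by (rule pochhammer_rGamma[symmetric])
      then show ?thesis using j by (simp add: of_nat_diff)
    qed
    ultimately show ?thesis
      using n' by (simp add: mult_ac)
  qed
  then have "continued d G (of_nat n) =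
      Gamma (of_nat n) * (of_nat n * (\<Sum>j=1..m. of_nat j * Z (?G j) (of_nat n + 1)))"
    unfolding continued_recurrence[OF G] sum_distrib_left by (intro sum.cong refl)
  then show ?thesis
    unfolding Z_boundary_value[OF G n]
    by (simp add: boundary_integral_def ray_power_coeff_0 power_int_minus divide_inverse)
qed

text \<open>The recurrence takes \<open>T\<close> to \<open>T - j\<close>, and for
  \<open>j > T\<close> its Pochhammer factor is zero, so the induction never jumps past
  \<open>T = 0\<close>. If \<open>i + n \<le> 0\<close>, the Gamma factor sits at a pole and has a
  default value; but then \<open>m (i + n) < d + p\<close>, that is \<open>m n < T\<close>, and the
  boundary integral vanishes.\<close>

lemma continued_value:
  assumes "homogeneous d G" and "int T = int (d + CARD('n)) - int m * i"
  shows "continued d G (of_int i) = (- 1) ^ T * fact T *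
    (\<Sum>n\<le>T. Gamma (of_int (i + int n)) * (- 1) ^ n / fact n * boundary_integral G i n (- int T))"
  using assms
proof (induction T arbitrary: d G i rule: less_induct)
  case (less T)
  note G = less.prems(1)
  let ?G = "\<lambda>j x. G x * poly_eval (hom_part (m - j) f) x"
  show ?case
  proof (cases T)
    case 0
    with less.prems have eq: "int m * i = int (d + CARD('n))" by simp
    then have "i > 0"
      by (metis of_nat_0_less_iff add_gr_0 zero_less_card_finite zero_less_mult_pos m_pos)
    then obtain n where i: "i = int n" by (metis nonneg_int_cases less_imp_le)
    with eq have "int (m * n) = int (d + CARD('n))" by simp
    then have n: "m * n = d + CARD('n)" by (simp only: of_nat_eq_iff)
    show ?thesis using continued_boundary_value[OF G n] by (simp add: 0 i)
  next
    case (Suc t)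
    define g :: "nat \<Rightarrow> complex" where "g n = Gamma (of_int (i + 1 + int n)) * (- 1) ^ n / fact n" for n
    define J where "J j n = boundary_integral (?G j) (i + 1) n (- int T + int j)" for j n
    have w: "of_nat m * of_int i - of_nat (d + CARD('n)) + 1 = (- of_nat t :: complex)"
    proof -
      have "of_int (int T) = (of_int (int (d + CARD('n)) - int m * i) :: complex)"
        using less.prems(2) by (rule arg_cong)
      then show ?thesis by (simp add: Suc algebra_simps)
    qed
    \<comment> \<open>This lets the inner sums, of length depending on \<open>j\<close>, all run up
      to \<open>t\<close>, and also disposes of \<open>j > T\<close>.\<close>
    have J0: "J j n = 0" if "int T < int j + int n" for j n
      unfolding J_def by (rule boundary_integral_eq_0) (use that in auto)
    have summand: "of_nat j * pochhammer (- of_nat t) (j - 1) * continued (d + (m - j)) (?G j) (of_int i + 1) =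
        (- 1) ^ t * fact t * (\<Sum>n\<le>t. g n * (of_nat j * J j n))" if j: "j \<in> {1..m}" for j
    proof (cases "j \<le> T")
      case True
      have "continued (d + (m - j)) (?G j) (of_int (i + 1)) = (- 1) ^ (T - j) * fact (T - j) *
          (\<Sum>n\<le>T - j. Gamma (of_int (i + 1 + int n)) * (- 1) ^ n / fact n * boundary_integral (?G j) (i + 1) n (- int (T - j)))"
        using j True less.prems(2)
        by (intro less.IH homogeneous_mult_hom_part[OF G]) (auto simp: of_nat_diff algebra_simps)
      also have "(\<Sum>n\<le>T - j. Gamma (of_int (i + 1 + int n)) * (- 1) ^ n / fact n * boundary_integral (?G j) (i + 1) n (- int (T - j))) =
          (\<Sum>n\<le>T - j. g n * J j n)"
        using True by (simp add: g_def J_def of_nat_diff)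
      also have "\<dots> = (\<Sum>n\<le>t. g n * J j n)"
        using j True Suc by (intro sum.mono_neutral_left) (auto intro!: J0)
      finally have c: "continued (d + (m - j)) (?G j) (of_int i + 1) =
          (- 1) ^ (T - j) * fact (T - j) * (\<Sum>n\<le>t. g n * J j n)" by simp
      have Tj: "T - j = t - (j - 1)" and jt: "j - 1 \<le> t" using j Suc True by auto
      \<comment> \<open>The combined factor is the same for every \<open>j\<close>, so the sum over
        \<open>j\<close> can be carried out inside and matched with the derivation identity.\<close>
      have "pochhammer (- of_nat t :: complex) (j - 1) * ((- 1) ^ (T - j) * fact (T - j)) =
          (- 1) ^ (t - (j - 1)) * ((- 1) ^ (j - 1) * fact t)"
        unfolding Tj pochhammer_neg_of_nat_mult_fact[OF jt, symmetric] by simp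
      also have "\<dots> = (- 1) ^ t * fact t"
        using jt by (simp flip: power_add mult.assoc)
      finally show ?thesis
        unfolding c sum_distrib_left mult.assoc[symmetric]
        by (simp add: mult_ac sum_distrib_left)
    next
      case False
      then have "pochhammer (- of_nat t :: complex) (j - 1) = 0"
        using Suc by (intro pochhammer_of_nat_eq_0_lemma) simp
      moreover have "J j n = 0" for n using False by (intro J0) simp
      ultimately show ?thesis by simp
    qed
    have "continued d G (of_int i) = (\<Sum>j=1..m. (- 1) ^ t * fact t * (\<Sum>n\<le>t. g n * (of_nat j * J j n)))"
      unfolding continued_recurrence[OF G, of "of_int i"] w by (intro sum.cong refl summand)
    also have "\<dots> = (- 1) ^ t * fact t * (\<Sum>n\<le>t. g n * (\<Sum>j=1..m. of_nat j * J j n))"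
      unfolding sum_distrib_left by (rule sum.swap)
    also have "\<dots> = (- 1) ^ t * fact t * (\<Sum>n\<le>t. g n * (of_nat T / of_nat (Suc n) * boundary_integral G i (Suc n) (- int T)))"
      unfolding J_def boundary_integral_derivation[OF G] by simp
    \<comment> \<open>\<open>T * fact t\<close> is \<open>fact T\<close>, the factor
      \<open>n + 1\<close> completes \<open>fact (Suc n)\<close>, and the two sign changes cancel.
      The Gamma argument is the same on both sides, since \<open>i + 1\<close> and \<open>n\<close>
      became \<open>i\<close> and \<open>n + 1\<close>.\<close>
    also have "\<dots> = (- 1) ^ T * fact T *
        (\<Sum>n\<le>t. Gamma (of_int (i + int (Suc n))) * (- 1) ^ Suc n / fact (Suc n) * boundary_integral G i (Suc n) (- int T))"
      unfolding sum_distrib_left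
    proof (rule sum.cong[OF refl])
      fix n
      have "Gamma (of_int (i + int (Suc n))) = (Gamma (of_int (i + 1 + int n)) :: complex)"
        by (simp add: add_ac)
      then show "(- 1) ^ t * fact t * (g n * (of_nat T / of_nat (Suc n) * boundary_integral G i (Suc n) (- int T))) =
          (- 1) ^ T * fact T * (Gamma (of_int (i + int (Suc n))) * (- 1) ^ Suc n / fact (Suc n) *
            boundary_integral G i (Suc n) (- int T))"
        by (simp add: g_def Suc field_simps del: of_nat_Suc of_int_add)
    qed
    \<comment> \<open>The missing summand \<open>n = 0\<close> vanishes: the zeroth power has no
      term of exponent \<open>-T\<close> when \<open>T > 0\<close>.\<close>
    also have "(\<Sum>n\<le>t. Gamma (of_int (i + int (Suc n))) * (- 1) ^ Suc n / fact (Suc n) * boundary_integral G i (Suc n) (- int T)) =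
        (\<Sum>n\<le>T. Gamma (of_int (i + int n)) * (- 1) ^ n / fact n * boundary_integral G i n (- int T))"
      unfolding Suc using boundary_integral_eq_0[where k = "- int (Suc t)" and n = 0 and G = G and i = i] by (subst sum.atMost_Suc_shift) simp
    finally show ?thesis .
  qed
qed

section \<open>The value at nonpositive integers\<close>

definition pole_argument :: "nat \<Rightarrow> complex \<Rightarrow> complex" where
  "pole_argument d s = of_nat m * s - of_nat (d + CARD('n))"

text \<open>Undoes the normalisation for each homogeneous part of \<open>g\<close>. At a pole of a
  Gamma factor the value is only a default, so limits are taken from it there.\<close>

definition zeta_formula :: "'n cpoly \<Rightarrow> complex \<Rightarrow> complex" where
  "zeta_formula g s = (\<Sum>d\<le>total_degree g.
     rGamma s * continued d (poly_eval (hom_part d g)) s * Gamma (pole_argument d s))"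

lemma zeta_formula_meromorphic: "zeta_formula g meromorphic_on UNIV"
proof -
  have hol: "h meromorphic_on UNIV" if "h holomorphic_on UNIV" for h :: "complex \<Rightarrow> complex"
    using that by (simp add: analytic_on_imp_meromorphic_on analytic_on_open)
  show ?thesis
    \<comment> \<open>Unfolding Gamma as the inverse of the entire function \<open>rGamma\<close>
      exhibits each summand as a quotient of entire functions.\<close>
    unfolding zeta_formula_def[abs_def] Gamma_def pole_argument_def
    by (intro meromorphic_on_sum meromorphic_on_mult meromorphic_on_inverse hol continued(1)
        homogeneous_hom_part holomorphic_intros)
qed

lemma Gamma_mult_rGamma: "Re s > 0 \<Longrightarrow> Gamma s * rGamma s = (1 :: complex)"
  using Re_pos_not_nonpos_Int[of s] by (simp add: Gamma_def rGamma_eq_zero_iff)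

lemma pole_argument_Re_pos:
  "d \<le> k \<Longrightarrow> s \<in> half_plane (k + CARD('n)) \<Longrightarrow> Re (pole_argument d s) > 0"
  by (auto simp: pole_argument_def)

lemma zeta_formula_convergent:
  assumes s: "s \<in> half_plane (total_degree g + CARD('n))"
  shows "zeta_formula g s = zeta_integral g L s"
proof -
  let ?q = "total_degree g"
  let ?g = "\<lambda>d. poly_eval (hom_part d g)"
  have sd: "s \<in> half_plane (d + CARD('n))" if "d \<le> ?q" for d
    using s that by auto
  have "zeta_formula g s = (\<Sum>d\<le>?q. Z (?g d) s)"
    unfolding zeta_formula_def
  proof (rule sum.cong[OF refl])
    fix d assume "d \<in> {..?q}"
    then have d: "d \<le> ?q" by simp
    have "rGamma s * continued d (?g d) s * Gamma (pole_argument d s) =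
        (Gamma s * rGamma s) * (Gamma (pole_argument d s) * rGamma (pole_argument d s)) * Z (?g d) s"
      unfolding continued(2)[OF homogeneous_hom_part sd[OF d]] regularised_def pole_argument_def
      by (simp only: mult_ac)
    then show "rGamma s * continued d (?g d) s * Gamma (pole_argument d s) = Z (?g d) s"
      using Gamma_mult_rGamma half_plane_Re_pos[OF s] pole_argument_Re_pos[OF d s] by simp
  qed
  also have "\<dots> = (LINT x:orthant|lborel. \<Sum>d\<le>?q. ?g d x * exp (- s * L x))"
    unfolding Z_def set_lebesgue_integral_def scaleR_sum_right
    using integrable_integrand[OF homogeneous_hom_part, of _ s g] sd
    by (intro Bochner_Integration.integral_sum[symmetric]) (auto simp: set_integrable_def)
  also have "\<dots> = zeta_integral g L s"
    unfolding zeta_integral_def poly_eval_eq_sum_hom_part[of g] sum_distrib_right ..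
  finally show ?thesis .
qed

text \<open>Removing singularities keeps the value at analytic points; this secures agreement with
  the integral in the half plane.\<close>

lemma zeta_formula_analytic:
  assumes s: "s \<in> half_plane (total_degree g + CARD('n))"
  shows "zeta_formula g analytic_on {s}"
proof (rule holomorphic_on_imp_analytic_at[OF _ open_half_plane s])
  let ?H = "half_plane (total_degree g + CARD('n))"
  have "(\<lambda>s. Gamma (pole_argument d s)) holomorphic_on ?H" if d: "d \<le> total_degree g" for d
  proof -
    have "(Gamma \<circ> pole_argument d) holomorphic_on ?H"
    proof (rule holomorphic_on_compose_gen)
      show "pole_argument d holomorphic_on ?H"
        unfolding pole_argument_def[abs_def] by (intro holomorphic_intros)
      show "Gamma holomorphic_on {z :: complex. Re z > 0}"
        by (intro holomorphic_intros) (use Re_pos_not_nonpos_Int in auto)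
      show "pole_argument d ` ?H \<subseteq> {z. Re z > 0}"
        using pole_argument_Re_pos[OF d] by blast
    qed
    then show ?thesis by (simp add: o_def)
  qed
  then show "zeta_formula g holomorphic_on ?H"
    unfolding zeta_formula_def[abs_def]
    by (intro holomorphic_on_sum holomorphic_on_mult continued(1) homogeneous_hom_part)
       (auto intro: holomorphic_intros)
qed

text \<open>The residue of Gamma at \<open>-T\<close>, divided by the slope \<open>m\<close> of the
  inner linear function.\<close>

lemma Gamma_pole_argument_limit:
  assumes T: "T = d + CARD('n) + m * N"
  shows "(\<lambda>s. Gamma (pole_argument d s) * (s + of_nat N)) \<midarrow>- of_nat N\<rightarrow> (- 1) ^ T / fact T / of_nat m"
proof -
  have m: "of_nat m \<noteq> (0 :: complex)" using m_pos by simp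
  have shift: "pole_argument d s + of_nat T = of_nat m * (s + of_nat N)" for s
    by (simp add: pole_argument_def T algebra_simps)
  have "isCont (pole_argument d) (- of_nat N)"
    unfolding pole_argument_def[abs_def] by (intro continuous_intros)
  moreover have "pole_argument d (- of_nat N) = - of_nat T"
    by (simp add: pole_argument_def T)
  ultimately have "pole_argument d \<midarrow>- of_nat N\<rightarrow> - of_nat T"
    by (simp add: isCont_def)
  moreover have "\<forall>\<^sub>F s in at (- of_nat N). pole_argument d s \<noteq> - of_nat T"
  proof -
    have "pole_argument d s \<noteq> - of_nat T" if "s \<noteq> - of_nat N" for s
    proof
      assume "pole_argument d s = - of_nat T"
      with shift[of s] m have "s + of_nat N = 0" by simp
      with that show False by (simp add: add_eq_0_iff2)
    qed
    then show ?thesis by (auto simp: eventually_at_filter)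
  qed
  ultimately have "filterlim (pole_argument d) (at (- of_nat T)) (at (- of_nat N))"
    by (simp add: filterlim_at)
  from filterlim_compose[OF Gamma_residues this]
  have "(\<lambda>s. Gamma (pole_argument d s) * (of_nat m * (s + of_nat N))) \<midarrow>- of_nat N\<rightarrow> (- 1) ^ T / fact T"
    by (simp only: shift)
  then have "(\<lambda>s. Gamma (pole_argument d s) * (of_nat m * (s + of_nat N)) / of_nat m) \<midarrow>- of_nat N\<rightarrow>
      (- 1) ^ T / fact T / of_nat m"
    using m by (intro tendsto_intros)
  then show ?thesis using m by simp
qed

text \<open>\<open>rGamma\<close> has a simple zero at \<open>-N\<close> with slope
  \<open>(-1)^N N!\<close>, which cancels the simple pole of the Gamma factor. The residue of the
  latter also removes the \<open>(-1)^T T!\<close> of the continued value.\<close>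

lemma zeta_formula_limit:
  "zeta_formula g \<midarrow>- of_nat N\<rightarrow> (\<Sum>d\<le>total_degree g. (- 1) ^ N * fact N / of_nat m *
     (\<Sum>n\<le>d + CARD('n) + m * N. Gamma (of_int (int n - int N)) * (- 1) ^ n / fact n *
        boundary_integral (poly_eval (hom_part d g)) (- int N) n (- int (d + CARD('n) + m * N))))"
  unfolding zeta_formula_def[abs_def]
proof (rule tendsto_sum)
  fix d
  let ?G = "poly_eval (hom_part d g)"
  define T where "T = d + CARD('n) + m * N"
  define S where "S = (\<Sum>n\<le>T. Gamma (of_int (int n - int N)) * (- 1) ^ n / fact n *
    boundary_integral ?G (- int N) n (- int T))"
  have "continued d ?G (of_int (- int N)) = (- 1) ^ T * fact T *
    (\<Sum>n\<le>T. Gamma (of_int (- int N + int n)) * (- 1) ^ n / fact n * boundary_integral ?G (- int N) n (- int T))"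
    by (rule continued_value[OF homogeneous_hom_part]) (simp add: T_def)
  then have val: "continued d ?G (- of_nat N) = (- 1) ^ T * fact T * S"
    by (simp add: S_def)
  have "isCont (continued d ?G) (- of_nat N)"
    using holomorphic_on_imp_continuous_on[OF continued(1)[OF homogeneous_hom_part[of d g], of UNIV]]
    by (simp add: continuous_on_eq_continuous_at)
  then have "continued d ?G \<midarrow>- of_nat N\<rightarrow> (- 1) ^ T * fact T * S"
    by (simp add: isCont_def val)
  with Gamma_pole_argument_limit[OF T_def] rGamma_zeros[of N]
  have "(\<lambda>s. rGamma s / (s + of_nat N) * continued d ?G s * (Gamma (pole_argument d s) * (s + of_nat N)))
      \<midarrow>- of_nat N\<rightarrow> ((- 1) ^ N * fact N) * ((- 1) ^ T * fact T * S) * ((- 1) ^ T / fact T / of_nat m)"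
    by (intro tendsto_mult)
  moreover have "\<forall>\<^sub>F s in at (- of_nat N). rGamma s / (s + of_nat N) * continued d ?G s *
      (Gamma (pole_argument d s) * (s + of_nat N)) = rGamma s * continued d ?G s * Gamma (pole_argument d s)"
    by (auto simp: eventually_at_filter add_eq_0_iff2)
  ultimately have "(\<lambda>s. rGamma s * continued d ?G s * Gamma (pole_argument d s)) \<midarrow>- of_nat N\<rightarrow>
      ((- 1) ^ N * fact N) * ((- 1) ^ T * fact T * S) * ((- 1) ^ T / fact T / of_nat m)"
    by (rule Lim_transform_eventually)
  also have "((- 1) ^ N * fact N) * ((- 1) ^ T * fact T * S) * ((- 1) ^ T / fact T / of_nat m) =
      (- 1) ^ N * fact N / of_nat m * S"
  proof -
    have "(- 1) ^ T * (- 1) ^ T = (1 :: complex)" by (simp flip: power_add)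
    moreover have "((- 1) ^ N * fact N) * ((- 1) ^ T * fact T * S) * ((- 1) ^ T / fact T / of_nat m) =
        ((- 1) ^ T * (- 1) ^ T) * ((- 1) ^ N * fact N / of_nat m * S)"
      by simp
    ultimately show ?thesis by simp
  qed
  finally show "(\<lambda>s. rGamma s * continued d ?G s * Gamma (pole_argument d s)) \<midarrow>- of_nat N\<rightarrow>
      (- 1) ^ N * fact N / of_nat m * (\<Sum>n\<le>d + CARD('n) + m * N. Gamma (of_int (int n - int N)) * (- 1) ^ n / fact n *
        boundary_integral ?G (- int N) n (- int (d + CARD('n) + m * N)))"
    unfolding S_def T_def .
qed

text \<open>The finite limits at \<open>-N\<close> make those singularities removable, which is the
  regularity demanded of the continuation; uniqueness then identifies it.\<close>

lemma zeta_eq_remove_sings: "zeta f g L = remove_sings (zeta_formula g)"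
proof -
  have "is_zeta_continuation f g L (remove_sings (zeta_formula g))"
    unfolding is_zeta_continuation_def
  proof (intro conjI allI impI)
    show "remove_sings (zeta_formula g) nicely_meromorphic_on UNIV"
      by (rule remove_sings_nicely_meromorphic[OF zeta_formula_meromorphic])
    have "isolated_singularity_at (zeta_formula g) s" for s
      using zeta_formula_meromorphic[of g] meromorphic_on_isolated_singularity meromorphic_on_subset by blast
    then show "remove_sings (zeta_formula g) analytic_on {- of_nat n}" for n
      by (rule remove_sings_analytic_at) (rule zeta_formula_limit)
    fix s assume "Re s > real (total_degree g + CARD('n)) / real m"
    then have "s \<in> half_plane (total_degree g + CARD('n))"
      using m_pos by (simp add: field_simps)
    then show "remove_sings (zeta_formula g) s = zeta_integral g L s"
      by (simp only: remove_sings_at_analytic[OF zeta_formula_analytic] zeta_formula_convergent)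
  qed
  then show ?thesis
    unfolding zeta_def using is_zeta_continuation_unique by blast
qed

text \<open>A part of \<open>g\<close> of degree \<open>d\<close> raises the exponent by
  \<open>d\<close>, so the coefficients at \<open>-(d + p + m N)\<close> for all \<open>d\<close>
  add up to the single one at \<open>-(p + m N)\<close> in the product.\<close>

lemma sum_boundary_integral:
  "(\<Sum>d\<le>total_degree g. boundary_integral (poly_eval (hom_part d g)) (- int N) n (- int (d + CARD('n) + m * N))) =
   (LINT \<sigma>:cube_boundary|boundary_volume. C_coeff f g n N \<sigma> * poly_eval (top_part f) \<sigma> ^ N)"
proof -
  let ?c = "\<lambda>d \<sigma>. ray_power_coeff f n (- int (d + CARD('n) + m * N)) \<sigma>"
  let ?h = "\<lambda>d \<sigma>. ?c d \<sigma> * (poly_eval (hom_part d g) \<sigma> * poly_eval (top_part f) \<sigma> powi int N)"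
  have "set_integrable boundary_volume cube_boundary (?h d)" for d
    by (intro integrable_continuous_on_cube_boundary(1) continuous_intros continuous_on_ray_power_coeff
        continuous_on_poly_eval)
  then have "(\<Sum>d\<le>total_degree g. boundary_integral (poly_eval (hom_part d g)) (- int N) n (- int (d + CARD('n) + m * N))) =
      (LINT \<sigma>:cube_boundary|boundary_volume. \<Sum>d\<le>total_degree g. ?h d \<sigma>)"
    unfolding boundary_integral_def set_lebesgue_integral_def set_integrable_def scaleR_sum_right minus_minus
    by (intro Bochner_Integration.integral_sum[symmetric]) auto
  also have "(\<lambda>\<sigma>. \<Sum>d\<le>total_degree g. ?h d \<sigma>) = (\<lambda>\<sigma>. C_coeff f g n N \<sigma> * poly_eval (top_part f) \<sigma> ^ N)"
  proof
    fix \<sigma>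
    have "C_coeff f g n N \<sigma> = (\<Sum>d\<le>total_degree g. poly_eval (hom_part d g) \<sigma> * ?c d \<sigma>)"
      unfolding C_coeff_def ray_poly_def sum_distrib_right lookup_sum lookup_single_mult ray_power_coeff_def[symmetric]
      by (intro sum.cong refl arg_cong2[where f = "(*)"] arg_cong[where f = "\<lambda>k. ray_power_coeff f n k \<sigma>"])
         (simp add: algebra_simps)
    then show "(\<Sum>d\<le>total_degree g. ?h d \<sigma>) = C_coeff f g n N \<sigma> * poly_eval (top_part f) \<sigma> ^ N"
      unfolding power_int_of_nat by (simp only: sum_distrib_right) (intro sum.cong refl, simp only: mult_ac)
  qed
  finally show ?thesis .
qed

lemma zeta_value:
  "zeta f g L (- of_nat N) = (- 1) ^ N * fact N / of_nat m *
    (\<Sum>n = N + nat \<lceil>real CARD('n) / real m\<rceil>..total_degree g + CARD('n) + N * m.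
       Gamma (of_int (int n - int N)) * (- 1) ^ n / fact n *
       (LINT \<sigma>:cube_boundary|boundary_volume. C_coeff f g n N \<sigma> * poly_eval (top_part f) \<sigma> ^ N))"
proof -
  let ?p = "CARD('n)" and ?q = "total_degree g"
  let ?A = "{N + nat \<lceil>real ?p / real m\<rceil>..?q + ?p + N * m}"
  define c :: "nat \<Rightarrow> complex" where "c n = Gamma (of_int (int n - int N)) * (- 1) ^ n / fact n" for n
  define I where "I d n = boundary_integral (poly_eval (hom_part d g)) (- int N) n (- int (d + ?p + m * N))" for d n
  \<comment> \<open>The lower limit: a nonzero integral needs
    \<open>m n \<ge> d + p + m N \<ge> p + m N\<close>, that is
    \<open>n \<ge> N + p / m\<close>.\<close>
  have I0: "I d n = 0" if "d \<le> ?q" "n \<le> ?q + ?p + N * m" "n \<notin> ?A" for d n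
  proof -
    have "0 \<le> \<lceil>real ?p / real m\<rceil>"
      by (rule order_trans[OF _ ceiling_mono[of 0]]) auto
    then have "int n - int N < \<lceil>real ?p / real m\<rceil>"
      using that(2,3) unfolding atLeastAtMost_iff by linarith
    then have "real n < real N + real ?p / real m"
      unfolding less_ceiling_iff by simp
    then have "real m * real n < real m * (real N + real ?p / real m)"
      using m_pos by (intro mult_strict_left_mono) auto
    also have "\<dots> = real (m * N + ?p)"
      using m_pos by (simp add: field_simps)
    finally have "m * n < m * N + ?p"
      by (simp only: of_nat_mult[symmetric] of_nat_less_iff)
    then have "- int (d + ?p + m * N) < - int (m * n)" by linarith
    then show ?thesis unfolding I_def by (intro boundary_integral_eq_0) auto
  qed
  \<comment> \<open>The upper limit: terms beyond \<open>d + p + m N\<close> vanish, so a common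
    range serves all \<open>d\<close> and the two sums can be exchanged.\<close>
  have range: "(\<Sum>n\<le>d + ?p + m * N. c n * I d n) = (\<Sum>n\<in>?A. c n * I d n)" if d: "d \<le> ?q" for d
  proof -
    have "(\<Sum>n\<le>d + ?p + m * N. c n * I d n) = (\<Sum>n\<le>?q + ?p + N * m. c n * I d n)"
    proof (rule sum.mono_neutral_left)
      have "I d n = 0" if "n > d + ?p + m * N" for n
        unfolding I_def by (rule boundary_integral_eq_0) (use that in linarith)
      then show "\<forall>n\<in>{..?q + ?p + N * m} - {..d + ?p + m * N}. c n * I d n = 0"
        by simp
    qed (use d in \<open>auto simp: mult.commute\<close>)
    also have "\<dots> = (\<Sum>n\<in>?A. c n * I d n)"
      using d I0 by (intro sum.mono_neutral_right) auto
    finally show ?thesis .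
  qed
  have "zeta f g L (- of_nat N) = (\<Sum>d\<le>?q. (- 1) ^ N * fact N / of_nat m * (\<Sum>n\<le>d + ?p + m * N. c n * I d n))"
    unfolding zeta_eq_remove_sings c_def I_def by (rule remove_sings_eqI[OF zeta_formula_limit])
  also have "\<dots> = (- 1) ^ N * fact N / of_nat m * (\<Sum>d\<le>?q. \<Sum>n\<in>?A. c n * I d n)"
    by (simp add: range sum_distrib_left)
  also have "(\<Sum>d\<le>?q. \<Sum>n\<in>?A. c n * I d n) = (\<Sum>n\<in>?A. c n * (\<Sum>d\<le>?q. I d n))"
    unfolding sum_distrib_left by (rule sum.swap)
  finally show ?thesis
    unfolding c_def I_def sum_boundary_integral .
qed

end

theorem theorem7:
  fixes f g :: "'n::finite cpoly"
    and L :: "real ^ 'n \<Rightarrow> complex"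
    and N :: nat
  defines "p \<equiv> CARD('n)"
    and "m \<equiv> total_degree f"
    and "q \<equiv> total_degree g"
  assumes "mahler_hypothesis f"
    and "log_branch f L"
  shows "zeta f g L (- of_nat N) =
    1 / of_nat m *
    (\<Sum>l = N + nat \<lceil>real p / real m\<rceil>..q + p + N * m.
       (- 1) ^ (l - N) / of_nat (l - N) * (1 / of_nat (l choose N)) *
       (LINT \<sigma>:cube_boundary|boundary_volume.
          C_coeff f g l N \<sigma> * poly_eval (top_part f) \<sigma> ^ N))"
proof -
  interpret mahler_log f L by standard fact+
  define J where "J l = (LINT \<sigma>:cube_boundary|boundary_volume. C_coeff f g l N \<sigma> * poly_eval (top_part f) \<sigma> ^ N)" for l
  let ?A = "{N + nat \<lceil>real p / real m\<rceil>..q + p + N * m}"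
  \<comment> \<open>\<open>Gamma (l - N)\<close> is \<open>(l - N - 1)!\<close>, and
    \<open>N! (l - N - 1)! / l!\<close> is the inverse of \<open>l - N\<close> times the binomial
    coefficient.\<close>
  have coeff: "(- 1) ^ N * fact N * (Gamma (of_int (int l - int N)) * (- 1) ^ l / fact l) =
      ((- 1) ^ (l - N) / of_nat (l - N) * (1 / of_nat (l choose N)) :: complex)" if l: "l \<in> ?A" for l
  proof -
    \<comment> \<open>Since \<open>p > 0\<close>, the summation starts above \<open>N\<close>, so
      Gamma is evaluated at positive integers only.\<close>
    have "real p / real m > 0" using m_pos by (simp add: p_def m_def)
    then have "nat \<lceil>real p / real m\<rceil> > 0" by simp
    with l have "l > N" unfolding atLeastAtMost_iff by linarith
    then obtain k where k: "l = N + Suc k" by (auto dest: less_imp_Suc_add)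
    have G: "Gamma (of_int (int l - int N) :: complex) = fact k"
      using Gamma_fact[of k, where ?'a = complex] by (simp add: k)
    have B: "(of_nat (l choose N) :: complex) = fact l / (fact N * fact (Suc k))"
      using binomial_fact[of N l, where ?'a = complex] by (simp add: k)
    have S: "(- 1) ^ N * (- 1) ^ l = ((- 1) ^ (l - N) :: complex)"
      by (simp add: k power_add flip: mult.assoc power_mult_distrib)
    have "(- 1) ^ N * fact N * (Gamma (of_int (int l - int N)) * (- 1) ^ l / fact l) =
        ((- 1) ^ N * (- 1) ^ l) * (fact N * fact k / fact l :: complex)"
      unfolding G by simp
    also have "\<dots> = (- 1) ^ (l - N) / of_nat (l - N) * (1 / of_nat (l choose N))"
      unfolding S B by (simp add: k field_simps del: of_nat_Suc)
    finally show ?thesis .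
  qed
  have "zeta f g L (- of_nat N) = 1 / of_nat m *
      (\<Sum>l\<in>?A. (- 1) ^ N * fact N * (Gamma (of_int (int l - int N)) * (- 1) ^ l / fact l) * J l)"
    unfolding zeta_value p_def m_def q_def J_def sum_distrib_left by (intro sum.cong refl) simp
  also have "\<dots> = 1 / of_nat m * (\<Sum>l\<in>?A. (- 1) ^ (l - N) / of_nat (l - N) * (1 / of_nat (l choose N)) * J l)"
    by (intro arg_cong[where f = "\<lambda>x. 1 / of_nat m * x"] sum.cong refl) (simp only: coeff)
  finally show ?thesis unfolding J_def .
qed

end
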